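(* Let $X_1,X_2,\dots$ be i.i.d. with law $P$ on $[0,1]^d$. For each $n$ let $m=m(n)$ and let $0<u_1<\dots<u_m<1$ ($u_i=u_i^{(n)}$) be a grid, and put $k=d\cdot m(n)$. Assume $$0<\liminf_{n\to\infty}\min_{1\le i\le m-1}k(u_{i+1}-u_i)\le\limsup_{n\to\infty}\max_{1\le i\le m-1}k(u_{i+1}-u_i)<\infty .$$ Assume that $P$ belongs to the set $\Omega$ of probability measures on $[0,1]^d$ with uniform marginals and that $P$ has a density bounded below by some positive number. Let further $\lim_{n\to\infty}k=\infty$ and $\lim_{n\to\infty}k^{7/2}n^{-1/2}=0$. Then $$\frac{n\chi_{n,k}^2-k}{\sqrt{2k}}=\frac{\underline{\gamma}_{n,k}'\,S_{n,k}^{-1}\,\underline{\gamma}_{n,k}-k}{\sqrt{2k}}$$ has limiting standard normal distribution.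
   Context: For $u\in[0,1]$, $j\in\{1,\dots,d\}$, $\mathbf{1}_{u,j}:[0,1]^d\to\{0,1\}$ is defined by $\mathbf{1}_{u,j}(x_1,\dots,x_d)=1$ if $x_j\le u$ and $0$ otherwise. $\mathcal{F}_n=\{\mathbf{1}_{u_i,j}: i=1,\dots,m,\ j=1,\dots,d\}$, which has $k=md$ elements; the grids are such that $\mathcal{F}_n\subseteq\mathcal{F}_{n+1}$ for all $n$. $Q_0$ denotes the uniform distribution on $[0,1]^d$, and $Qf=\int f\,dQ$. $P_n=\frac1n\sum_{i\le n}\delta_{X_i}$. $\chi_{n,k}^2=\sup_f\ (Q_0-P_n)f-\frac14P_nf^2$, the supremum being over the linear span of $\mathcal{F}_n\cup\{1\}$. $\underline{\gamma}_{n,k}$ is the $k$-vector with entries $\sqrt n(P_n-P)f$, $f\in\mathcal{F}_n$, and $S_{n,k}$ is the $k\times k$ empirical covariance matrix with entries $P_nfg-P_nf\,P_ng$, $f,g\in\mathcal{F}_n$.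
   Formalization: The lower spacing bound is also assumed for the end gaps, liminf k·min(u_1, 1−u_m) > 0; without it u_1 can be exponentially small in n along a subsequence, making S singular and χ² infinite with probability tending to 1. *)

theory Defs
  imports
    "Jordan_Normal_Form.Gauss_Jordan_Elimination"
    "HOL-Library.Function_Algebras"
    "HOL-Probability.Probability"
begin

definition Q0 :: "(real^'d) measure" where
  "Q0 = uniform_measure lborel (cbox 0 1)"

definition Omega :: "(real^'d) measure set" where
  "Omega = {P. prob_space P \<and> sets P = sets borel \<and> emeasure P (cbox 0 1) = 1 \<and>
     (\<forall>j. distr P borel (\<lambda>x. vec_nth x j) = uniform_measure lborel {0..1})}"

definition half_ind :: "real \<Rightarrow> 'd \<Rightarrow> real^'d \<Rightarrow> real" where
  "half_ind v j x = (if vec_nth x j \<le> v then 1 else 0)"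

definition ind_class :: "(nat \<Rightarrow> real) \<Rightarrow> nat \<Rightarrow> (real^'d \<Rightarrow> real) set" where
  "ind_class g m = {half_ind (g i) j | i j. i \<in> {1..m}}"

text \<open>The empirical measure of \<open>x 1, \<dots>, x n\<close>, as an integral operator.\<close>

definition emp :: "nat \<Rightarrow> (nat \<Rightarrow> 'a) \<Rightarrow> ('a \<Rightarrow> real) \<Rightarrow> real" where
  "emp n x f = (\<Sum>i=1..n. f (x i)) / real n"

interpretation fun_space: vector_space "\<lambda>(c::real) (f::'a \<Rightarrow> real) x. c * f x"
  by unfold_locales (auto simp: fun_eq_iff algebra_simps)

text \<open>Extended-real valued: the supremum is \<open>\<infinity>\<close> for some samples whose empirical
  covariance matrix is singular.\<close>

definition chi_sq :: "nat \<Rightarrow> (nat \<Rightarrow> real^'d) \<Rightarrow> (real^'d \<Rightarrow> real) set \<Rightarrow> ereal" where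
  "chi_sq n x F = (SUP f \<in> fun_space.span (F \<union> {\<lambda>_. 1}).
     ereal (((\<integral>y. f y \<partial>Q0) - emp n x f) - 1/4 * emp n x (\<lambda>y. (f y)\<^sup>2)))"

text \<open>Vectors and matrices indexed by the functions in a finite set \<open>F\<close>, listed in the
  order \<open>from_nat_into F 0, from_nat_into F 1, \<dots>\<close>. The quadratic form below does not depend
  on this order.\<close>

definition gamma_vec ::
  "(real^'d) measure \<Rightarrow> nat \<Rightarrow> (nat \<Rightarrow> real^'d) \<Rightarrow> (real^'d \<Rightarrow> real) set \<Rightarrow> real Matrix.vec" where
  "gamma_vec P n x F = Matrix.vec (card F)
     (\<lambda>a. sqrt (real n) * (emp n x (from_nat_into F a) - (\<integral>y. from_nat_into F a y \<partial>P)))"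

definition emp_cov :: "nat \<Rightarrow> (nat \<Rightarrow> 'a) \<Rightarrow> ('a \<Rightarrow> real) set \<Rightarrow> real Matrix.mat" where
  "emp_cov n x F = Matrix.mat (card F) (card F)
     (\<lambda>(a, b). emp n x (\<lambda>y. from_nat_into F a y * from_nat_into F b y)
               - emp n x (from_nat_into F a) * emp n x (from_nat_into F b))"

text \<open>The form \<open>v' A\<^sup>-\<^sup>1 v\<close>, set to \<open>0\<close> by convention when \<open>A\<close> is singular.\<close>

definition inv_quad_form :: "real Matrix.mat \<Rightarrow> real Matrix.vec \<Rightarrow> real" where
  "inv_quad_form A v =
     (case mat_inverse A of Some B \<Rightarrow> scalar_prod v (B *\<^sub>v v) | None \<Rightarrow> 0)"

end

theory Submission
  imports Defs "Jordan_Normal_Form.Determinant"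
begin

text \<open>
  Let \<open>e\<^sub>1, \<dots>, e\<^sub>k\<close> be an orthonormal basis, in \<open>L\<^sup>2(P)\<close>, of the centred span of the indicators, and
  \<open>W = n\<^sup>-\<^sup>1\<^sup>/\<^sup>2 \<Sum>\<^sub>i e(X\<^sub>i)\<close>. Completing the square shows that \<open>n \<chi>\<^sup>2\<close> is the quadratic form in the inverse
  empirical covariance, in whatever basis of the span; in the basis \<open>e\<close> the covariance is close to the
  identity, so \<open>n \<chi>\<^sup>2\<close> is close to \<open>|W|\<^sup>2\<close>. Removing one summand from \<open>W\<close> and expanding to second order
  shows that the characteristic function \<open>\<phi>\<close> of \<open>(|W|\<^sup>2 - k) / (2k)\<^sup>1\<^sup>/\<^sup>2\<close> satisfies \<open>\<phi>'(t) = - t \<phi>(t)\<close> up to a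
  small error, hence is close to \<open>exp (- t\<^sup>2 / 2)\<close>. Both steps need \<open>|e(x)|\<^sup>2 = O(k\<^sup>2)\<close>, which follows from a
  lower bound of order \<open>1/k\<close> on the variance of step functions: the density bound reduces it to the
  uniform distribution, where a translation across each grid point isolates one coefficient.
\<close>

section \<open>Bounded measurable functions on product spaces\<close>

text \<open>Since \<open>k\<close> grows with \<open>n\<close>, no central limit theorem in a fixed
  dimension applies, and only |W|^2 is followed. The engine is the identity that the sum over i of
  sqrt n <W, e(X_i)> equals n |W|^2. Weighted with exp (i s (|W|^2 - k)) and averaged, each summand
  is handled by integrating out its own observation, and contributes about k + 2 i s k times the
  average weight. For s = t / sqrt (2k) the second part, divided by sqrt (2k), is i t; this is the
  origin of the factor 2 in the normalisation. The basis e is not explicit, but chi^2 depends on the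
  indicators only through their span with the constants, so its value may be computed in either
  basis and no change-of-basis matrix is inverted. Rates: a spacing c/k gives a variance bound
  \<open>\<kappa>\<close> of order 1/k, hence |e(x)|^2 \<le> k / \<open>\<kappa>\<close>. The
  characteristic function costs 1 / sqrt k + k^3 / sqrt n. Replacing the covariance by the identity
  costs a relative error k^2 / sqrt n; on the event |W|^2 < k^2, which Markov's inequality makes
  likely, and after division by sqrt (2k), this becomes k^(7/2) / sqrt n.\<close>

definition bdd_meas :: "'a measure \<Rightarrow> ('a \<Rightarrow> 'b::{banach,second_countable_topology,real_normed_algebra_1}) \<Rightarrow> bool"
  where "bdd_meas M f \<longleftrightarrow> f \<in> borel_measurable M \<and> (\<exists>C. \<forall>x\<in>space M. norm (f x) \<le> C)"

lemma bdd_measI: "f \<in> borel_measurable M \<Longrightarrow> (\<And>x. x \<in> space M \<Longrightarrow> norm (f x) \<le> C) \<Longrightarrow> bdd_meas M f"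
  unfolding bdd_meas_def by blast

lemma bdd_meas_measurable: "bdd_meas M f \<Longrightarrow> f \<in> borel_measurable M"
  unfolding bdd_meas_def by blast

lemma bdd_measE:
  assumes "bdd_meas M f"
  obtains C where "C \<ge> 0" "\<And>x. x \<in> space M \<Longrightarrow> norm (f x) \<le> C"
proof -
  obtain C where "\<forall>x\<in>space M. norm (f x) \<le> C" using assms unfolding bdd_meas_def by blast
  then show ?thesis by (intro that[of "max 0 C"]) (auto simp: max.coboundedI2)
qed

lemma bdd_meas_const: "bdd_meas M (\<lambda>_. c)"
  by (rule bdd_measI[of _ _ "norm c"]) auto

lemma bdd_meas_add:
  assumes "bdd_meas M f" "bdd_meas M g" shows "bdd_meas M (\<lambda>x. f x + g x)"
proof -
  obtain C where "\<And>x. x \<in> space M \<Longrightarrow> norm (f x) \<le> C" using bdd_measE[OF assms(1)] by blast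
  moreover obtain D where "\<And>x. x \<in> space M \<Longrightarrow> norm (g x) \<le> D" using bdd_measE[OF assms(2)] by blast
  ultimately show ?thesis using assms
    by (intro bdd_measI[of _ _ "C + D"] borel_measurable_add)
       (auto dest: bdd_meas_measurable intro: norm_triangle_mono)
qed

lemma bdd_meas_mult:
  assumes "bdd_meas M f" "bdd_meas M g" shows "bdd_meas M (\<lambda>x. f x * g x)"
proof -
  obtain C where C: "C \<ge> 0" "\<And>x. x \<in> space M \<Longrightarrow> norm (f x) \<le> C" using bdd_measE[OF assms(1)] by blast
  obtain D where D: "D \<ge> 0" "\<And>x. x \<in> space M \<Longrightarrow> norm (g x) \<le> D" using bdd_measE[OF assms(2)] by blast
  have "norm (f x * g x) \<le> C * D" if "x \<in> space M" for x
    using norm_mult_ineq[of "f x" "g x"] mult_mono[OF C(2)[OF that] D(2)[OF that] C(1)] by force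
  then show ?thesis using assms
    by (intro bdd_measI[of _ _ "C * D"] borel_measurable_times) (auto dest: bdd_meas_measurable)
qed

lemma bdd_meas_uminus: "bdd_meas M f \<Longrightarrow> bdd_meas M (\<lambda>x. - f x)"
  using bdd_meas_mult[OF bdd_meas_const[of M "-1"]] by fastforce

lemma bdd_meas_diff: "bdd_meas M f \<Longrightarrow> bdd_meas M g \<Longrightarrow> bdd_meas M (\<lambda>x. f x - g x)"
  using bdd_meas_add[OF _ bdd_meas_uminus, of M f g] by simp

lemma bdd_meas_sum: "(\<And>a. a \<in> A \<Longrightarrow> bdd_meas M (f a)) \<Longrightarrow> bdd_meas M (\<lambda>x. \<Sum>a\<in>A. f a x)"
  by (induction A rule: infinite_finite_induct) (auto intro: bdd_meas_const bdd_meas_add)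

lemma bdd_meas_power: "bdd_meas M f \<Longrightarrow> bdd_meas M (\<lambda>x. f x ^ m)"
  by (induction m) (auto intro: bdd_meas_const bdd_meas_mult)

lemma bdd_meas_divide:
  fixes f :: "'a \<Rightarrow> 'b::{banach,second_countable_topology,real_normed_field}"
  shows "bdd_meas M f \<Longrightarrow> bdd_meas M (\<lambda>x. f x / c)"
  using bdd_meas_mult[OF _ bdd_meas_const[of M "inverse c"]] by (simp add: divide_inverse)

lemma bdd_meas_of_real:
  fixes f :: "'a \<Rightarrow> real"
  shows "bdd_meas M f \<Longrightarrow> bdd_meas M (\<lambda>x. complex_of_real (f x))"
  unfolding bdd_meas_def by auto

lemma bdd_meas_cis: "bdd_meas M f \<Longrightarrow> bdd_meas M (\<lambda>x. cis (f x))"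
  by (rule bdd_measI[of _ _ 1]) (auto simp: cis_conv_exp dest!: bdd_meas_measurable)

lemmas bdd_meas_intros = bdd_meas_const bdd_meas_add bdd_meas_mult bdd_meas_diff bdd_meas_sum bdd_meas_power
  bdd_meas_divide bdd_meas_of_real bdd_meas_cis

lemma (in prob_space) bdd_meas_integrable: "bdd_meas M f \<Longrightarrow> integrable M f"
  unfolding bdd_meas_def by (auto intro!: integrable_const_bound)

lemma bdd_meas_component:
  assumes "bdd_meas P g" "i \<in> I" shows "bdd_meas (Pi\<^sub>M I (\<lambda>_. P)) (\<lambda>x. g (x i))"
proof -
  obtain C where C: "\<And>x. x \<in> space P \<Longrightarrow> norm (g x) \<le> C" using bdd_measE[OF assms(1)] by blast
  have [measurable]: "g \<in> borel_measurable P" using assms(1) by (rule bdd_meas_measurable)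
  have "(\<lambda>x. g (x i)) \<in> borel_measurable (Pi\<^sub>M I (\<lambda>_. P))" using assms(2) by measurable
  moreover have "norm (g (x i)) \<le> C" if "x \<in> space (Pi\<^sub>M I (\<lambda>_. P))" for x
    using that assms(2) by (intro C) (auto simp: space_PiM dest: PiE_mem)
  ultimately show ?thesis by (rule bdd_measI)
qed

context prob_space
begin

abbreviation sample :: "'i set \<Rightarrow> ('i \<Rightarrow> 'a) measure" where
  "sample I \<equiv> Pi\<^sub>M I (\<lambda>_. M)"

lemma prob_space_sample: "prob_space (sample I)"
  by (intro prob_space_PiM) (rule prob_space_axioms)

text \<open>The bound in \<open>bdd_meas\<close> holds at every point of the space rather than
  almost everywhere, so it survives fixing all coordinates but one; this gives the integrability
  that iterated integrals need at each fixed \<open>x\<close>.\<close>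

lemma bdd_meas_fun_upd:
  assumes f: "bdd_meas (sample (insert i I)) f" and x: "x \<in> space (sample I)"
  shows "bdd_meas M (\<lambda>y. f (x(i := y)))"
proof -
  have [measurable]: "(\<lambda>y. x(i := y)) \<in> measurable M (sample (insert i I))"
    using measurable_comp[OF measurable_Pair1'[OF x] measurable_add_dim] by (simp add: comp_def)
  obtain C where C: "\<And>x. x \<in> space (sample (insert i I)) \<Longrightarrow> norm (f x) \<le> C" using bdd_measE[OF f] by blast
  have [measurable]: "f \<in> borel_measurable (sample (insert i I))" using f by (rule bdd_meas_measurable)
  show ?thesis
    by (rule bdd_measI[of _ _ C]) (auto intro!: C measurable_space[of "\<lambda>y. x(i := y)" M])
qed

lemma bdd_meas_integral_fun_upd:
  assumes f: "bdd_meas (sample (insert i I)) f"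
  shows "bdd_meas (sample I) (\<lambda>x. \<integral>y. f (x(i := y)) \<partial>M)"
proof -
  obtain C where C: "C \<ge> 0" "\<And>x. x \<in> space (sample (insert i I)) \<Longrightarrow> norm (f x) \<le> C"
    using bdd_measE[OF f] by blast
  have [measurable]: "f \<in> borel_measurable (sample (insert i I))" using f by (rule bdd_meas_measurable)
  have [measurable]: "(\<lambda>(x, y). x(i := y)) \<in> measurable (sample I \<Otimes>\<^sub>M M) (sample (insert i I))"
    by (rule measurable_add_dim)
  show ?thesis
  proof (rule bdd_measI[of _ _ C])
    show "(\<lambda>x. \<integral>y. f (x(i := y)) \<partial>M) \<in> borel_measurable (sample I)"
      by (rule borel_measurable_lebesgue_integral) measurable
    fix x assume x: "x \<in> space (sample I)"
    have "norm (\<integral>y. f (x(i := y)) \<partial>M) \<le> (\<integral>y. norm (f (x(i := y))) \<partial>M)" by (rule integral_norm_bound)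
    also have "\<dots> \<le> (\<integral>y. C \<partial>M)"
    proof (rule integral_mono)
      show "integrable M (\<lambda>y. norm (f (x(i := y))))"
        by (intro integrable_norm bdd_meas_integrable bdd_meas_fun_upd[OF f x])
      fix y assume "y \<in> space M"
      then have "(x, y) \<in> space (sample I \<Otimes>\<^sub>M M)" using x by (simp add: space_pair_measure)
      from measurable_space[OF measurable_add_dim this]
      show "norm (f (x(i := y))) \<le> C" by (intro C) simp
    qed simp
    also have "\<dots> = C" by (simp add: prob_space)
    finally show "norm (\<integral>y. f (x(i := y)) \<partial>M) \<le> C" .
  qed
qed

lemma integral_sample_insert:
  assumes "finite I" "i \<notin> I" and f: "bdd_meas (sample (insert i I)) f"
  shows "(\<integral>x. f x \<partial>sample (insert i I)) = (\<integral>x. (\<integral>y. f (x(i := y)) \<partial>M) \<partial>sample I)"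
proof -
  interpret product_sigma_finite "\<lambda>_. M" by unfold_locales
  show ?thesis
    using assms(1,2) by (rule product_integral_insert)
      (rule prob_space.bdd_meas_integrable[OF prob_space_sample f])
qed

lemma integral_bdd_meas_approx:
  assumes "bdd_meas M f" "bdd_meas M g" "bdd_meas M h"
    and "\<And>x. x \<in> space M \<Longrightarrow> norm (f x - g x) \<le> h x"
  shows "norm ((\<integral>x. f x \<partial>M) - (\<integral>x. g x \<partial>M)) \<le> (\<integral>x. h x \<partial>M)"
proof -
  have "(\<integral>x. f x \<partial>M) - (\<integral>x. g x \<partial>M) = (\<integral>x. f x - g x \<partial>M)"
    using assms by (simp add: bdd_meas_integrable)
  also have "norm \<dots> \<le> (\<integral>x. norm (f x - g x) \<partial>M)" by (rule integral_norm_bound)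
  also have "\<dots> \<le> (\<integral>x. h x \<partial>M)"
    using assms by (intro integral_mono integrable_norm bdd_meas_integrable bdd_meas_diff)
  finally show ?thesis .
qed

text \<open>The form in which one observation is removed: the defect of the inner integral is
  estimated separately for each fixed remainder \<open>x\<close>, and the error \<open>h\<close> is
  averaged over the smaller sample only.\<close>

lemma integral_sample_insert_approx:
  assumes "finite I" "i \<notin> I" and f: "bdd_meas (sample (insert i I)) f"
    and g: "bdd_meas (sample I) g" and h: "bdd_meas (sample I) h"
    and le: "\<And>x. x \<in> space (sample I) \<Longrightarrow> norm ((\<integral>y. f (x(i := y)) \<partial>M) - g x) \<le> h x"
  shows "norm ((\<integral>x. f x \<partial>sample (insert i I)) - (\<integral>x. g x \<partial>sample I)) \<le> (\<integral>x. h x \<partial>sample I)"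
  unfolding integral_sample_insert[OF assms(1-3)]
  using prob_space.integral_bdd_meas_approx[OF prob_space_sample bdd_meas_integral_fun_upd[OF f] g h le] .

text \<open>Induction on the index set: the cross term with the new observation integrates to 0
  because \<open>g\<close> is centred, and its square adds one variance.\<close>

lemma integral_sample_sum_square:
  fixes g :: "'a \<Rightarrow> real" and I :: "'i set"
  assumes "finite I" and g: "bdd_meas M g" and g0: "(\<integral>y. g y \<partial>M) = 0"
  shows "(\<integral>x. (\<Sum>i\<in>I. g (x i))\<^sup>2 \<partial>sample I) = card I * (\<integral>y. (g y)\<^sup>2 \<partial>M)"
  using \<open>finite I\<close>
proof (induction I rule: finite_induct)
  case (insert i I)
  let ?S = "\<lambda>x::'i \<Rightarrow> 'a. \<Sum>i\<in>I. g (x i)"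
  have S: "bdd_meas (sample J) (\<lambda>x. \<Sum>i\<in>J. g (x i))" for J :: "'i set"
    by (intro bdd_meas_sum bdd_meas_component[OF g])
  have "(\<integral>y. (\<Sum>j\<in>insert i I. g ((x(i := y)) j))\<^sup>2 \<partial>M) = (?S x)\<^sup>2 + (\<integral>y. (g y)\<^sup>2 \<partial>M)" for x
  proof -
    have "(\<Sum>j\<in>insert i I. g ((x(i := y)) j))\<^sup>2 = (?S x)\<^sup>2 + 2 * ?S x * g y + (g y)\<^sup>2" for y
    proof -
      have "(\<Sum>j\<in>I. g ((x(i := y)) j)) = ?S x" using insert by (intro sum.cong) auto
      then show ?thesis using insert by (simp add: power2_eq_square algebra_simps)
    qed
    then show ?thesis
      using g0 bdd_meas_integrable[OF g] bdd_meas_integrable[OF bdd_meas_power[OF g, of 2]]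
      by (simp add: prob_space)
  qed
  then have "(\<integral>x. (\<Sum>j\<in>insert i I. g (x j))\<^sup>2 \<partial>sample (insert i I)) =
      (\<integral>x. (?S x)\<^sup>2 + (\<integral>y. (g y)\<^sup>2 \<partial>M) \<partial>sample I)"
    by (simp only: integral_sample_insert[OF insert(1,2) bdd_meas_power[OF S]])
  also have "\<dots> = (\<integral>x. (?S x)\<^sup>2 \<partial>sample I) + (\<integral>y. (g y)\<^sup>2 \<partial>M)"
    using prob_space.bdd_meas_integrable[OF prob_space_sample bdd_meas_power[OF S, of _ 2]]
      prob_space.bdd_meas_integrable[OF prob_space_sample bdd_meas_const]
      prob_space.prob_space[OF prob_space_sample]
    by (subst Bochner_Integration.integral_add) auto
  also have "\<dots> = card (insert i I) * (\<integral>y. (g y)\<^sup>2 \<partial>M)"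
    using insert by (simp add: algebra_simps)
  finally show ?case .
qed (simp add: prob_space.prob_space prob_space_sample)

end

section \<open>Sums of independent orthonormal vectors\<close>

lemma norm_cis_minus_1_le: "norm (cis x - 1) \<le> \<bar>x\<bar>"
  using iexp_approx1[of x 0] by (simp add: cis_conv_exp)

lemma norm_cis_minus_linear_le: "norm (cis x - 1 - \<i> * x) \<le> x\<^sup>2 / 2"
  using iexp_approx1[of x 1] by (simp add: cis_conv_exp numeral_2_eq_2 algebra_simps)

lemma diff_sq_le: "(x - y)\<^sup>2 \<le> 2 * x\<^sup>2 + 2 * (y::real)\<^sup>2"
  using zero_le_power2[of "x + y"] by (simp add: power2_sum power2_diff)

text \<open>The coefficient of \<open>x\<^sup>2\<close> has to be exactly 1: the bound is applied
  once per observation in the variance induction, and a larger factor would compound.\<close>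

lemma add_sq_le: "(x + (y + z))\<^sup>2 \<le> x\<^sup>2 + 2 * x * (y + z) + 2 * y\<^sup>2 + 2 * (z::real)\<^sup>2"
  using zero_le_power2[of "y - z"] by (simp add: power2_eq_square algebra_simps)

lemma integral_double_sum:
  fixes f :: "nat \<Rightarrow> nat \<Rightarrow> 'a \<Rightarrow> real"
  assumes "\<And>a b. a < k \<Longrightarrow> b < k \<Longrightarrow> integrable M (f a b)"
  shows "(\<integral>x. (\<Sum>a<k. \<Sum>b<k. f a b x) \<partial>M) = (\<Sum>a<k. \<Sum>b<k. \<integral>x. f a b x \<partial>M)"
proof -
  have "(\<integral>x. (\<Sum>b<k. f a b x) \<partial>M) = (\<Sum>b<k. \<integral>x. f a b x \<partial>M)" if "a < k" for a
    using assms that by (intro Bochner_Integration.integral_sum) auto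
  then show ?thesis
    using assms by (subst Bochner_Integration.integral_sum) (auto intro!: Bochner_Integration.integrable_sum)
qed

text \<open>Parseval's identity, used for the functionals \<open>ip\<close> and for the reproducing
  kernel that bounds the basis pointwise.\<close>

lemma integral_orthonormal_sq:
  fixes e :: "nat \<Rightarrow> 'a \<Rightarrow> real"
  assumes int: "\<And>a b. a < N \<Longrightarrow> b < N \<Longrightarrow> integrable M (\<lambda>y. e a y * e b y)"
    and orth: "\<And>a b. a < N \<Longrightarrow> b < N \<Longrightarrow> (\<integral>y. e a y * e b y \<partial>M) = (if a = b then 1 else 0)"
  shows "(\<integral>y. (\<Sum>a<N. v a * e a y)\<^sup>2 \<partial>M) = (\<Sum>a<N. (v a)\<^sup>2)"
proof -
  have "(\<Sum>a<N. v a * e a y)\<^sup>2 = (\<Sum>a<N. \<Sum>b<N. v a * v b * (e a y * e b y))" for y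
    unfolding power2_eq_square sum_product by (simp add: mult_ac)
  then have "(\<integral>y. (\<Sum>a<N. v a * e a y)\<^sup>2 \<partial>M) = (\<integral>y. (\<Sum>a<N. \<Sum>b<N. v a * v b * (e a y * e b y)) \<partial>M)"
    by simp
  also have "\<dots> = (\<Sum>a<N. \<Sum>b<N. \<integral>y. v a * v b * (e a y * e b y) \<partial>M)"
    using int by (intro integral_double_sum integrable_mult_right)
  also have "\<dots> = (\<Sum>a<N. \<Sum>b<N. if a = b then v a * v b else 0)"
    by (intro sum.cong refl) (simp add: orth)
  finally show ?thesis by (simp add: power2_eq_square)
qed

lemma sum_squares_nonposD:
  fixes v :: "nat \<Rightarrow> real"
  assumes "\<kappa> > 0" "\<kappa> * (\<Sum>a<N. (v a)\<^sup>2) \<le> 0"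
  shows "\<forall>a<N. v a = 0"
proof -
  have "(\<Sum>a<N. (v a)\<^sup>2) \<le> 0" using assms by (simp add: mult_le_0_iff)
  then have "(\<Sum>a<N. (v a)\<^sup>2) = 0" by (meson antisym sum_nonneg zero_le_power2)
  then show ?thesis by (subst (asm) sum_nonneg_eq_0_iff) auto
qed

text \<open>\<open>B\<close> bounds the diagonal of the reproducing kernel of the span of the
  \<open>e a\<close> (its Christoffel function). Together with \<open>k\<close> and the sample size
  it controls all error terms.\<close>

locale orthonormal_system = prob_space M for M :: "'a measure" +
  fixes e :: "nat \<Rightarrow> 'a \<Rightarrow> real" and k :: nat and B :: real
  assumes k_pos: "k \<ge> 1"
    and e_meas: "a < k \<Longrightarrow> e a \<in> borel_measurable M"
    and e_mean: "a < k \<Longrightarrow> (\<integral>y. e a y \<partial>M) = 0"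
    and e_orth: "a < k \<Longrightarrow> b < k \<Longrightarrow> (\<integral>y. e a y * e b y \<partial>M) = (if a = b then 1 else 0)"
    and e_bound: "y \<in> space M \<Longrightarrow> (\<Sum>a<k. (e a y)\<^sup>2) \<le> B"
begin

definition nsq :: "(nat \<Rightarrow> real) \<Rightarrow> real" where "nsq v = (\<Sum>a<k. (v a)\<^sup>2)"

definition ip :: "(nat \<Rightarrow> real) \<Rightarrow> 'a \<Rightarrow> real" where "ip v y = (\<Sum>a<k. v a * e a y)"

definition rsq :: "'a \<Rightarrow> real" where "rsq y = (\<Sum>a<k. (e a y)\<^sup>2)"

text \<open>The normalisation \<open>sqrt n\<close> is independent of \<open>card I\<close>, because
  the sum over \<open>n - 1\<close> observations left after a removal is still divided by
  \<open>sqrt n\<close>.\<close>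

definition wvec :: "nat \<Rightarrow> 'i set \<Rightarrow> ('i \<Rightarrow> 'a) \<Rightarrow> nat \<Rightarrow> real"
  where "wvec n I x a = (\<Sum>i\<in>I. e a (x i)) / sqrt n"

lemma nsq_nonneg: "nsq v \<ge> 0" by (simp add: nsq_def sum_nonneg)

lemma rsq_nonneg: "rsq y \<ge> 0" by (simp add: rsq_def sum_nonneg)

lemma rsq_le: "y \<in> space M \<Longrightarrow> rsq y \<le> B" by (simp add: rsq_def e_bound)

lemma ip_sq_le_rsq: "(ip v y)\<^sup>2 \<le> nsq v * rsq y"
  unfolding ip_def nsq_def rsq_def by (rule Cauchy_Schwarz_ineq_sum)

lemma bdd_meas_e: assumes "a < k" shows "bdd_meas M (e a)"
proof (rule bdd_measI[OF e_meas[OF assms]])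
  fix y assume y: "y \<in> space M"
  have "(e a y)\<^sup>2 \<le> rsq y" unfolding rsq_def using assms by (intro member_le_sum) auto
  also have "\<dots> \<le> B" using y by (rule rsq_le)
  finally show "norm (e a y) \<le> sqrt B" using real_le_rsqrt real_sqrt_le_mono by fastforce
qed

lemma bdd_meas_ip: "bdd_meas M (ip v)"
  unfolding ip_def by (intro bdd_meas_intros bdd_meas_e) auto

lemma bdd_meas_rsq: "bdd_meas M rsq"
  unfolding rsq_def by (intro bdd_meas_intros bdd_meas_e) auto

lemma bdd_meas_wvec:
  assumes "a < k" shows "bdd_meas (sample I) (\<lambda>x. wvec n I x a)"
  unfolding wvec_def
  by (intro bdd_meas_intros bdd_meas_component[OF bdd_meas_e[OF assms]])

lemma bdd_meas_nsq_wvec: "bdd_meas (sample I) (\<lambda>x. nsq (wvec n I x))"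
  unfolding nsq_def by (intro bdd_meas_intros bdd_meas_wvec) auto

lemma integral_ip: "(\<integral>y. ip v y \<partial>M) = 0"
  unfolding ip_def by (subst Bochner_Integration.integral_sum)
    (auto simp: e_mean bdd_meas_integrable bdd_meas_e)

lemma integral_rsq: "(\<integral>y. rsq y \<partial>M) = k"
  unfolding rsq_def by (subst Bochner_Integration.integral_sum)
    (auto simp: e_orth power2_eq_square intro!: bdd_meas_integrable bdd_meas_mult bdd_meas_e)

lemma integral_ip_sq: "(\<integral>y. (ip v y)\<^sup>2 \<partial>M) = nsq v"
  unfolding ip_def nsq_def
  by (intro integral_orthonormal_sq e_orth bdd_meas_integrable bdd_meas_mult bdd_meas_e)

text \<open>The template to which the one-observation expansions are reduced: the linear term is
  centred, and the two quadratic ones have known means by orthonormality.\<close>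

lemma integral_ip_rsq:
  "(\<integral>y. A0 + A1 * ip v y + A2 * (ip v y)\<^sup>2 + A3 * rsq y \<partial>M) = A0 + A2 * nsq v + A3 * k"
  using bdd_meas_integrable[OF bdd_meas_ip[of v]]
    bdd_meas_integrable[OF bdd_meas_power[OF bdd_meas_ip[of v], of 2]]
    bdd_meas_integrable[OF bdd_meas_rsq]
  by (simp add: integral_ip integral_rsq integral_ip_sq prob_space)

text \<open>The mean of \<open>rsq\<close> is \<open>k\<close>, so no pointwise bound can be
  smaller. In particular \<open>B \<ge> 1\<close>.\<close>

lemma k_le_B: "k \<le> B"
proof -
  have "(\<integral>y. rsq y \<partial>M) \<le> (\<integral>y. B \<partial>M)"
    by (intro integral_mono bdd_meas_integrable bdd_meas_rsq bdd_meas_const rsq_le)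
  then show ?thesis by (simp add: integral_rsq prob_space)
qed

lemma nsq_add: "nsq (\<lambda>a. v a + e a y * c) = nsq v + 2 * c * ip v y + c\<^sup>2 * rsq y"
  unfolding nsq_def ip_def rsq_def
  by (simp add: power2_sum power_mult_distrib sum.distrib sum_distrib_left algebra_simps)

lemma ip_add: "ip (\<lambda>a. v a + e a y * c) y = ip v y + c * rsq y"
  unfolding ip_def rsq_def
  by (simp add: power2_eq_square sum.distrib sum_distrib_left algebra_simps)

lemma wvec_fun_upd:
  assumes "finite I" "i \<notin> I"
  shows "wvec n (insert i I) (x(i := y)) = (\<lambda>a. wvec n I x a + e a y * (1 / sqrt n))"
proof
  fix a
  have "(\<Sum>j\<in>I. e a ((x(i := y)) j)) = (\<Sum>j\<in>I. e a (x j))" using assms by (intro sum.cong) auto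
  then show "wvec n (insert i I) (x(i := y)) a = wvec n I x a + e a y * (1 / sqrt n)"
    using assms by (simp add: wvec_def add_divide_distrib)
qed

lemma nsq_wvec_fun_upd:
  assumes "finite I" "i \<notin> I"
  shows "nsq (wvec n (insert i I) (x(i := y)))
    = nsq (wvec n I x) + (2 * ip (wvec n I x) y / sqrt n + rsq y / n)"
  unfolding wvec_fun_upd[OF assms] nsq_add by (simp add: power_divide)

lemma integral_nsq_wvec:
  assumes "finite I" "n > 0"
  shows "(\<integral>x. nsq (wvec n I x) \<partial>sample I) = real (card I) * k / n"
proof -
  have b: "bdd_meas (sample I) (\<lambda>x. (\<Sum>i\<in>I. e a (x i))\<^sup>2)" if "a < k" for a
    by (intro bdd_meas_intros bdd_meas_component[OF bdd_meas_e[OF that]])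
  have "nsq (wvec n I x) = (\<Sum>a<k. (\<Sum>i\<in>I. e a (x i))\<^sup>2) / n" for x
    unfolding nsq_def wvec_def power_divide sum_divide_distrib[symmetric] by simp
  then have "(\<integral>x. nsq (wvec n I x) \<partial>sample I) = (\<integral>x. (\<Sum>a<k. (\<Sum>i\<in>I. e a (x i))\<^sup>2) / n \<partial>sample I)"
    by simp
  also have "\<dots> = (\<Sum>a<k. (\<integral>x. (\<Sum>i\<in>I. e a (x i))\<^sup>2 \<partial>sample I)) / n"
    by (subst Bochner_Integration.integral_divide_zero, subst Bochner_Integration.integral_sum)
       (auto intro!: prob_space.bdd_meas_integrable[OF prob_space_sample] b)
  also have "\<dots> = (\<Sum>a<k. real (card I)) / n"
    using integral_sample_sum_square[OF \<open>finite I\<close> bdd_meas_e e_mean] e_orth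
    by (intro arg_cong2[where f="(/)"] sum.cong refl) (auto simp: power2_eq_square)
  finally show ?thesis by simp
qed

text \<open>Induction on \<open>I\<close>: a new observation adds \<open>u + w\<close> to the
  centred square norm, where \<open>u\<close> (from \<open>ip\<close>) and \<open>w\<close> (from
  \<open>rsq - k\<close>) both have mean 0. The second moment of \<open>u\<close> is
  \<open>4 / n\<close> times the current square norm; summed over the observations this would give a
  leading coefficient 2, and bounding the squares of \<open>u\<close> and \<open>w\<close>
  separately doubles it to 4.\<close>

lemma integral_nsq_wvec_variance:
  assumes "finite I" "n > 0"
  shows "(\<integral>x. (nsq (wvec n I x) - real (card I) * k / n)\<^sup>2 \<partial>sample I)
    \<le> (4 * (real (card I))\<^sup>2 * k + 2 * real (card I) * B * k) / (real n)\<^sup>2"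
  using \<open>finite I\<close>
proof (induction I rule: finite_induct)
  case empty
  then show ?case
    by (simp add: nsq_def wvec_def prob_space.prob_space[OF prob_space_sample])
next
  case (insert i I)
  let ?Q = "\<lambda>x. nsq (wvec n I x)" and ?c = "real (card I) * k / n"
  interpret S: prob_space "sample I" by (rule prob_space_sample)
  have bQ: "bdd_meas (sample I) ?Q" by (rule bdd_meas_nsq_wvec)
  have f: "bdd_meas (sample (insert i I))
    (\<lambda>x. (nsq (wvec n (insert i I) x) - real (card (insert i I)) * k / n)\<^sup>2)"
    by (intro bdd_meas_intros bdd_meas_nsq_wvec)
  have inner: "(\<integral>y. (nsq (wvec n (insert i I) (x(i := y))) - real (card (insert i I)) * k / n)\<^sup>2 \<partial>M)
      \<le> (?Q x - ?c)\<^sup>2 + 8 / n * ?Q x + 2 * B * k / (real n)\<^sup>2" (is "(\<integral>y. ?f y \<partial>M) \<le> _") for x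
  proof -
    let ?d = "?Q x - ?c" and ?p = "ip (wvec n I x)"
    \<comment> \<open>Coefficients of the expansion of \<open>add_sq_le\<close> after the square of
      \<open>rsq\<close> in \<open>w\<^sup>2\<close> has been replaced by \<open>B * rsq\<close>;
      this brings the bound into the shape of \<open>integral_ip_rsq\<close>.\<close>
    let ?A0 = "?d\<^sup>2 - 2 * ?d * k / n + 2 * (real k)\<^sup>2 / (real n)\<^sup>2" and ?A1 = "4 * ?d / sqrt n"
      and ?A2 = "8 / n"
      and ?A3 = "2 * ?d / n + 2 * (B - 2 * k) / (real n)\<^sup>2"
    have le: "?f y \<le> ?A0 + ?A1 * ?p y + ?A2 * (?p y)\<^sup>2 + ?A3 * rsq y" if y: "y \<in> space M" for y
    proof -
      define u where "u = 2 * ?p y / sqrt n"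
      define w where "w = (rsq y - k) / n"
      have f: "?f y = (?d + (u + w))\<^sup>2"
        unfolding nsq_wvec_fun_upd[OF insert(1,2)] u_def w_def using insert
        by (simp add: diff_divide_distrib add_divide_distrib algebra_simps)
      have "(?d + (u + w))\<^sup>2 \<le> ?d\<^sup>2 + 2 * ?d * (u + w) + 2 * u\<^sup>2 + 2 * w\<^sup>2"
        by (rule add_sq_le)
      also have "w\<^sup>2 = ((rsq y)\<^sup>2 - 2 * k * rsq y + k\<^sup>2) / (real n)\<^sup>2"
        unfolding w_def by (simp add: power_divide power2_diff algebra_simps)
      also have "\<dots> \<le> (B * rsq y - 2 * k * rsq y + k\<^sup>2) / (real n)\<^sup>2"
        using mult_right_mono[OF rsq_le[OF y] rsq_nonneg[of y]]
        by (intro divide_right_mono) (auto simp: power2_eq_square)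
      also have "u\<^sup>2 = 4 * (?p y)\<^sup>2 / n" unfolding u_def by (simp add: power_divide power_mult_distrib)
      finally show ?thesis unfolding f u_def w_def
        by (simp add: diff_divide_distrib add_divide_distrib algebra_simps)
    qed
    have "(\<integral>y. ?f y \<partial>M) \<le> (\<integral>y. ?A0 + ?A1 * ?p y + ?A2 * (?p y)\<^sup>2 + ?A3 * rsq y \<partial>M)"
    proof (intro integral_mono bdd_meas_integrable le)
      show "bdd_meas M (\<lambda>y. ?A0 + ?A1 * ?p y + ?A2 * (?p y)\<^sup>2 + ?A3 * rsq y)"
        by (intro bdd_meas_intros bdd_meas_ip bdd_meas_rsq)
      show "bdd_meas M ?f"
        unfolding nsq_wvec_fun_upd[OF insert(1,2)]
        by (intro bdd_meas_intros bdd_meas_ip bdd_meas_rsq)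
    qed
    also have "\<dots> = ?A0 + ?A2 * ?Q x + ?A3 * k" by (rule integral_ip_rsq)
    also have "\<dots> = ?d\<^sup>2 + 8 / n * ?Q x + 2 * B * k / (real n)\<^sup>2 - 2 * (real k)\<^sup>2 / (real n)\<^sup>2"
      by (simp add: diff_divide_distrib add_divide_distrib power2_eq_square algebra_simps)
    also have "\<dots> \<le> ?d\<^sup>2 + 8 / n * ?Q x + 2 * B * k / (real n)\<^sup>2" by simp
    finally show ?thesis .
  qed
  have "(\<integral>x. (nsq (wvec n (insert i I) x) - real (card (insert i I)) * k / n)\<^sup>2 \<partial>sample (insert i I))
      \<le> (\<integral>x. (?Q x - ?c)\<^sup>2 + 8 / n * ?Q x + 2 * B * k / (real n)\<^sup>2 \<partial>sample I)"
    unfolding integral_sample_insert[OF insert(1,2) f]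
    by (intro integral_mono S.bdd_meas_integrable bdd_meas_integral_fun_upd[OF f] inner bdd_meas_intros bQ)
  also have "\<dots> = (\<integral>x. (?Q x - ?c)\<^sup>2 \<partial>sample I) + 8 / n * (real (card I) * k / n) + 2 * B * k / (real n)\<^sup>2"
  proof -
    have "integrable (sample I) (\<lambda>x. (?Q x - ?c)\<^sup>2)"
      by (intro S.bdd_meas_integrable bdd_meas_intros bQ)
    then show ?thesis
      using S.bdd_meas_integrable[OF bQ] S.prob_space integral_nsq_wvec[OF insert(1) assms(2)] by simp
  qed
  also have "\<dots> \<le> (4 * (real (card I))\<^sup>2 * k + 2 * real (card I) * B * k) / (real n)\<^sup>2
    + 8 / n * (real (card I) * k / n) + 2 * B * k / (real n)\<^sup>2"
    using insert.IH by simp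
  also have "\<dots> = (4 * ((real (card I))\<^sup>2 + 2 * real (card I)) * k + 2 * (real (card I) + 1) * B * k)
    / (real n)\<^sup>2"
    by (simp add: add_divide_distrib power2_eq_square algebra_simps)
  also have "\<dots> \<le> (4 * (real (card (insert i I)))\<^sup>2 * k + 2 * real (card (insert i I)) * B * k) / (real n)\<^sup>2"
    using insert(1,2) order_trans[OF of_nat_0_le_iff k_le_B]
    by (intro divide_right_mono add_mono mult_right_mono) (auto simp: power2_eq_square algebra_simps)
  finally show ?case .
qed

text \<open>With \<open>n - 1\<close> observations the mean is \<open>(n - 1) * k / n\<close>, so
  centring at \<open>k\<close> instead costs \<open>(k / n)\<^sup>2\<close>. The assumption
  \<open>B \<le> n\<close> turns the fourth-moment term \<open>B * k / n\<close> into at most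
  \<open>k\<close>; the constant is 14 = 2 (4 + 2) + 2.\<close>

lemma leave_one_out_moments:
  assumes "finite I" "n > 0" "card I = n - 1" "B \<le> n"
  shows "(\<integral>x. nsq (wvec n I x) \<partial>sample I) \<le> k"
    and "(\<integral>x. (nsq (wvec n I x) - k)\<^sup>2 \<partial>sample I) \<le> 14 * k"
proof -
  interpret S: prob_space "sample I" by (rule prob_space_sample)
  let ?Q = "\<lambda>x. nsq (wvec n I x)" and ?c = "real (card I) * k / n"
  have bQ: "bdd_meas (sample I) ?Q" by (rule bdd_meas_nsq_wvec)
  have p: "real (card I) = real n - 1" using assms by simp
  show "(\<integral>x. ?Q x \<partial>sample I) \<le> k"
    unfolding integral_nsq_wvec[OF assms(1,2)] p using assms by (simp add: field_simps)
  have i: "integrable (sample I) (\<lambda>x. (?Q x - ?c)\<^sup>2)"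
    by (intro S.bdd_meas_integrable bdd_meas_intros bQ)
  have "(\<integral>x. (?Q x - k)\<^sup>2 \<partial>sample I) \<le> (\<integral>x. 2 * (?Q x - ?c)\<^sup>2 + 2 * (k / n)\<^sup>2 \<partial>sample I)"
  proof (intro integral_mono S.bdd_meas_integrable bdd_meas_intros bQ)
    fix x
    have "?Q x - k = (?Q x - ?c) - k / n" using assms by (simp add: p field_simps)
    then show "(?Q x - k)\<^sup>2 \<le> 2 * (?Q x - ?c)\<^sup>2 + 2 * (k / n)\<^sup>2"
      using diff_sq_le[of "?Q x - ?c" "k / n"] by (simp only:)
  qed
  also have "\<dots> = 2 * (\<integral>x. (?Q x - ?c)\<^sup>2 \<partial>sample I) + 2 * (k / n)\<^sup>2"
    using i S.prob_space by simp
  also have "\<dots> \<le> 2 * ((4 * (real (card I))\<^sup>2 * k + 2 * real (card I) * B * k) / (real n)\<^sup>2) + 2 * (k / n)\<^sup>2"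
    using integral_nsq_wvec_variance[OF assms(1,2)] by (intro add_right_mono mult_left_mono) auto
  also have "\<dots> \<le> 2 * ((4 * (real n)\<^sup>2 * k + 2 * n * n * k) / (real n)\<^sup>2) + 2 * k"
  proof -
    have "k / n \<le> 1" using k_le_B assms by simp
    then have "(k / n)\<^sup>2 \<le> 1" by (simp add: power_le_one)
    then have 1: "(k / n)\<^sup>2 \<le> k" using k_pos by linarith
    have 2: "4 * (real (card I))\<^sup>2 * k \<le> 4 * (real n)\<^sup>2 * k"
      using p by (intro mult_right_mono mult_left_mono power_mono) auto
    have 3: "2 * real (card I) * B * k \<le> 2 * real n * real n * k"
      using p assms k_le_B by (intro mult_right_mono mult_mono) auto
    show ?thesis
      using 1 2 3 by (intro add_mono mult_left_mono divide_right_mono) auto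
  qed
  also have "\<dots> = 14 * k" using assms by (simp add: field_simps power2_eq_square)
  finally show "(\<integral>x. (?Q x - k)\<^sup>2 \<partial>sample I) \<le> 14 * k" .
qed

end

section \<open>From an approximate differential equation to the Gaussian characteristic
  function\<close>

lemma (in prob_space) integral_norm_le_bdd_meas:
  assumes "bdd_meas M f" "bdd_meas M h" "\<And>x. x \<in> space M \<Longrightarrow> norm (f x) \<le> h x"
  shows "norm (\<integral>x. f x \<partial>M) \<le> (\<integral>x. h x \<partial>M)"
  using integral_bdd_meas_approx[OF assms(1) bdd_meas_const[of _ 0] assms(2)] assms(3) by simp

text \<open>Replaces dominated convergence when differentiating under the integral: the Taylor
  remainder of \<open>cis\<close> is quadratic in \<open>h\<close>, and the second moment of
  \<open>T\<close> is finite.\<close>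

lemma has_vector_derivative_quadratic:
  fixes f :: "real \<Rightarrow> 'b::real_normed_vector"
  assumes "\<And>h. norm (f (t + h) - f t - h *\<^sub>R D) \<le> K * h\<^sup>2"
  shows "(f has_vector_derivative D) (at t)"
  unfolding has_vector_derivative_def
proof (rule has_derivativeI_sandwich[of 1])
  show "bounded_linear (\<lambda>x. x *\<^sub>R D)" by (rule bounded_linear_scaleR_left)
  show "(\<lambda>y. K * \<bar>y - t\<bar>) \<midarrow>t\<rightarrow> 0"
    by (rule tendsto_eq_intros | simp)+
  fix y assume y: "y \<noteq> t"
  have "norm (f y - f t - (y - t) *\<^sub>R D) \<le> K * (y - t)\<^sup>2" using assms[of "y - t"] by simp
  also have "\<dots> = K * \<bar>y - t\<bar> * norm (y - t)" by (simp add: power2_eq_square)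
  finally show "norm (f y - f t - (y - t) *\<^sub>R D) / norm (y - t) \<le> K * \<bar>y - t\<bar>"
    using y by (simp add: pos_divide_le_eq)
qed simp

text \<open>The shape of the error comes from integrating a defect
  \<open>(\<bar>s\<bar> + s\<^sup>2) * \<epsilon>\<close> in the differential equation between 0 and
  \<open>t\<close>. It tends to 0 with \<open>\<epsilon>\<close> for each fixed \<open>t\<close>,
  which is all that convergence of characteristic functions requires.\<close>

definition near_gaussian :: "'a measure \<Rightarrow> ('a \<Rightarrow> real) \<Rightarrow> real \<Rightarrow> bool" where
  "near_gaussian M T \<epsilon> \<longleftrightarrow> (\<forall>t. norm ((\<integral>x. cis (t * T x) \<partial>M) - complex_of_real (exp (- t\<^sup>2 / 2)))
    \<le> \<bar>t\<bar> * (\<bar>t\<bar> + t\<^sup>2) * \<epsilon>)"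

lemma near_gaussian_mono: "near_gaussian M T \<epsilon> \<Longrightarrow> \<epsilon> \<le> \<epsilon>' \<Longrightarrow> near_gaussian M T \<epsilon>'"
  unfolding near_gaussian_def by (meson abs_ge_zero add_nonneg_nonneg mult_left_mono mult_nonneg_nonneg
    order_trans zero_le_power2)

text \<open>The characteristic function \<open>\<phi>\<close> of \<open>T\<close> nearly satisfies \<open>\<phi>' = - t \<phi>\<close>.\<close>

lemma (in prob_space) char_near_gaussian:
  fixes T :: "'a \<Rightarrow> real"
  assumes T: "bdd_meas M T" and "\<epsilon> \<ge> 0"
    and stein: "\<And>t. norm ((\<integral>x. T x * cis (t * T x) \<partial>M) - \<i> * t * (\<integral>x. cis (t * T x) \<partial>M)) \<le> (\<bar>t\<bar> + t\<^sup>2) * \<epsilon>"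
  shows "near_gaussian M T \<epsilon>"
  unfolding near_gaussian_def
proof
  fix t :: real
  define \<phi> where "\<phi> t = (\<integral>x. cis (t * T x) \<partial>M)" for t
  \<comment> \<open>Integrating factor: for an exact solution of the differential equation
    \<open>\<psi>\<close> would be constant, so its derivative consists of the defect alone.\<close>
  define \<psi> where "\<psi> t = exp (t\<^sup>2 / 2) *\<^sub>R \<phi> t" for t
  have cis_tT: "bdd_meas M (\<lambda>x. cis (t * T x))" for t
    by (intro bdd_meas_intros T)
  have TT: "bdd_meas M (\<lambda>x. \<i> * T x * cis (t * T x))" for t
    by (intro bdd_meas_intros T cis_tT)
  have d\<phi>: "(\<phi> has_vector_derivative (\<integral>x. \<i> * T x * cis (t * T x) \<partial>M)) (at t)" for t
  proof (rule has_vector_derivative_quadratic[where K = "\<integral>x. (T x)\<^sup>2 / 2 \<partial>M"])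
    fix h
    have "\<phi> (t + h) - \<phi> t - h *\<^sub>R (\<integral>x. \<i> * T x * cis (t * T x) \<partial>M)
        = (\<integral>x. cis ((t + h) * T x) - cis (t * T x) - h *\<^sub>R (\<i> * T x * cis (t * T x)) \<partial>M)"
      unfolding \<phi>_def using bdd_meas_integrable[OF cis_tT] bdd_meas_integrable[OF TT] by simp
    also have "norm \<dots> \<le> (\<integral>x. h\<^sup>2 * ((T x)\<^sup>2 / 2) \<partial>M)"
    proof (rule integral_norm_le_bdd_meas)
      show "bdd_meas M (\<lambda>x. cis ((t + h) * T x) - cis (t * T x) - h *\<^sub>R (\<i> * T x * cis (t * T x)))"
        unfolding scaleR_conv_of_real by (intro bdd_meas_intros cis_tT TT)
      show "bdd_meas M (\<lambda>x. h\<^sup>2 * ((T x)\<^sup>2 / 2))"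
        by (intro bdd_meas_intros T)
      fix x
      have "cis ((t + h) * T x) - cis (t * T x) - h *\<^sub>R (\<i> * T x * cis (t * T x))
          = cis (t * T x) * (cis (h * T x) - 1 - \<i> * (h * T x))"
        by (simp add: distrib_right cis_mult[symmetric] scaleR_conv_of_real algebra_simps)
      then show "norm (cis ((t + h) * T x) - cis (t * T x) - h *\<^sub>R (\<i> * T x * cis (t * T x)))
        \<le> h\<^sup>2 * ((T x)\<^sup>2 / 2)"
        using norm_cis_minus_linear_le[of "h * T x"] by (simp add: norm_mult power_mult_distrib)
    qed
    also have "\<dots> = (\<integral>x. (T x)\<^sup>2 / 2 \<partial>M) * h\<^sup>2" by simp
    finally show "norm (\<phi> (t + h) - \<phi> t - h *\<^sub>R (\<integral>x. \<i> * T x * cis (t * T x) \<partial>M))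
        \<le> (\<integral>x. (T x)\<^sup>2 / 2 \<partial>M) * h\<^sup>2" .
  qed
  define E where "E t = (\<integral>x. T x * cis (t * T x) \<partial>M)" for t
  have d\<psi>: "(\<psi> has_vector_derivative exp (s\<^sup>2 / 2) *\<^sub>R (\<i> * (E s - \<i> * s * \<phi> s))) (at s)" for s
  proof -
    have "(\<integral>x. \<i> * T x * cis (s * T x) \<partial>M) = \<i> * E s"
      unfolding E_def by (simp add: mult.assoc)
    then have 1: "(\<phi> has_vector_derivative \<i> * E s) (at s)" using d\<phi>[of s] by simp
    have 2: "((\<lambda>t. exp (t\<^sup>2 / 2)) has_real_derivative exp (s\<^sup>2 / 2) * s) (at s)"
      by (auto intro!: derivative_eq_intros simp: field_simps)
    have "(\<psi> has_vector_derivative exp (s\<^sup>2 / 2) *\<^sub>R (\<i> * E s) + (exp (s\<^sup>2 / 2) * s) *\<^sub>R \<phi> s) (at s)"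
      unfolding \<psi>_def by (rule has_vector_derivative_scaleR[OF 2 1])
    then show ?thesis by (simp add: scaleR_conv_of_real algebra_simps)
  qed
  \<comment> \<open>The symmetric interval contains both 0 and \<open>t\<close> whatever the sign of
    \<open>t\<close>. The factor \<open>exp (t\<^sup>2 / 2)\<close> is cancelled when passing back
    from \<open>\<psi>\<close> to \<open>\<phi>\<close>.\<close>
  have "norm (\<psi> t - \<psi> 0) \<le> exp (t\<^sup>2 / 2) * ((\<bar>t\<bar> + t\<^sup>2) * \<epsilon>) * norm (t - 0)"
  proof (rule differentiable_bound[of "{-\<bar>t\<bar>..\<bar>t\<bar>}"])
    fix s assume "s \<in> {-\<bar>t\<bar>..\<bar>t\<bar>}"
    then have s: "\<bar>s\<bar> \<le> \<bar>t\<bar>" by auto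
    then have s2: "s\<^sup>2 \<le> t\<^sup>2" by (simp add: abs_le_square_iff)
    let ?D = "exp (s\<^sup>2 / 2) *\<^sub>R (\<i> * (E s - \<i> * s * \<phi> s))"
    show "(\<psi> has_derivative (\<lambda>x. x *\<^sub>R ?D)) (at s within {-\<bar>t\<bar>..\<bar>t\<bar>})"
      using d\<psi>[of s] unfolding has_vector_derivative_def by (rule has_derivative_at_withinI)
    have "norm ?D = exp (s\<^sup>2 / 2) * norm (E s - \<i> * s * \<phi> s)" by (simp add: norm_mult)
    also have "\<dots> \<le> exp (t\<^sup>2 / 2) * ((\<bar>t\<bar> + t\<^sup>2) * \<epsilon>)"
    proof (rule mult_mono)
      have "norm (E s - \<i> * s * \<phi> s) \<le> (\<bar>s\<bar> + s\<^sup>2) * \<epsilon>" unfolding E_def \<phi>_def by (rule stein)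
      also have "\<dots> \<le> (\<bar>t\<bar> + t\<^sup>2) * \<epsilon>" using s s2 \<open>\<epsilon> \<ge> 0\<close> by (intro mult_right_mono) auto
      finally show "norm (E s - \<i> * s * \<phi> s) \<le> (\<bar>t\<bar> + t\<^sup>2) * \<epsilon>" .
    qed (use s2 in auto)
    finally have D: "norm ?D \<le> exp (t\<^sup>2 / 2) * ((\<bar>t\<bar> + t\<^sup>2) * \<epsilon>)" .
    show "onorm (\<lambda>x. x *\<^sub>R ?D) \<le> exp (t\<^sup>2 / 2) * ((\<bar>t\<bar> + t\<^sup>2) * \<epsilon>)"
    proof (rule onorm_le)
      fix x :: real
      show "norm (x *\<^sub>R ?D) \<le> exp (t\<^sup>2 / 2) * ((\<bar>t\<bar> + t\<^sup>2) * \<epsilon>) * norm x"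
        using mult_left_mono[OF D, of "\<bar>x\<bar>"] by (simp only: norm_scaleR real_norm_def mult.commute)
    qed
  qed auto
  then have "norm (\<psi> t - 1) \<le> exp (t\<^sup>2 / 2) * ((\<bar>t\<bar> + t\<^sup>2) * \<epsilon>) * \<bar>t\<bar>"
    by (simp add: \<psi>_def \<phi>_def prob_space)
  then have m: "exp (- t\<^sup>2 / 2) * norm (\<psi> t - 1) \<le> exp (- t\<^sup>2 / 2) * (exp (t\<^sup>2 / 2) * ((\<bar>t\<bar> + t\<^sup>2) * \<epsilon>) * \<bar>t\<bar>)"
    by (rule mult_left_mono) simp
  have e: "exp (- t\<^sup>2 / 2) * exp (t\<^sup>2 / 2) = 1" by (simp flip: exp_add)
  have "\<phi> t - exp (- t\<^sup>2 / 2) = exp (- t\<^sup>2 / 2) *\<^sub>R (\<psi> t - 1)"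
    using e unfolding \<psi>_def by (simp only: scaleR_right_diff_distrib scaleR_scaleR)
      (simp add: scaleR_conv_of_real)
  then have "norm (\<phi> t - exp (- t\<^sup>2 / 2)) = exp (- t\<^sup>2 / 2) * norm (\<psi> t - 1)" by simp
  also note m
  also have "exp (- t\<^sup>2 / 2) * (exp (t\<^sup>2 / 2) * ((\<bar>t\<bar> + t\<^sup>2) * \<epsilon>) * \<bar>t\<bar>)
      = (exp (- t\<^sup>2 / 2) * exp (t\<^sup>2 / 2)) * (\<bar>t\<bar> * (\<bar>t\<bar> + t\<^sup>2) * \<epsilon>)"
    by (simp only: mult_ac)
  finally show "norm ((\<integral>x. cis (t * T x) \<partial>M) - complex_of_real (exp (- t\<^sup>2 / 2))) \<le> \<bar>t\<bar> * (\<bar>t\<bar> + t\<^sup>2) * \<epsilon>"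
    unfolding e \<phi>_def by simp
qed

section \<open>Integrating out one observation\<close>

context orthonormal_system
begin

text \<open>Here \<open>v\<close> is the sum without one observation \<open>y\<close>, and
  \<open>\<delta> v y\<close> is the change of the square norm when \<open>y\<close> is added.
  Expanding \<open>cis (s * \<delta> v y)\<close>, the constant 1 leaves the mean \<open>k\<close>
  of \<open>rsq\<close>, and the linear part of \<open>\<delta>\<close> pairs
  \<open>sqrt n * ip\<close> with \<open>2 * ip / sqrt n\<close>, whose mean produces
  \<open>2 * \<i> * s * nsq v\<close>.\<close>

lemma leave_one_out_inner:
  fixes s :: real and n :: nat
  assumes n: "n > 0" "B \<le> n"
  defines "\<delta> \<equiv> \<lambda>v y. 2 * ip v y / sqrt n + rsq y / n"
  shows "norm ((\<integral>y. complex_of_real (sqrt n * ip v y + rsq y) * cis (s * \<delta> v y) \<partial>M) - (k + 2 * \<i> * s * nsq v))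
      \<le> 3 * \<bar>s\<bar> * sqrt B * k * (1 + nsq v) / sqrt n + 4 * s\<^sup>2 * B * (1 + nsq v)\<^sup>2 / sqrt n" (is ?A)
    and "norm ((\<integral>y. cis (s * \<delta> v y) \<partial>M) - 1) \<le> 2 * \<bar>s\<bar> * sqrt B * (1 + nsq v) / sqrt n" (is ?B)
proof -
  define N where "N = sqrt (nsq v)"
  \<comment> \<open>\<open>2 * N \<le> 1 + N\<^sup>2\<close> replaces the square root
    \<open>N\<close> by a polynomial in \<open>nsq v\<close>, whose average over the remaining
    sample is available.\<close>
  define R where "R = 1 + nsq v"
  have Q: "nsq v = N\<^sup>2" "N \<ge> 0" unfolding N_def using nsq_nonneg[of v] by auto
  have NR: "2 * N \<le> R" "R \<ge> 1" using zero_le_power2[of "N - 1"] by (auto simp: R_def Q power2_diff)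
  have B: "B \<ge> 1" using k_pos k_le_B by linarith
  have sB: "sqrt B \<ge> 1" "sqrt B \<le> sqrt n" using B n by auto
  have sn: "sqrt n > 0" "sqrt n * sqrt n = n" using n by auto
  have ipN: "\<bar>ip v y\<bar> \<le> N * sqrt B" if "y \<in> space M" for y
  proof -
    have "(ip v y)\<^sup>2 \<le> nsq v * B"
      using ip_sq_le_rsq[of v y] mult_left_mono[OF rsq_le[OF that] nsq_nonneg[of v]] by linarith
    then have "sqrt ((ip v y)\<^sup>2) \<le> sqrt (nsq v * B)" by (rule real_sqrt_le_mono)
    then show ?thesis by (simp add: N_def real_sqrt_mult)
  qed
  \<comment> \<open>\<open>B \<le> n\<close> makes \<open>B / n\<close> at most its square root, so
    both parts of \<open>\<delta>\<close> have the order \<open>sqrt B / sqrt n\<close>.\<close>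
  have rn: "rsq y / n \<le> sqrt B / sqrt n" if "y \<in> space M" for y
  proof -
    have "rsq y / n \<le> (sqrt B * sqrt B) / (sqrt n * sqrt n)" using rsq_le[OF that] B sn
      by (simp add: divide_right_mono)
    also have "\<dots> = (sqrt B / sqrt n) * (sqrt B / sqrt n)" by simp
    also have "\<dots> \<le> (sqrt B / sqrt n) * 1" using sB sn by (intro mult_left_mono) auto
    finally show ?thesis by simp
  qed
  have \<delta>0: "\<bar>\<delta> v y\<bar> \<le> (2 * N + 1) * (sqrt B / sqrt n)" if y: "y \<in> space M" for y
  proof -
    have "\<bar>\<delta> v y\<bar> \<le> 2 * (\<bar>ip v y\<bar> / sqrt n) + rsq y / n"
      unfolding \<delta>_def using rsq_nonneg[of y] sn
      by (intro order_trans[OF abs_triangle_ineq]) (simp add: abs_mult)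
    also have "\<dots> \<le> 2 * (N * sqrt B / sqrt n) + sqrt B / sqrt n"
      using ipN[OF y] rn[OF y] sn by (intro add_mono mult_left_mono divide_right_mono) auto
    finally show ?thesis by (simp add: algebra_simps)
  qed
  have \<delta>1: "\<bar>\<delta> v y\<bar> \<le> 2 * R * sqrt B / sqrt n" if "y \<in> space M" for y
  proof -
    have "(2 * N + 1) * (sqrt B / sqrt n) \<le> (2 * R) * (sqrt B / sqrt n)"
      using NR B by (intro mult_right_mono) auto
    then show ?thesis using \<delta>0[OF that] by simp
  qed
  have \<delta>2: "(\<delta> v y)\<^sup>2 \<le> 8 * R * B / n" if "y \<in> space M" for y
  proof -
    have "\<bar>\<delta> v y\<bar>\<^sup>2 \<le> ((2 * N + 1) * (sqrt B / sqrt n))\<^sup>2" by (intro power_mono \<delta>0 that) auto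
    also have "\<dots> = (2 * N + 1)\<^sup>2 * (B / n)" using B sn by (simp add: power_mult_distrib power_divide)
    also have "\<dots> \<le> (8 * R) * (B / n)"
      using diff_sq_le[of "2 * N" "-1"] B by (intro mult_right_mono) (auto simp: R_def Q power_mult_distrib)
    finally show ?thesis by simp
  qed
  have b\<delta>: "bdd_meas M (\<lambda>y. s * \<delta> v y)"
    unfolding \<delta>_def by (intro bdd_meas_intros bdd_meas_ip bdd_meas_rsq)
  have "norm ((\<integral>y. cis (s * \<delta> v y) \<partial>M) - (\<integral>y. 1 \<partial>M)) \<le> (\<integral>y. 2 * \<bar>s\<bar> * sqrt B * R / sqrt n \<partial>M)"
  proof (rule integral_bdd_meas_approx[OF bdd_meas_cis[OF b\<delta>] bdd_meas_const bdd_meas_const])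
    fix y assume y: "y \<in> space M"
    have "norm (cis (s * \<delta> v y) - 1) \<le> \<bar>s\<bar> * \<bar>\<delta> v y\<bar>" using norm_cis_minus_1_le[of "s * \<delta> v y"]
      by (simp add: abs_mult)
    also have "\<dots> \<le> \<bar>s\<bar> * (2 * R * sqrt B / sqrt n)" by (intro mult_left_mono \<delta>1 y) simp
    finally show "norm (cis (s * \<delta> v y) - 1) \<le> 2 * \<bar>s\<bar> * sqrt B * R / sqrt n" by (simp add: mult_ac)
  qed
  then show ?B by (simp add: prob_space R_def)
  let ?f = "\<lambda>y. complex_of_real (sqrt n * ip v y + rsq y) * cis (s * \<delta> v y)"
  \<comment> \<open>The zero coefficients are kept so that real and imaginary parts are both
    instances of \<open>integral_ip_rsq\<close>.\<close>
  let ?g = "\<lambda>y. complex_of_real (0 + sqrt n * ip v y + 0 * (ip v y)\<^sup>2 + 1 * rsq y)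
               + \<i> * (2 * s) * complex_of_real (0 + 0 * ip v y + 1 * (ip v y)\<^sup>2 + 0 * rsq y)"
  let ?h = "\<lambda>y. 4 * s\<^sup>2 * B * R / sqrt n + 0 * ip v y + (4 * s\<^sup>2 * B * R / sqrt n) * (ip v y)\<^sup>2
               + (3 * \<bar>s\<bar> * sqrt B * R / sqrt n) * rsq y"
  have quad: "bdd_meas M (\<lambda>y. A0 + A1 * ip v y + A2 * (ip v y)\<^sup>2 + A3 * rsq y)" for A0 A1 A2 A3
    by (intro bdd_meas_intros bdd_meas_ip bdd_meas_rsq)
  have "norm ((\<integral>y. ?f y \<partial>M) - (\<integral>y. ?g y \<partial>M)) \<le> (\<integral>y. ?h y \<partial>M)"
  proof (rule integral_bdd_meas_approx)
    show "bdd_meas M ?f"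
      by (intro bdd_meas_intros bdd_meas_ip bdd_meas_rsq b\<delta>)
    show "bdd_meas M ?g"
      by (intro bdd_meas_add[where f = "\<lambda>y. complex_of_real (0 + sqrt n * ip v y + 0 * (ip v y)\<^sup>2 + 1 * rsq y)"]
            bdd_meas_mult bdd_meas_const bdd_meas_of_real quad)
    show "bdd_meas M ?h" by (rule quad)
    fix y assume y: "y \<in> space M"
    let ?c = "cis (s * \<delta> v y)" and ?q = "ip v y" and ?r = "rsq y"
    have qd: "sqrt n * ?q * \<delta> v y = 2 * ?q\<^sup>2 + ?q * ?r / sqrt n"
      unfolding \<delta>_def using sn by (simp add: power2_eq_square field_simps)
    \<comment> \<open>Three errors: zeroth order in \<open>cis\<close> against \<open>rsq\<close>,
      first order in \<open>cis\<close> against the large factor \<open>sqrt n * ip\<close>, and the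
      contribution of \<open>rsq / n\<close> to the linear term of the latter.\<close>
    have "?f y - ?g y = ?r * (?c - 1) + (sqrt n * ?q) * (?c - 1 - \<i> * (s * \<delta> v y))
        + \<i> * s * complex_of_real (sqrt n * ?q * \<delta> v y - 2 * ?q\<^sup>2)"
      by (simp add: algebra_simps)
    also have "norm \<dots> \<le> ?r * norm (?c - 1) + (sqrt n * \<bar>?q\<bar>) * norm (?c - 1 - \<i> * (s * \<delta> v y))
      + \<bar>s\<bar> * (\<bar>?q\<bar> * ?r / sqrt n)"
      unfolding qd using rsq_nonneg[of y]
      by (intro order_trans[OF norm_triangle_ineq] add_mono)
         (simp_all add: norm_mult norm_divide abs_mult)
    also have "\<dots> \<le> ?r * (\<bar>s\<bar> * (2 * R * sqrt B / sqrt n)) + (sqrt n * \<bar>?q\<bar>) * (s\<^sup>2 * (8 * R * B / n) / 2)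
        + \<bar>s\<bar> * (R * sqrt B * ?r / sqrt n)"
    proof (intro add_mono mult_left_mono divide_right_mono mult_right_mono)
      show "norm (?c - 1) \<le> \<bar>s\<bar> * (2 * R * sqrt B / sqrt n)"
        using norm_cis_minus_1_le[of "s * \<delta> v y"] mult_left_mono[OF \<delta>1[OF y], of "\<bar>s\<bar>"] by (simp add: abs_mult)
      show "norm (?c - 1 - \<i> * (s * \<delta> v y)) \<le> s\<^sup>2 * (8 * R * B / n) / 2"
      proof -
        have "norm (?c - 1 - \<i> * (s * \<delta> v y)) \<le> s\<^sup>2 * (\<delta> v y)\<^sup>2 / 2"
          using norm_cis_minus_linear_le[of "s * \<delta> v y"] by (simp add: power_mult_distrib)
        also have "\<dots> \<le> s\<^sup>2 * (8 * R * B / n) / 2"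
          by (intro divide_right_mono mult_left_mono \<delta>2 y) auto
        finally show ?thesis .
      qed
      have "N * sqrt B \<le> R * sqrt B" using NR Q B by (intro mult_right_mono) auto
      then show "\<bar>?q\<bar> \<le> R * sqrt B" using ipN[OF y] by simp
    qed (use rsq_nonneg[of y] in auto)
    also have "\<dots> \<le> ?h y"
    proof -
      define c where "c = 4 * s\<^sup>2 * B * R / sqrt n"
      define d where "d = \<bar>s\<bar> * sqrt B * R / sqrt n"
      have c: "(sqrt n * \<bar>?q\<bar>) * (s\<^sup>2 * (8 * R * B / n) / 2) = c * \<bar>?q\<bar>"
        using sn n unfolding c_def by (simp add: field_simps)
      have d: "?r * (\<bar>s\<bar> * (2 * R * sqrt B / sqrt n)) = 2 * d * ?r" "\<bar>s\<bar> * (R * sqrt B * ?r / sqrt n) = d * ?r"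
        "3 * \<bar>s\<bar> * sqrt B * R / sqrt n = 3 * d" by (simp_all add: d_def)
      \<comment> \<open>The absolute value of \<open>ip\<close> is majorised by a quadratic to fit
        the template \<open>?h\<close>, whose integral is explicit.\<close>
      have "c * \<bar>?q\<bar> \<le> c * (1 + ?q\<^sup>2)"
      proof (rule mult_left_mono)
        show "\<bar>?q\<bar> \<le> 1 + ?q\<^sup>2" using zero_le_power2[of "\<bar>?q\<bar> - 1"] by (simp add: power2_diff)
        show "0 \<le> c" using NR B by (simp add: c_def)
      qed
      then show ?thesis unfolding c d c_def[symmetric] by (simp add: distrib_left)
    qed
    finally show "norm (?f y - ?g y) \<le> ?h y" .
  qed
  also have "(\<integral>y. ?h y \<partial>M) = 4 * s\<^sup>2 * B * R / sqrt n + (4 * s\<^sup>2 * B * R / sqrt n) * nsq v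
       + (3 * \<bar>s\<bar> * sqrt B * R / sqrt n) * k" by (rule integral_ip_rsq)
  also have "\<dots> = 3 * \<bar>s\<bar> * sqrt B * k * R / sqrt n + 4 * s\<^sup>2 * B * R\<^sup>2 / sqrt n"
    by (simp add: R_def power2_eq_square algebra_simps add_divide_distrib)
  also have "(\<integral>y. ?g y \<partial>M) = complex_of_real (0 + 0 * nsq v + 1 * real k)
    + \<i> * (2 * s) * complex_of_real (0 + 1 * nsq v + 0 * real k)"
  proof -
    have "integrable M (\<lambda>y. complex_of_real (A0 + A1 * ip v y + A2 * (ip v y)\<^sup>2 + A3 * rsq y))" for A0 A1 A2 A3
      by (intro bdd_meas_integrable bdd_meas_of_real quad)
    then show ?thesis
      using integral_ip_rsq[of 0 "sqrt n" v 0 1] integral_ip_rsq[of 0 0 v 1 0]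
      by (subst Bochner_Integration.integral_add)
         (simp_all only: integrable_mult_right integral_mult_right_zero integral_complex_of_real)
  qed
  finally show ?A by (simp add: R_def mult_ac)
qed

text \<open>The inner estimate is averaged over the sample without \<open>i\<close>. Then the square
  norm of the reduced sum is replaced by \<open>k\<close>, which its variance bound permits, and
  finally the reduced weight \<open>h I\<close> by the full weight \<open>h J\<close>; the last step
  makes the result the same for every \<open>i\<close>.\<close>

lemma leave_one_out_outer:
  fixes s :: real and n :: nat and J :: "'i set"
  assumes J: "finite J" "card J = n" "i \<in> J" and n: "B \<le> n"
  defines "h \<equiv> \<lambda>J x. cis (s * (nsq (wvec n J x) - k))"
  shows "norm ((\<integral>x. complex_of_real (sqrt n * ip (wvec n J x) (x i)) * h J x \<partial>sample J)
      - (k + 2 * \<i> * s * k) * (\<integral>x. h J x \<partial>sample J))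
    \<le> \<bar>s\<bar> * (10 * B * k\<^sup>2 / sqrt n + 16 * sqrt k) + s\<^sup>2 * (140 * B * k\<^sup>2 / sqrt n)"
proof -
  define I where "I = J - {i}"
  have I: "finite I" "i \<notin> I" "J = insert i I" "card I = n - 1" using J by (auto simp: I_def)
  have n0: "n > 0" using J by (auto simp: card_gt_0_iff)
  interpret S: prob_space "sample I" by (rule prob_space_sample)
  let ?V = "\<lambda>x. wvec n I x" let ?Q = "\<lambda>x. nsq (wvec n I x)"
  let ?\<delta> = "\<lambda>x y. 2 * ip (?V x) y / sqrt n + rsq y / n"
  have bQ: "bdd_meas (sample I) ?Q" by (rule bdd_meas_nsq_wvec)
  have bh: "bdd_meas (sample L) (h L)" for L
    unfolding h_def by (intro bdd_meas_intros bdd_meas_nsq_wvec)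
  have bip: "bdd_meas (sample L) (\<lambda>x. ip (wvec n L x) (x j))" if "j \<in> L" for j L
    unfolding ip_def using that
    by (intro bdd_meas_intros bdd_meas_wvec bdd_meas_component[OF bdd_meas_e]) auto
  have B: "B \<ge> 1" using k_pos k_le_B by linarith
  have sBB: "sqrt B \<le> B" using B by (simp add: real_le_lsqrt power2_eq_square)
  have k1: "real k \<ge> 1" using k_pos by simp
  have mQ: "(\<integral>x. ?Q x \<partial>sample I) \<le> k" and vQ: "(\<integral>x. (?Q x - k)\<^sup>2 \<partial>sample I) \<le> 14 * k"
    using leave_one_out_moments[OF I(1) n0 I(4) n] by auto
  have norm_h: "norm (h L x) = 1" for L x by (simp add: h_def)
  have h_upd: "h J (x(i := y)) = h I x * cis (s * ?\<delta> x y)" for x y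
    unfolding h_def I(3) nsq_wvec_fun_upd[OF I(1,2)] by (simp add: cis_mult algebra_simps)
  have ip_upd: "sqrt n * ip (wvec n J (x(i := y))) ((x(i := y)) i) = sqrt n * ip (?V x) y + rsq y" for x y
    unfolding I(3) wvec_fun_upd[OF I(1,2)] ip_add fun_upd_same using n0 by (simp add: algebra_simps)
  let ?f = "\<lambda>x. complex_of_real (sqrt n * ip (wvec n J x) (x i)) * h J x"
  let ?g = "\<lambda>x. complex_of_real k * h I x + 2 * \<i> * s * (?Q x * h I x)"
  define A1 where "A1 = 3 * \<bar>s\<bar> * sqrt B * k / sqrt n"
  define A2 where "A2 = 4 * s\<^sup>2 * B / sqrt n"
  have A: "A1 \<ge> 0" "A2 \<ge> 0" using B by (auto simp: A1_def A2_def)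
  \<comment> \<open>The square of \<open>1 + ?Q x\<close> is bounded through
    \<open>?Q x - k\<close>, so that only the two moments from \<open>leave_one_out_moments\<close>
    occur.\<close>
  let ?e1 = "\<lambda>x. A1 * (1 + ?Q x) + A2 * (1 + 2 * ?Q x + (2 * (?Q x - k)\<^sup>2 + 2 * (real k)\<^sup>2))"
  have approx: "norm ((\<integral>x. ?f x \<partial>sample (insert i I)) - (\<integral>x. ?g x \<partial>sample I)) \<le> (\<integral>x. ?e1 x \<partial>sample I)"
  proof (rule integral_sample_insert_approx[OF I(1,2)])
    show "bdd_meas (sample (insert i I)) ?f"
      unfolding I(3)[symmetric] using J
      by (intro bdd_meas_intros bip bh)
    show "bdd_meas (sample I) ?g" by (intro bdd_meas_intros bQ bh)
    show "bdd_meas (sample I) ?e1"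
      by (intro bdd_meas_intros bQ)
    fix x
    have "(\<integral>y. ?f (x(i := y)) \<partial>M) = h I x
      * (\<integral>y. complex_of_real (sqrt n * ip (?V x) y + rsq y) * cis (s * ?\<delta> x y) \<partial>M)"
      unfolding ip_upd h_upd by (subst integral_mult_right_zero[symmetric]) (simp only: mult_ac)
    then have "(\<integral>y. ?f (x(i := y)) \<partial>M) - ?g x =
       h I x * ((\<integral>y. complex_of_real (sqrt n * ip (?V x) y + rsq y) * cis (s * ?\<delta> x y) \<partial>M)
         - (k + 2 * \<i> * s * ?Q x))"
      by (simp only: ) (simp add: algebra_simps)
    then have "norm ((\<integral>y. ?f (x(i := y)) \<partial>M) - ?g x)
        \<le> 3 * \<bar>s\<bar> * sqrt B * k * (1 + ?Q x) / sqrt n + 4 * s\<^sup>2 * B * (1 + ?Q x)\<^sup>2 / sqrt n"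
      using leave_one_out_inner(1)[OF n0 n, where v = "?V x" and s = s]
      by (simp only: norm_mult norm_h mult_1_left)
    also have "\<dots> = A1 * (1 + ?Q x) + A2 * (1 + ?Q x)\<^sup>2" by (simp add: A1_def A2_def)
    also have "\<dots> \<le> ?e1 x"
      using diff_sq_le[of "?Q x - k" "- real k"] A
        by (intro add_left_mono mult_left_mono) (simp_all add: power2_sum)
    finally show "norm ((\<integral>y. ?f (x(i := y)) \<partial>M) - ?g x) \<le> ?e1 x" .
  qed
  have "(\<integral>x. ?e1 x \<partial>sample I) = A1 * (1 + (\<integral>x. ?Q x \<partial>sample I))
       + A2 * (1 + 2 * (\<integral>x. ?Q x \<partial>sample I) + (2 * (\<integral>x. (?Q x - k)\<^sup>2 \<partial>sample I) + 2 * (real k)\<^sup>2))"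
  proof -
    have "integrable (sample I) (\<lambda>x. (?Q x - k)\<^sup>2)"
      by (intro S.bdd_meas_integrable bdd_meas_intros bQ)
    then show ?thesis using S.bdd_meas_integrable[OF bQ] S.prob_space by simp
  qed
  \<comment> \<open>33 = 1 + 2 + 2 * 14 + 2, since 1 and \<open>k\<close> are at most the square of
    \<open>k\<close>.\<close>
  also have "\<dots> \<le> A1 * (2 * k) + A2 * (33 * (real k)\<^sup>2)"
  proof (intro add_mono mult_left_mono A)
    have "real k \<le> (real k)\<^sup>2" using k1 mult_right_mono[of 1 "real k" "real k"] by (simp add: power2_eq_square)
    then show "1 + 2 * (\<integral>x. ?Q x \<partial>sample I) + (2 * (\<integral>x. (?Q x - k)\<^sup>2 \<partial>sample I) + 2 * (real k)\<^sup>2)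
      \<le> 33 * (real k)\<^sup>2"
      using mQ vQ k1 by linarith
    show "1 + (\<integral>x. ?Q x \<partial>sample I) \<le> 2 * k" using mQ k1 by linarith
  qed
  also have "\<dots> \<le> \<bar>s\<bar> * (6 * B * k\<^sup>2 / sqrt n) + s\<^sup>2 * (132 * B * k\<^sup>2 / sqrt n)"
  proof (rule add_mono)
    have "A1 * (2 * k) = sqrt B * (\<bar>s\<bar> * (6 * k\<^sup>2 / sqrt n))" by (simp add: A1_def power2_eq_square)
    also have "\<dots> \<le> B * (\<bar>s\<bar> * (6 * k\<^sup>2 / sqrt n))" using sBB by (intro mult_right_mono) auto
    finally show "A1 * (2 * k) \<le> \<bar>s\<bar> * (6 * B * k\<^sup>2 / sqrt n)" by (simp add: mult_ac)
    show "A2 * (33 * (real k)\<^sup>2) \<le> s\<^sup>2 * (132 * B * k\<^sup>2 / sqrt n)" by (simp add: A2_def mult_ac)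
  qed
  finally have s1: "norm ((\<integral>x. ?f x \<partial>sample J) - (\<integral>x. ?g x \<partial>sample I))
    \<le> \<bar>s\<bar> * (6 * B * k\<^sup>2 / sqrt n) + s\<^sup>2 * (132 * B * k\<^sup>2 / sqrt n)"
    using approx unfolding I(3)[symmetric] by (rule order_trans[rotated])
  \<comment> \<open>The fluctuation of the square norm around \<open>k\<close> is of order
    \<open>sqrt k\<close>. This is the error that does not shrink with \<open>n\<close>; after
    normalisation it becomes \<open>8 / sqrt k\<close>.\<close>
  have s2: "norm ((\<integral>x. ?g x \<partial>sample I) - (\<integral>x. (k + 2 * \<i> * s * k) * h I x \<partial>sample I)) \<le> \<bar>s\<bar> * (16 * sqrt k)"
  proof -
    have "norm ((\<integral>x. ?g x \<partial>sample I) - (\<integral>x. (k + 2 * \<i> * s * k) * h I x \<partial>sample I))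
        \<le> (\<integral>x. \<bar>s\<bar> * ((?Q x - k)\<^sup>2 / sqrt k + sqrt k) \<partial>sample I)"
    proof (rule S.integral_bdd_meas_approx)
      show "bdd_meas (sample I) ?g" by (intro bdd_meas_intros bQ bh)
      show "bdd_meas (sample I) (\<lambda>x. (k + 2 * \<i> * s * k) * h I x)" by (intro bdd_meas_intros bh)
      show "bdd_meas (sample I) (\<lambda>x. \<bar>s\<bar> * ((?Q x - k)\<^sup>2 / sqrt k + sqrt k))"
        by (intro bdd_meas_intros bQ)
      fix x
      have "?g x - (k + 2 * \<i> * s * k) * h I x = 2 * \<i> * s * complex_of_real (?Q x - k) * h I x"
        by (simp add: algebra_simps)
      then have "norm (?g x - (k + 2 * \<i> * s * k) * h I x) = \<bar>s\<bar> * (2 * \<bar>?Q x - k\<bar>)"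
        by (simp only: norm_mult norm_h norm_of_real norm_ii) simp
      also have "\<dots> \<le> \<bar>s\<bar> * ((?Q x - k)\<^sup>2 / sqrt k + sqrt k)"
      proof (rule mult_left_mono)
        \<comment> \<open>The weight \<open>sqrt (sqrt k)\<close> balances the two terms: the mean
          of the squared deviation is at most \<open>14 * k\<close>, so each is of order
          \<open>sqrt k\<close>.\<close>
        have "0 \<le> (\<bar>?Q x - k\<bar> / sqrt (sqrt k) - sqrt (sqrt k))\<^sup>2" by simp
        then show "2 * \<bar>?Q x - k\<bar> \<le> (?Q x - k)\<^sup>2 / sqrt k + sqrt k"
          using k1 by (simp add: power2_diff power_divide)
      qed simp
      finally show "norm (?g x - (k + 2 * \<i> * s * k) * h I x) \<le> \<bar>s\<bar> * ((?Q x - k)\<^sup>2 / sqrt k + sqrt k)" .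
    qed
    also have "\<dots> = \<bar>s\<bar> * ((\<integral>x. (?Q x - k)\<^sup>2 \<partial>sample I) / sqrt k + sqrt k)"
    proof -
      have "integrable (sample I) (\<lambda>x. (?Q x - k)\<^sup>2)"
        by (intro S.bdd_meas_integrable bdd_meas_intros bQ)
      then show ?thesis using S.prob_space by simp
    qed
    also have "\<dots> \<le> \<bar>s\<bar> * (14 * k / sqrt k + sqrt k)"
      using vQ by (intro mult_left_mono add_mono divide_right_mono) auto
    also have "14 * k / sqrt k = 14 * sqrt k" by (simp add: real_div_sqrt flip: times_divide_eq_right)
    also have "\<bar>s\<bar> * (14 * sqrt k + sqrt k) \<le> \<bar>s\<bar> * (16 * sqrt k)" by (intro mult_left_mono) auto
    finally show ?thesis .
  qed
  \<comment> \<open>The weight is put back on the full sample; the second part of the inner estimate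
    bounds the change caused by one observation.\<close>
  have s3: "norm ((\<integral>x. h J x \<partial>sample J) - (\<integral>x. h I x \<partial>sample I)) \<le> 4 * \<bar>s\<bar> * B * k / sqrt n"
  proof -
    have "norm ((\<integral>x. h J x \<partial>sample (insert i I)) - (\<integral>x. h I x \<partial>sample I))
      \<le> (\<integral>x. 2 * \<bar>s\<bar> * sqrt B * (1 + ?Q x) / sqrt n \<partial>sample I)"
    proof (rule integral_sample_insert_approx[OF I(1,2) _ bh])
      show "bdd_meas (sample (insert i I)) (h J)" using bh[of J] unfolding I(3) .
      show "bdd_meas (sample I) (\<lambda>x. 2 * \<bar>s\<bar> * sqrt B * (1 + ?Q x) / sqrt n)"
        by (intro bdd_meas_intros bQ)
      fix x
      have "(\<integral>y. h J (x(i := y)) \<partial>M) - h I x = h I x * ((\<integral>y. cis (s * ?\<delta> x y) \<partial>M) - 1)"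
        unfolding h_upd by (simp add: algebra_simps)
      then show "norm ((\<integral>y. h J (x(i := y)) \<partial>M) - h I x) \<le> 2 * \<bar>s\<bar> * sqrt B * (1 + ?Q x) / sqrt n"
        using leave_one_out_inner(2)[OF n0 n, where v = "?V x" and s = s]
        by (simp only: norm_mult norm_h mult_1_left)
    qed
    also have "\<dots> = (2 * \<bar>s\<bar> * sqrt B / sqrt n) * (1 + (\<integral>x. ?Q x \<partial>sample I))"
      using S.bdd_meas_integrable[OF bQ] S.prob_space by simp
    also have "\<dots> \<le> (2 * \<bar>s\<bar> * B / sqrt n) * (2 * k)"
      using mQ k1 sBB B by (intro mult_mono divide_right_mono) (auto simp: nsq_nonneg)
    finally show ?thesis unfolding I(3)[symmetric] by simp
  qed
  let ?c = "k + 2 * \<i> * s * k"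
  have "norm ?c \<le> k + 2 * \<bar>s\<bar> * k"
    by (rule order_trans[OF norm_triangle_ineq]) (simp add: norm_mult)
  then have c: "norm ?c * norm ((\<integral>x. h I x \<partial>sample I) - (\<integral>x. h J x \<partial>sample J))
    \<le> (k + 2 * \<bar>s\<bar> * k) * (4 * \<bar>s\<bar> * B * k / sqrt n)"
    using s3 by (intro mult_mono) (auto simp: norm_minus_commute)
  have s4: "norm ((\<integral>x. ?c * h I x \<partial>sample I) - ?c * (\<integral>x. h J x \<partial>sample J))
    \<le> \<bar>s\<bar> * (4 * B * k\<^sup>2 / sqrt n) + s\<^sup>2 * (8 * B * k\<^sup>2 / sqrt n)"
  proof -
    have "(k + 2 * u * k) * (4 * u * B * k / sqrt n)
      = u * (4 * B * k\<^sup>2 / sqrt n) + u\<^sup>2 * (8 * B * k\<^sup>2 / sqrt n)"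
      for u :: real
      by (simp add: power2_eq_square algebra_simps flip: add_divide_distrib)
    from this[of "\<bar>s\<bar>"] c show ?thesis
      by (simp only: integral_mult_right_zero right_diff_distrib[symmetric] norm_mult power2_abs)
  qed
  have "norm ((\<integral>x. ?f x \<partial>sample J) - ?c * (\<integral>x. h J x \<partial>sample J))
     \<le> (\<bar>s\<bar> * (6 * B * k\<^sup>2 / sqrt n) + s\<^sup>2 * (132 * B * k\<^sup>2 / sqrt n)) + \<bar>s\<bar> * (16 * sqrt k)
        + (\<bar>s\<bar> * (4 * B * k\<^sup>2 / sqrt n) + s\<^sup>2 * (8 * B * k\<^sup>2 / sqrt n))"
    using norm_triangle_mono[OF norm_triangle_mono[OF s1 s2] s4] by simp
  also have "\<dots> = \<bar>s\<bar> * (10 * B * k\<^sup>2 / sqrt n + 16 * sqrt k) + s\<^sup>2 * (140 * B * k\<^sup>2 / sqrt n)"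
    by (simp add: algebra_simps flip: add_divide_distrib)
  finally show ?thesis .
qed

text \<open>The square norm is linear in each observation once one factor of \<open>W\<close> is
  written out, so its weighted mean is an average of \<open>n\<close> leave-one-out terms. This
  yields the approximate differential equation required by
  \<open>char_near_gaussian\<close>.\<close>

lemma char_bound:
  fixes n :: nat and J :: "'i set"
  assumes J: "finite J" "card J = n" "n > 0" and n: "B \<le> n"
  defines "T \<equiv> \<lambda>x. (nsq (wvec n J x) - k) / sqrt (2 * k)"
  shows "near_gaussian (sample J) T (8 / sqrt k + 70 * B * k / sqrt n)"
proof (rule prob_space.char_near_gaussian[OF prob_space_sample])
  have B: "B \<ge> 1" using k_pos k_le_B by linarith
  have k1: "real k \<ge> 1" using k_pos by simp
  define r where "r = sqrt (2 * k)"
  have r: "r \<ge> 1" "r * r = 2 * k" using k1 by (auto simp: r_def)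
  interpret S: prob_space "sample J" by (rule prob_space_sample)
  show "0 \<le> 8 / sqrt k + 70 * B * k / sqrt n" using B by simp
  show bT: "bdd_meas (sample J) T"
    unfolding T_def by (intro bdd_meas_intros bdd_meas_nsq_wvec)
  fix t :: real
  define s where "s = t / r"
  define h where "h x = cis (s * (nsq (wvec n J x) - k))" for x
  have th: "cis (t * T x) = h x" for x by (simp add: T_def h_def s_def r_def)
  have bh: "bdd_meas (sample J) h"
    unfolding h_def by (intro bdd_meas_intros bdd_meas_nsq_wvec)
  let ?c = "k + 2 * \<i> * s * k"
  let ?E = "\<bar>s\<bar> * (10 * B * k\<^sup>2 / sqrt n + 16 * sqrt k) + s\<^sup>2 * (140 * B * k\<^sup>2 / sqrt n)"
  let ?f = "\<lambda>i x. complex_of_real (sqrt n * ip (wvec n J x) (x i)) * h x"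
  have bf: "integrable (sample J) (?f i)" if "i \<in> J" for i
    unfolding ip_def using that
    by (intro S.bdd_meas_integrable bdd_meas_intros bh bdd_meas_wvec bdd_meas_component[OF bdd_meas_e]) auto
  \<comment> \<open>Summing over \<open>i\<close> rebuilds one of the two factors \<open>W\<close>
    of the square norm.\<close>
  have sum_ip: "(\<Sum>i\<in>J. sqrt n * ip (wvec n J x) (x i)) = n * nsq (wvec n J x)" for x
  proof -
    have "(\<Sum>i\<in>J. sqrt n * ip (wvec n J x) (x i)) = (\<Sum>a<k. \<Sum>i\<in>J. sqrt n * (wvec n J x a * e a (x i)))"
      unfolding ip_def sum_distrib_left by (rule sum.swap)
    also have "\<dots> = (\<Sum>a<k. n * (wvec n J x a)\<^sup>2)"
    proof (rule sum.cong[OF refl])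
      fix a
      have "(\<Sum>i\<in>J. e a (x i)) = sqrt n * wvec n J x a" using J by (simp add: wvec_def)
      then show "(\<Sum>i\<in>J. sqrt n * (wvec n J x a * e a (x i))) = n * (wvec n J x a)\<^sup>2"
        by (simp add: power2_eq_square flip: sum_distrib_left)
    qed
    finally show ?thesis by (simp add: nsq_def sum_distrib_left)
  qed
  define D1 where "D1 = (\<integral>x. complex_of_real (nsq (wvec n J x)) * h x \<partial>sample J)"
  define D2 where "D2 = (\<integral>x. h x \<partial>sample J)"
  have "n * D1 = (\<integral>x. (\<Sum>i\<in>J. ?f i x) \<partial>sample J)"
    unfolding sum_distrib_right[symmetric] of_real_sum[symmetric] sum_ip D1_def
    by (simp add: mult.assoc)
  also have "\<dots> = (\<Sum>i\<in>J. \<integral>x. ?f i x \<partial>sample J)" using bf by (rule Bochner_Integration.integral_sum)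
  finally have sum_D: "of_nat n * (D1 - ?c * D2) = (\<Sum>i\<in>J. (\<integral>x. ?f i x \<partial>sample J) - ?c * D2)"
    using J by (simp add: sum_subtractf right_diff_distrib)
  have "norm (\<Sum>i\<in>J. (\<integral>x. ?f i x \<partial>sample J) - ?c * D2) \<le> (\<Sum>i\<in>J. ?E)"
    unfolding h_def D2_def by (intro sum_norm_le leave_one_out_outer J n)
  then have "n * norm (D1 - ?c * D2) \<le> n * ?E"
    unfolding sum_D[symmetric] by (simp only: norm_mult norm_of_nat sum_constant J)
  then have main: "norm (D1 - ?c * D2) \<le> ?E"
    using J by (auto intro: mult_left_le_imp_le)
  have e1: "(\<integral>x. T x * cis (t * T x) \<partial>sample J)
    = (\<integral>x. (complex_of_real (nsq (wvec n J x)) * h x - k * h x) / r \<partial>sample J)"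
    unfolding th by (intro Bochner_Integration.integral_cong refl) (simp add: T_def r_def left_diff_distrib)
  have e2: "(\<integral>x. (complex_of_real (nsq (wvec n J x)) * h x - k * h x) / r \<partial>sample J) = (D1 - k * D2) / r"
    unfolding D1_def D2_def
    using S.bdd_meas_integrable[OF bh] S.bdd_meas_integrable[OF
      bdd_meas_mult[OF bdd_meas_of_real[OF bdd_meas_nsq_wvec] bh]]
    by simp
  \<comment> \<open>With \<open>s = t / r\<close> and \<open>r * r = 2 * k\<close>, the term
    \<open>2 * \<i> * s * k / r\<close> equals \<open>\<i> * t\<close>: the variance of the limit is
    exactly 1.\<close>
  have e3: "(D1 - k * D2) / r - \<i> * t * D2 = (D1 - ?c * D2) / r"
  proof -
    have "s * r = t" using r by (simp add: s_def)
    then have "t * r = s * (r * r)" by (simp only: mult.assoc[symmetric])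
    then have "t * r = 2 * s * k" unfolding r(2) by simp
    then have tr: "complex_of_real t * r = 2 * s * k" by (metis of_real_mult of_real_numeral of_real_of_nat_eq)
    have "(D1 - k * D2) / r - \<i> * t * D2 = (D1 - k * D2 - \<i> * (complex_of_real t * r) * D2) / r"
      using r by (simp add: field_simps)
    then show ?thesis unfolding tr by (simp add: algebra_simps)
  qed
  have "norm ((D1 - ?c * D2) / r) \<le> ?E / r"
    unfolding norm_divide using divide_right_mono[OF main, of r] r by simp
  also have "\<dots> \<le> (\<bar>t\<bar> + t\<^sup>2) * (8 / sqrt k + 70 * B * k / sqrt n)"
  proof -
    have s1: "\<bar>s\<bar> / r = \<bar>t\<bar> / (2 * k)" using r by (simp add: s_def abs_divide)
    \<comment> \<open>Dropping \<open>1 / r \<le> 1\<close> loses a factor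
      \<open>sqrt (2 * k)\<close>; the resulting \<open>B * k / sqrt n\<close> is still small
      enough.\<close>
    have s2: "s\<^sup>2 / r \<le> t\<^sup>2 / (2 * k)"
    proof -
      have "s\<^sup>2 / r = t\<^sup>2 / (2 * k) / r" using r by (simp add: s_def power_divide power2_eq_square)
      also have "\<dots> \<le> t\<^sup>2 / (2 * k) / 1" using r k1 by (intro divide_left_mono) auto
      finally show ?thesis by simp
    qed
    have "?E / r = (\<bar>s\<bar> / r) * (10 * B * k\<^sup>2 / sqrt n + 16 * sqrt k) + (s\<^sup>2 / r) * (140 * B * k\<^sup>2 / sqrt n)"
      by (simp add: add_divide_distrib)
    also have "\<dots> \<le> (\<bar>t\<bar> / (2 * k)) * (10 * B * k\<^sup>2 / sqrt n + 16 * sqrt k)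
      + (t\<^sup>2 / (2 * k)) * (140 * B * k\<^sup>2 / sqrt n)"
      unfolding s1 using s2 B by (intro add_left_mono mult_right_mono) auto
    also have "\<dots> = \<bar>t\<bar> * (8 * (sqrt k / k) + 5 * B * k / sqrt n) + t\<^sup>2 * (70 * B * k / sqrt n)"
      using k1 by (simp add: power2_eq_square field_simps)
    finally have 1: "?E / r \<le> \<bar>t\<bar> * (8 * (sqrt k / k) + 5 * B * k / sqrt n) + t\<^sup>2 * (70 * B * k / sqrt n)" .
    have 2: "sqrt k / k = 1 / sqrt k" using k1 by (simp add: field_simps)
    have 3: "\<bar>t\<bar> * (8 * (1 / sqrt k) + 5 * B * k / sqrt n) + t\<^sup>2 * (70 * B * k / sqrt n)
        \<le> \<bar>t\<bar> * (8 / sqrt k + 70 * B * k / sqrt n) + t\<^sup>2 * (8 / sqrt k + 70 * B * k / sqrt n)"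
      using B by (intro add_mono mult_left_mono) (auto intro!: divide_right_mono mult_right_mono)
    show ?thesis using order_trans[OF 1[unfolded 2] 3] by (simp only: distrib_right)
  qed
  finally have "norm ((\<integral>x. T x * cis (t * T x) \<partial>sample J) - \<i> * t * D2)
      \<le> (\<bar>t\<bar> + t\<^sup>2) * (8 / sqrt k + 70 * B * k / sqrt n)"
    unfolding e1 e2 e3 .
  then show "norm ((\<integral>x. T x * cis (t * T x) \<partial>sample J) - \<i> * t * (\<integral>x. cis (t * T x) \<partial>sample J))
      \<le> (\<bar>t\<bar> + t\<^sup>2) * (8 / sqrt k + 70 * B * k / sqrt n)"
    unfolding th D2_def .
qed

end

section \<open>Empirical Gram matrices\<close>

context orthonormal_system
begin

definition gram_err :: "nat \<Rightarrow> 'i set \<Rightarrow> ('i \<Rightarrow> 'a) \<Rightarrow> nat \<Rightarrow> nat \<Rightarrow> real" where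
  "gram_err n I x a b = (\<Sum>i\<in>I. e a (x i) * e b (x i)) / n - (if a = b then 1 else 0)"

lemma bdd_meas_gram_err:
  assumes "a < k" "b < k" shows "bdd_meas (sample I) (\<lambda>x. gram_err n I x a b)"
  unfolding gram_err_def
  by (intro bdd_meas_intros bdd_meas_component[OF bdd_meas_e[OF assms(1)]]
    bdd_meas_component[OF bdd_meas_e[OF assms(2)]])

text \<open>This is the expected squared Frobenius norm, which dominates the operator norm. Each
  entry has variance at most the mean of \<open>(e a)\<^sup>2 * (e b)\<^sup>2\<close>, divided by
  \<open>n\<close>; over all entries these means add up to the mean of \<open>rsq\<^sup>2\<close>,
  and one factor \<open>rsq\<close> is bounded by \<open>B\<close>.\<close>

lemma integral_gram_err:
  assumes "finite J" "card J = n" "n > 0"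
  shows "(\<integral>x. (\<Sum>a<k. \<Sum>b<k. (gram_err n J x a b)\<^sup>2) \<partial>sample J) \<le> B * k / n"
proof -
  interpret S: prob_space "sample J" by (rule prob_space_sample)
  have bee: "bdd_meas M (\<lambda>y. e a y * e b y)" if "a < k" "b < k" for a b
    using that by (intro bdd_meas_mult bdd_meas_e)
  have bH: "integrable (sample J) (\<lambda>x. (gram_err n J x a b)\<^sup>2)" if "a < k" "b < k" for a b
    using that by (intro S.bdd_meas_integrable bdd_meas_power bdd_meas_gram_err)
  have ee2: "integrable M (\<lambda>y. (e a y)\<^sup>2 * (e b y)\<^sup>2)" if "a < k" "b < k" for a b
    using that by (intro bdd_meas_integrable bdd_meas_intros bdd_meas_e)
  have one: "(\<integral>x. (gram_err n J x a b)\<^sup>2 \<partial>sample J) \<le> (\<integral>y. (e a y)\<^sup>2 * (e b y)\<^sup>2 \<partial>M) / n"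
    if ab: "a < k" "b < k" for a b
  proof -
    define d where "d = (if a = b then 1 else 0 :: real)"
    let ?g = "\<lambda>y. e a y * e b y - d"
    have bg: "bdd_meas M ?g" by (intro bdd_meas_intros bee ab)
    have int: "(\<integral>y. e a y * e b y \<partial>M) = d" using e_orth[OF ab] by (simp add: d_def)
    have g0: "(\<integral>y. ?g y \<partial>M) = 0"
      using bdd_meas_integrable[OF bee[OF ab]] int by (simp add: prob_space)
    have gH: "gram_err n J x a b = (\<Sum>i\<in>J. ?g (x i)) / n" for x
      using assms by (simp add: gram_err_def d_def sum_subtractf diff_divide_distrib)
    have "(\<integral>y. (?g y)\<^sup>2 \<partial>M) = (\<integral>y. (e a y)\<^sup>2 * (e b y)\<^sup>2 - 2 * d * (e a y * e b y) + d\<^sup>2 \<partial>M)"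
      by (intro Bochner_Integration.integral_cong refl) (simp add: power2_diff power_mult_distrib)
    also have "\<dots> = (\<integral>y. (e a y)\<^sup>2 * (e b y)\<^sup>2 \<partial>M) - d\<^sup>2"
      using ee2[OF ab] bdd_meas_integrable[OF bee[OF ab]] int by (simp add: prob_space power2_eq_square)
    finally have "(\<integral>y. (?g y)\<^sup>2 \<partial>M) \<le> (\<integral>y. (e a y)\<^sup>2 * (e b y)\<^sup>2 \<partial>M)" by simp
    moreover have "(\<integral>x. (gram_err n J x a b)\<^sup>2 \<partial>sample J) = (\<integral>y. (?g y)\<^sup>2 \<partial>M) / n"
      unfolding gH power_divide integral_divide_zero integral_sample_sum_square[OF assms(1) bg g0]
      using assms by (simp add: power2_eq_square)
    ultimately show ?thesis using assms by (simp add: divide_right_mono)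
  qed
  have "(\<integral>x. (\<Sum>a<k. \<Sum>b<k. (gram_err n J x a b)\<^sup>2) \<partial>sample J)
      = (\<Sum>a<k. \<Sum>b<k. \<integral>x. (gram_err n J x a b)\<^sup>2 \<partial>sample J)"
    by (rule integral_double_sum[OF bH])
  also have "\<dots> \<le> (\<Sum>a<k. \<Sum>b<k. (\<integral>y. (e a y)\<^sup>2 * (e b y)\<^sup>2 \<partial>M) / n)"
    by (intro sum_mono one) auto
  also have "\<dots> = (\<integral>y. (rsq y)\<^sup>2 \<partial>M) / n"
  proof -
    have "(rsq y)\<^sup>2 = (\<Sum>a<k. \<Sum>b<k. (e a y)\<^sup>2 * (e b y)\<^sup>2)" for y
      unfolding rsq_def power2_eq_square[of "sum _ _"] sum_product ..
    then show ?thesis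
      by (simp add: integral_double_sum[OF ee2] sum_divide_distrib)
  qed
  also have "\<dots> \<le> B * k / n"
  proof (rule divide_right_mono)
    have "(\<integral>y. (rsq y)\<^sup>2 \<partial>M) \<le> (\<integral>y. B * rsq y \<partial>M)"
    proof (intro integral_mono bdd_meas_integrable bdd_meas_intros bdd_meas_rsq)
      fix y assume "y \<in> space M"
      from mult_right_mono[OF rsq_le[OF this] rsq_nonneg] show "(rsq y)\<^sup>2 \<le> B * rsq y"
        by (simp add: power2_eq_square)
    qed
    then show "(\<integral>y. (rsq y)\<^sup>2 \<partial>M) \<le> B * k" by (simp add: integral_rsq)
  qed simp
  finally show ?thesis .
qed

text \<open>Both thresholds are \<open>k\<close> times the bound for the mean (\<open>k\<close> and
  \<open>B * k / n\<close>), so that by Markov's inequality each condition fails with probability at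
  most \<open>1 / k\<close>.\<close>

definition good_sample :: "nat \<Rightarrow> 'i set \<Rightarrow> ('i \<Rightarrow> 'a) \<Rightarrow> bool" where
  "good_sample n J x \<longleftrightarrow> nsq (wvec n J x) < (real k)\<^sup>2
    \<and> (\<Sum>a<k. \<Sum>b<k. (gram_err n J x a b)\<^sup>2) < B * (real k)\<^sup>2 / n"

lemma prob_good_sample:
  assumes "finite J" "card J = n" "n > 0"
  shows "{x \<in> space (sample J). good_sample n J x} \<in> sets (sample J)"
    and "measure (sample J) {x \<in> space (sample J). good_sample n J x} \<ge> 1 - 2 / k"
proof -
  interpret S: prob_space "sample J" by (rule prob_space_sample)
  have k1: "real k \<ge> 1" using k_pos by simp
  have B: "B > 0" using k1 k_le_B by linarith
  let ?W = "\<lambda>x. nsq (wvec n J x)" and ?H = "\<lambda>x. \<Sum>a<k. \<Sum>b<k. (gram_err n J x a b)\<^sup>2"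
  have bW: "bdd_meas (sample J) ?W" by (rule bdd_meas_nsq_wvec)
  have bH: "bdd_meas (sample J) ?H" by (intro bdd_meas_intros bdd_meas_gram_err) auto
  note [measurable] = bdd_meas_measurable[OF bW] bdd_meas_measurable[OF bH]
  show "{x \<in> space (sample J). good_sample n J x} \<in> sets (sample J)"
    unfolding good_sample_def by measurable
  have "measure (sample J) {x\<in>space (sample J). (real k)\<^sup>2 \<le> ?W x} \<le> (\<integral>x. ?W x \<partial>sample J) / (real k)\<^sup>2"
    using k1 by (intro integral_Markov_inequality_measure[where A="{}"] S.bdd_meas_integrable bW AE_I2
      nsq_nonneg) auto
  also have "\<dots> = 1 / k"
    unfolding integral_nsq_wvec[OF assms(1,3)] using assms k1 by (simp add: power2_eq_square)
  finally have 1: "measure (sample J) {x\<in>space (sample J). (real k)\<^sup>2 \<le> ?W x} \<le> 1 / k" .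
  have "measure (sample J) {x\<in>space (sample J). B * (real k)\<^sup>2 / n \<le> ?H x}
    \<le> (\<integral>x. ?H x \<partial>sample J) / (B * (real k)\<^sup>2 / n)"
    using k1 B assms
    by (intro integral_Markov_inequality_measure[where A="{}"] S.bdd_meas_integrable bH AE_I2)
      (auto intro!: sum_nonneg)
  also have "\<dots> \<le> (B * k / n) / (B * (real k)\<^sup>2 / n)"
    using B by (intro divide_right_mono integral_gram_err assms) auto
  also have "\<dots> = 1 / k" using k1 B assms by (simp add: power2_eq_square)
  finally have 2: "measure (sample J) {x\<in>space (sample J). B * (real k)\<^sup>2 / n \<le> ?H x} \<le> 1 / k" .
  let ?b1 = "{x\<in>space (sample J). (real k)\<^sup>2 \<le> ?W x}"
    and ?b2 = "{x\<in>space (sample J). B * (real k)\<^sup>2 / n \<le> ?H x}"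
  have "{x \<in> space (sample J). good_sample n J x} = space (sample J) - (?b1 \<union> ?b2)"
    unfolding good_sample_def by auto
  then have "measure (sample J) {x \<in> space (sample J). good_sample n J x} = 1 - measure (sample J) (?b1 \<union> ?b2)"
    by (simp only:) (rule S.prob_compl, measurable)
  moreover have "measure (sample J) (?b1 \<union> ?b2) \<le> 1 / k + 1 / k"
    using 1 2 by (intro order_trans[OF measure_Un_le] add_mono) measurable
  ultimately show "measure (sample J) {x \<in> space (sample J). good_sample n J x} \<ge> 1 - 2 / k" by simp
qed

end

section \<open>The chi-square functional as a quadratic maximum\<close>

definition lincomb :: "nat \<Rightarrow> (nat \<Rightarrow> 'a \<Rightarrow> real) \<Rightarrow> (nat \<Rightarrow> real) \<Rightarrow> 'a \<Rightarrow> real" where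
  "lincomb N \<phi> v y = (\<Sum>a<N. v a * \<phi> a y)"

abbreviation affine_span :: "nat \<Rightarrow> (nat \<Rightarrow> 'a \<Rightarrow> real) \<Rightarrow> ('a \<Rightarrow> real) set" where
  "affine_span N \<phi> \<equiv> {\<lambda>y. c + lincomb N \<phi> v y | c v. True}"

definition quad_form :: "nat \<Rightarrow> (nat \<Rightarrow> nat \<Rightarrow> real) \<Rightarrow> (nat \<Rightarrow> real) \<Rightarrow> real" where
  "quad_form N C v = (\<Sum>a<N. \<Sum>b<N. v a * v b * C a b)"

text \<open>Unlike \<open>emp_cov\<close> it takes an arbitrary family of functions, so that it can
  also be formed for the orthonormal basis.\<close>

definition ecov :: "nat \<Rightarrow> (nat \<Rightarrow> 'a) \<Rightarrow> (nat \<Rightarrow> 'a \<Rightarrow> real) \<Rightarrow> nat \<Rightarrow> nat \<Rightarrow> real" where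
  "ecov n x \<phi> a b = emp n x (\<lambda>y. \<phi> a y * \<phi> b y) - emp n x (\<phi> a) * emp n x (\<phi> b)"

lemma emp_add: "emp n x (\<lambda>y. f y + g y) = emp n x f + emp n x g"
  by (simp add: emp_def sum.distrib add_divide_distrib)

lemma emp_mult_left: "emp n x (\<lambda>y. c * f y) = c * emp n x f"
  by (simp add: emp_def sum_distrib_left)

lemma emp_sum: "emp n x (\<lambda>y. \<Sum>a\<in>A. f a y) = (\<Sum>a\<in>A. emp n x (f a))"
  unfolding emp_def by (subst sum.swap) (simp add: sum_divide_distrib)

lemma emp_const: "n \<ge> 1 \<Longrightarrow> emp n x (\<lambda>_. c) = c"
  by (simp add: emp_def)

lemma emp_nonneg: "(\<And>y. f y \<ge> 0) \<Longrightarrow> emp n x f \<ge> 0"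
  by (simp add: emp_def sum_nonneg)

lemma emp_lincomb: "emp n x (lincomb N \<phi> v) = (\<Sum>a<N. v a * emp n x (\<phi> a))"
  using emp_sum[of n x "\<lambda>a y. v a * \<phi> a y" "{..<N}"] by (simp add: emp_mult_left lincomb_def[abs_def])

lemma lincomb_sq: "(lincomb N \<phi> v y)\<^sup>2 = (\<Sum>a<N. \<Sum>b<N. v a * v b * (\<phi> a y * \<phi> b y))"
  unfolding lincomb_def power2_eq_square sum_product by (simp add: mult_ac)

lemma emp_lincomb_sq:
  "emp n x (\<lambda>y. (lincomb N \<phi> v y)\<^sup>2) = quad_form N (\<lambda>a b. emp n x (\<lambda>y. \<phi> a y * \<phi> b y)) v"
  unfolding lincomb_sq quad_form_def by (simp only: emp_sum emp_mult_left)

lemma quad_form_ecov: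
  "quad_form N (ecov n x \<phi>) v = emp n x (\<lambda>y. (lincomb N \<phi> v y)\<^sup>2) - (emp n x (lincomb N \<phi> v))\<^sup>2"
  unfolding emp_lincomb_sq emp_lincomb power2_eq_square[of "sum _ _"] sum_product quad_form_def ecov_def
  by (simp add: sum_subtractf right_diff_distrib mult_ac)

text \<open>Decomposition into empirical variance and squared empirical mean. With \<open>c\<close>
  equal to minus the mean it exhibits \<open>quad_form\<close> of \<open>ecov\<close> as a
  variance.\<close>

lemma emp_affine_sq:
  assumes "n \<ge> 1"
  shows "emp n x (\<lambda>y. (c + lincomb N \<phi> v y)\<^sup>2) = quad_form N (ecov n x \<phi>) v + (c + emp n x (lincomb N \<phi> v))\<^sup>2"
proof -
  have "(c + lincomb N \<phi> v y)\<^sup>2 = c\<^sup>2 + (2 * c * lincomb N \<phi> v y + (lincomb N \<phi> v y)\<^sup>2)" for y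
    by (simp add: power2_sum)
  then have "emp n x (\<lambda>y. (c + lincomb N \<phi> v y)\<^sup>2)
      = c\<^sup>2 + (2 * c * emp n x (lincomb N \<phi> v) + emp n x (\<lambda>y. (lincomb N \<phi> v y)\<^sup>2))"
    using assms by (simp only: emp_add emp_mult_left emp_const)
  then show ?thesis unfolding quad_form_ecov by (simp add: power2_sum)
qed

lemma quad_form_ecov_nonneg: "n \<ge> 1 \<Longrightarrow> quad_form N (ecov n x \<phi>) v \<ge> 0"
  using emp_affine_sq[of n x "- emp n x (lincomb N \<phi> v)" N \<phi> v]
    emp_nonneg[of "\<lambda>y. (- emp n x (lincomb N \<phi> v) + lincomb N \<phi> v y)\<^sup>2" n x] by simp

text \<open>\<open>Q0\<close> and the empirical measure agree on constants, so \<open>c\<close>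
  enters the objective only through minus a quarter of a squared mean. The best \<open>c\<close>
  centres the function, and this turns second moments into covariances.\<close>

lemma chi_sq_eq_SUP:
  fixes \<phi> :: "nat \<Rightarrow> real^'d \<Rightarrow> real"
  assumes n: "n \<ge> 1" and "prob_space (Q0 :: (real^'d) measure)"
    and span: "fun_space.span (F \<union> {\<lambda>_. 1}) = affine_span N \<phi>"
    and int: "\<And>a. a < N \<Longrightarrow> integrable Q0 (\<phi> a)"
  shows "chi_sq n x F = (SUP v. ereal (- (\<Sum>a<N. v a * (emp n x (\<phi> a) - (\<integral>y. \<phi> a y \<partial>Q0)))
    - 1/4 * quad_form N (ecov n x \<phi>) v))"
    (is "_ = (SUP v. ereal (?R v))")
proof -
  interpret Q: prob_space "Q0 :: (real^'d) measure" by fact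
  have val: "((\<integral>y. c + lincomb N \<phi> v y \<partial>Q0) - emp n x (\<lambda>y. c + lincomb N \<phi> v y))
    - 1/4 * emp n x (\<lambda>y. (c + lincomb N \<phi> v y)\<^sup>2)
      = ?R v - 1/4 * (c + emp n x (lincomb N \<phi> v))\<^sup>2" for c v
  proof -
    have "(\<integral>y. c + lincomb N \<phi> v y \<partial>Q0) = c + (\<Sum>a<N. v a * (\<integral>y. \<phi> a y \<partial>Q0))"
    proof -
      have i: "integrable Q0 (\<lambda>y. v a * \<phi> a y)" if "a < N" for a using int[OF that] by simp
      then have "integrable Q0 (\<lambda>y. \<Sum>a<N. v a * \<phi> a y)" by (intro Bochner_Integration.integrable_sum) auto
      moreover have "(\<integral>y. (\<Sum>a<N. v a * \<phi> a y) \<partial>Q0) = (\<Sum>a<N. v a * (\<integral>y. \<phi> a y \<partial>Q0))"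
        using i by (subst Bochner_Integration.integral_sum) auto
      ultimately show ?thesis unfolding lincomb_def by (simp add: Q.prob_space)
    qed
    moreover have "emp n x (\<lambda>y. c + lincomb N \<phi> v y) = c + (\<Sum>a<N. v a * emp n x (\<phi> a))"
      using n by (simp only: emp_add emp_const emp_lincomb)
    ultimately show ?thesis
      unfolding emp_affine_sq[OF n] by (simp add: right_diff_distrib sum_subtractf add_divide_distrib)
  qed
  show ?thesis
    unfolding chi_sq_def span
  proof (rule antisym; rule SUP_least)
    fix f assume "f \<in> affine_span N \<phi>"
    then obtain c v where f: "f = (\<lambda>y. c + lincomb N \<phi> v y)" by blast
    show "ereal (((\<integral>y. f y \<partial>Q0) - emp n x f) - 1/4 * emp n x (\<lambda>y. (f y)\<^sup>2)) \<le> (SUP v. ereal (?R v))"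
      unfolding f val by (rule SUP_upper2[of v]) auto
  next
    fix v
    let ?f = "\<lambda>y. - emp n x (lincomb N \<phi> v) + lincomb N \<phi> v y"
    show "ereal (?R v) \<le> (SUP f\<in>affine_span N \<phi>.
        ereal (((\<integral>y. f y \<partial>Q0) - emp n x f) - 1/4 * emp n x (\<lambda>y. (f y)\<^sup>2)))"
    proof (rule SUP_upper2[of ?f])
      show "ereal (?R v) \<le> ereal (((\<integral>y. ?f y \<partial>Q0) - emp n x ?f) - 1/4 * emp n x (\<lambda>y. (?f y)\<^sup>2))"
        unfolding val by simp
    qed blast
  qed
qed

text \<open>Completing the square around \<open>v = - 2 * w\<close>, where \<open>w\<close> solves
  \<open>C w = g\<close>. The factor 1/4 in the objective makes the maximum \<open>w' C w\<close>
  without a further constant.\<close>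

lemma SUP_concave_quadratic:
  fixes g w :: "nat \<Rightarrow> real"
  assumes nn: "\<And>v. quad_form N C v \<ge> 0" and sym: "\<And>a b. C a b = C b a"
    and g: "\<And>a. a < N \<Longrightarrow> g a = (\<Sum>b<N. C a b * w b)"
  shows "(SUP v. ereal (- (\<Sum>a<N. v a * g a) - 1/4 * quad_form N C v)) = ereal (\<Sum>a<N. w a * g a)"
proof -
  have bil: "(\<Sum>a<N. v a * g a) = (\<Sum>a<N. \<Sum>b<N. v a * w b * C a b)" for v
    by (intro sum.cong refl) (auto simp: g sum_distrib_left mult_ac)
  have bil': "(\<Sum>a<N. v a * g a) = (\<Sum>a<N. \<Sum>b<N. w a * v b * C a b)" for v
    unfolding bil by (subst sum.swap) (auto simp: mult_ac sym[of _ _] intro!: sum.cong)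
  have wg: "(\<Sum>a<N. w a * g a) = quad_form N C w" unfolding bil quad_form_def ..
  have eq: "- (\<Sum>a<N. v a * g a) - 1/4 * quad_form N C v
    = quad_form N C w - 1/4 * quad_form N C (\<lambda>a. v a + 2 * w a)" for v
  proof -
    have "quad_form N C (\<lambda>a. v a + 2 * w a) = quad_form N C v + 2 * (\<Sum>a<N. \<Sum>b<N. v a * w b * C a b)
        + 2 * (\<Sum>a<N. \<Sum>b<N. w a * v b * C a b) + 4 * quad_form N C w"
      unfolding quad_form_def sum_distrib_left sum.distrib[symmetric]
      by (intro sum.cong refl) (simp add: algebra_simps)
    then show ?thesis unfolding bil[symmetric] bil'[symmetric] by (simp add: add_divide_distrib)
  qed
  show ?thesis
    unfolding wg
  proof (rule antisym)
    show "(SUP v. ereal (- (\<Sum>a<N. v a * g a) - 1/4 * quad_form N C v)) \<le> ereal (quad_form N C w)"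
      unfolding eq using nn by (intro SUP_least) simp
    have "quad_form N C (\<lambda>a. - 2 * w a + 2 * w a) = 0" by (simp add: quad_form_def)
    then show "ereal (quad_form N C w) \<le> (SUP v. ereal (- (\<Sum>a<N. v a * g a) - 1/4 * quad_form N C v))"
      unfolding eq by (intro SUP_upper2[of "\<lambda>a. - 2 * w a"]) auto
  qed
qed

text \<open>No inverse or eigenvalue is estimated. From above, the form is replaced by
  \<open>1 - \<epsilon>\<close> times the identity and the square completed, with
  \<open>1 / (1 - \<epsilon>) \<le> 1 + 2 * \<epsilon>\<close>; from below, one test vector is
  enough.\<close>

lemma SUP_near_identity_quadratic:
  fixes g :: "nat \<Rightarrow> real" and N :: nat
  defines "G \<equiv> \<Sum>a<N. (g a)\<^sup>2"
  assumes e: "0 \<le> \<epsilon>" "\<epsilon> \<le> 1/2"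
    and C: "\<And>v. \<bar>quad_form N C v - (\<Sum>a<N. (v a)\<^sup>2)\<bar> \<le> \<epsilon> * (\<Sum>a<N. (v a)\<^sup>2)"
    and s: "(SUP v. ereal (- (\<Sum>a<N. v a * g a) - 1/4 * quad_form N C v)) = ereal s"
  shows "\<bar>s - G\<bar> \<le> 2 * \<epsilon> * G"
proof -
  have G: "G \<ge> 0" by (simp add: G_def sum_nonneg)
  have "s \<le> G / (1 - \<epsilon>)"
  proof -
    have "- (\<Sum>a<N. v a * g a) - 1/4 * quad_form N C v \<le> G / (1 - \<epsilon>)" for v
    proof -
      have "(1 - \<epsilon>) * (\<Sum>a<N. (v a)\<^sup>2) \<le> quad_form N C v"
        using C[of v] by (simp add: abs_le_iff algebra_simps)
      moreover have "0 \<le> (\<Sum>a<N. (g a + (1 - \<epsilon>) / 2 * v a)\<^sup>2)" by (simp add: sum_nonneg)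
      then have "0 \<le> G + (1 - \<epsilon>) * (\<Sum>a<N. v a * g a) + (1 - \<epsilon>) * ((1 - \<epsilon>) * (\<Sum>a<N. (v a)\<^sup>2)) / 4"
      proof -
        have "(g a + d / 2 * v a)\<^sup>2 = (g a)\<^sup>2 + d * (v a * g a) + d * (d * (v a)\<^sup>2) / 4" for d a
          by (simp add: power2_eq_square field_simps)
        then have "(\<Sum>a<N. (g a + d / 2 * v a)\<^sup>2)
          = G + d * (\<Sum>a<N. v a * g a) + d * (d * (\<Sum>a<N. (v a)\<^sup>2)) / 4" for d
          by (simp only: sum.distrib G_def sum_distrib_left sum_divide_distrib)
        then show ?thesis using \<open>0 \<le> (\<Sum>a<N. (g a + (1 - \<epsilon>) / 2 * v a)\<^sup>2)\<close> by simp
      qed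
      moreover have "(1 - \<epsilon>) * ((1 - \<epsilon>) * (\<Sum>a<N. (v a)\<^sup>2)) \<le> (1 - \<epsilon>) * quad_form N C v"
        using calculation(1) e by (intro mult_left_mono) auto
      ultimately have "(1 - \<epsilon>) * (- (\<Sum>a<N. v a * g a) - 1/4 * quad_form N C v) \<le> G"
        by (simp add: right_diff_distrib)
      then show ?thesis using e by (simp add: pos_le_divide_eq mult.commute)
    qed
    then have "(SUP v. ereal (- (\<Sum>a<N. v a * g a) - 1/4 * quad_form N C v)) \<le> ereal (G / (1 - \<epsilon>))"
      by (intro SUP_least) simp
    then show ?thesis unfolding s by simp
  qed
  also have "\<dots> \<le> (1 + 2 * \<epsilon>) * G"
  proof -
    have "1 \<le> (1 + 2 * \<epsilon>) * (1 - \<epsilon>)" using e mult_left_mono[of \<epsilon> "1/2" \<epsilon>] by (simp add: algebra_simps)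
    then have "G \<le> G * ((1 + 2 * \<epsilon>) * (1 - \<epsilon>))" using G mult_left_mono by fastforce
    then show ?thesis using e by (simp add: pos_divide_le_eq mult_ac)
  qed
  finally have up: "s \<le> (1 + 2 * \<epsilon>) * G" .
  \<comment> \<open>\<open>- 2 * g\<close> is the maximiser for the identity matrix.\<close>
  have "(1 - \<epsilon>) * G \<le> - (\<Sum>a<N. (-2 * g a) * g a) - 1/4 * quad_form N C (\<lambda>a. -2 * g a)"
  proof -
    have 1: "(\<Sum>a<N. (-2 * g a) * g a) = - 2 * G"
      unfolding G_def sum_distrib_left by (intro sum.cong refl) (simp add: power2_eq_square)
    have 2: "(\<Sum>a<N. (-2 * g a)\<^sup>2) = 4 * G"
      unfolding G_def sum_distrib_left by (intro sum.cong refl) (simp add: power_mult_distrib)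
    show ?thesis using C[of "\<lambda>a. -2 * g a"] unfolding 1 2 by (simp add: abs_le_iff algebra_simps)
  qed
  also have "\<dots> \<le> s"
  proof -
    have "ereal (- (\<Sum>a<N. (-2 * g a) * g a) - 1/4 * quad_form N C (\<lambda>a. -2 * g a)) \<le> ereal s"
      unfolding s[symmetric] by (rule SUP_upper) simp
    then show ?thesis by simp
  qed
  finally have "(1 - \<epsilon>) * G \<le> s" .
  moreover have "\<epsilon> * G \<ge> 0" using e G by simp
  ultimately show ?thesis using up by (simp add: abs_le_iff algebra_simps)
qed

section \<open>Coordinates in the enumerated class and the inverse covariance matrix\<close>

lemma span_eq_affine:
  fixes F :: "('a \<Rightarrow> real) set"
  assumes "finite F"
  shows "fun_space.span (F \<union> {\<lambda>_. 1}) = affine_span (card F) (from_nat_into F)"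
    (is "_ = ?A")
proof
  let ?N = "card F" and ?\<phi> = "from_nat_into F"
  have bij: "bij_betw ?\<phi> {..<?N} F" by (rule bij_betw_from_nat_into_finite[OF assms])
  show "fun_space.span (F \<union> {\<lambda>_. 1}) \<subseteq> ?A"
  proof (rule fun_space.span_minimal)
    show "F \<union> {\<lambda>_. 1} \<subseteq> ?A"
    proof
      fix f assume "f \<in> F \<union> {\<lambda>_. 1}"
      then consider "f \<in> F" | "f = (\<lambda>_. 1)" by blast
      then show "f \<in> ?A"
      proof cases
        case 1
        then obtain a where a: "a < ?N" "f = ?\<phi> a" using bij by (auto simp: bij_betw_def)
        then have "f = (\<lambda>y. 0 + lincomb ?N ?\<phi> (\<lambda>b. if b = a then 1 else 0) y)"
          by (simp add: lincomb_def if_distrib[of "\<lambda>z. z * _"] sum.delta cong: if_cong)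
        then show ?thesis by blast
      next
        case 2
        then have "f = (\<lambda>y. 1 + lincomb ?N ?\<phi> (\<lambda>_. 0) y)" by (simp add: lincomb_def)
        then show ?thesis by blast
      qed
    qed
    show "fun_space.subspace ?A"
      unfolding fun_space.subspace_def
    proof (intro conjI ballI allI)
      have "0 = (\<lambda>y. 0 + lincomb ?N ?\<phi> (\<lambda>_. 0) y)" by (simp add: lincomb_def fun_eq_iff)
      then show "0 \<in> ?A" by blast
    next
      fix f g assume "f \<in> ?A" "g \<in> ?A"
      then obtain c v d w where "f = (\<lambda>y. c + lincomb ?N ?\<phi> v y)" "g = (\<lambda>y. d + lincomb ?N ?\<phi> w y)" by blast
      then have "f + g = (\<lambda>y. (c + d) + lincomb ?N ?\<phi> (\<lambda>a. v a + w a) y)"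
        by (simp add: lincomb_def fun_eq_iff distrib_right sum.distrib)
      then show "f + g \<in> ?A" by blast
    next
      fix r f assume "f \<in> ?A"
      then obtain c v where "f = (\<lambda>y. c + lincomb ?N ?\<phi> v y)" by blast
      then have "(\<lambda>x. r * f x) = (\<lambda>y. r * c + lincomb ?N ?\<phi> (\<lambda>a. r * v a) y)"
        by (simp add: lincomb_def fun_eq_iff distrib_left sum_distrib_left mult_ac)
      then show "(\<lambda>x. r * f x) \<in> ?A" by blast
    qed
  qed
  have "(\<lambda>y. c + lincomb m ?\<phi> v y) \<in> fun_space.span (F \<union> {\<lambda>_. 1})" if "m \<le> ?N" for c v m
    using that
  proof (induction m)
    case 0
    have "(\<lambda>y. c * (\<lambda>_. 1) y) \<in> fun_space.span (F \<union> {\<lambda>_. 1})"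
      by (intro fun_space.span_scale fun_space.span_base) simp
    then show ?case by (simp add: lincomb_def)
  next
    case (Suc m)
    have "?\<phi> m \<in> F" using bij Suc.prems by (auto simp: bij_betw_def)
    then have "(\<lambda>y. v m * ?\<phi> m y) \<in> fun_space.span (F \<union> {\<lambda>_. 1})"
      by (intro fun_space.span_scale fun_space.span_base) simp
    from fun_space.span_add[OF Suc.IH this] Suc.prems
    show ?case by (simp add: lincomb_def plus_fun_def add_ac)
  qed
  then show "?A \<subseteq> fun_space.span (F \<union> {\<lambda>_. 1})" by blast
qed

text \<open>The specification of \<open>mat_inverse\<close> is in terms of units of the matrix ring,
  hence the passage through \<open>ring_mat\<close>.\<close>

lemma invertible_mat_inverse:
  fixes A :: "real mat"
  assumes A: "A \<in> carrier_mat N N" and inv: "invertible_mat A"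
  obtains B where "mat_inverse A = Some B" "A * B = 1\<^sub>m N" "B \<in> carrier_mat N N"
proof -
  obtain B where B: "inverts_mat A B" "inverts_mat B A" using inv by (auto simp: invertible_mat_def)
  have AB: "A * B = 1\<^sub>m N" using B(1) A by (simp add: inverts_mat_def)
  have BA: "B * A = 1\<^sub>m (dim_row B)" using B(2) by (simp add: inverts_mat_def)
  have "dim_col B = N" using arg_cong[OF AB, of dim_col] by simp
  moreover have "dim_row B = N" using arg_cong[OF BA, of dim_col] A by simp
  ultimately have cB: "B \<in> carrier_mat N N" by auto
  have "A \<in> Units (ring_mat TYPE(real) N ())"
    unfolding Units_def using A cB AB BA \<open>dim_row B = N\<close> by (auto simp: ring_mat_def)
  then obtain B' where "mat_inverse A = Some B'" using mat_inverse(1)[OF A, of "()"]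
    by (cases "mat_inverse A") auto
  then show thesis using mat_inverse(2)[OF A] that by blast
qed

lemma invertible_mat_of_trivial_kernel:
  fixes A :: "real mat"
  assumes A: "A \<in> carrier_mat N N"
    and ker: "\<And>v. v \<in> carrier_vec N \<Longrightarrow> A *\<^sub>v v = 0\<^sub>v N \<Longrightarrow> v = 0\<^sub>v N"
  shows "invertible_mat A"
proof -
  have "Determinant.det A \<noteq> 0" using det_0_iff_vec_prod_zero_field[OF A] ker by blast
  from det_non_zero_imp_unit[OF A this, of "()"]
  obtain B where "B \<in> carrier_mat N N" "A * B = 1\<^sub>m N" "B * A = 1\<^sub>m N"
    unfolding Units_def by (auto simp: ring_mat_def)
  then show ?thesis using A unfolding invertible_mat_def inverts_mat_def by auto
qed

lemma emp_cov_mult_vec: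
  assumes "v \<in> carrier_vec (card F)" "a < card F"
  shows "(emp_cov n x F *\<^sub>v v) $ a = (\<Sum>b<card F. ecov n x (from_nat_into F) a b * v $ b)"
  using assms by (simp add: emp_cov_def ecov_def scalar_prod_def lessThan_atLeast0)

text \<open>A vector in the kernel makes the quadratic form vanish, so definiteness forces it to be
  0.\<close>

lemma invertible_emp_cov:
  assumes "n \<ge> 1" and pos: "\<And>v. quad_form (card F) (ecov n x (from_nat_into F)) v = 0 \<Longrightarrow> (\<forall>a<card F. v a = 0)"
  shows "invertible_mat (emp_cov n x F)"
proof (rule invertible_mat_of_trivial_kernel)
  show "emp_cov n x F \<in> carrier_mat (card F) (card F)" by (simp add: emp_cov_def)
  fix v assume v: "v \<in> carrier_vec (card F)" "emp_cov n x F *\<^sub>v v = 0\<^sub>v (card F)"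
  have "quad_form (card F) (ecov n x (from_nat_into F)) (vec_index v)
      = (\<Sum>a<card F. v $ a * (\<Sum>b<card F. ecov n x (from_nat_into F) a b * v $ b))"
    unfolding quad_form_def by (simp add: sum_distrib_left mult_ac)
  also have "\<dots> = (\<Sum>a<card F. v $ a * (emp_cov n x F *\<^sub>v v) $ a)"
    by (intro sum.cong refl) (simp add: emp_cov_mult_vec[OF v(1)])
  also have "\<dots> = 0" unfolding v(2) by simp
  finally have "\<forall>a<card F. v $ a = 0" by (rule pos)
  then show "v = 0\<^sub>v (card F)" using v(1) by (intro eq_vecI) auto
qed

text \<open>Equality of the means under \<open>Q0\<close> and \<open>P\<close> on \<open>F\<close>
  is what lets the \<open>Q0\<close> in \<open>chi_sq\<close> be matched with the \<open>P\<close>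
  in \<open>gamma_vec\<close>; the rest is the concave maximum in the coordinates of
  \<open>F\<close>.\<close>

lemma chi_sq_eq_inv_quad_form:
  fixes F :: "(real^'d \<Rightarrow> real) set"
  assumes n: "n \<ge> 1" and F: "finite F" and Q0: "prob_space (Q0 :: (real^'d) measure)"
    and int: "\<And>f. f \<in> F \<Longrightarrow> integrable Q0 f" and marg: "\<And>f. f \<in> F \<Longrightarrow> (\<integral>y. f y \<partial>Q0) = (\<integral>y. f y \<partial>P)"
    and inv: "invertible_mat (emp_cov n x F)"
  shows "ereal n * chi_sq n x F = ereal (inv_quad_form (emp_cov n x F) (gamma_vec P n x F))"
proof -
  let ?N = "card F" and ?\<phi> = "from_nat_into F" and ?S = "emp_cov n x F" and ?\<gamma> = "gamma_vec P n x F"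
  have \<phi>F: "?\<phi> a \<in> F" if "a < ?N" for a
    using bij_betw_from_nat_into_finite[OF F] that by (auto simp: bij_betw_def)
  have S: "?S \<in> carrier_mat ?N ?N" by (simp add: emp_cov_def)
  have \<gamma>: "?\<gamma> \<in> carrier_vec ?N" by (simp add: gamma_vec_def)
  obtain B where B: "mat_inverse ?S = Some B" "?S * B = 1\<^sub>m ?N" "B \<in> carrier_mat ?N ?N"
    using invertible_mat_inverse[OF S inv] .
  define z where "z = B *\<^sub>v ?\<gamma>"
  have z: "z \<in> carrier_vec ?N" using B(3) \<gamma> by (simp add: z_def)
  have Sz: "?S *\<^sub>v z = ?\<gamma>"
    unfolding z_def using assoc_mult_mat_vec[OF S B(3) \<gamma>] B(2) \<gamma> by simp
  define g where "g a = emp n x (?\<phi> a) - (\<integral>y. ?\<phi> a y \<partial>Q0)" for a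
  have \<gamma>g: "?\<gamma> $ a = sqrt n * g a" if "a < ?N" for a
    using that marg[OF \<phi>F[OF that]] by (simp add: gamma_vec_def g_def)
  \<comment> \<open>The solution of \<open>S w = g\<close>: the vector \<open>?\<gamma>\<close> is
    \<open>sqrt n\<close> times \<open>g\<close>, so the solution \<open>z\<close> for
    \<open>?\<gamma>\<close> is rescaled.\<close>
  define w where "w a = z $ a / sqrt n" for a
  have gw: "g a = (\<Sum>b<?N. ecov n x ?\<phi> a b * w b)" if "a < ?N" for a
  proof -
    have "sqrt n * g a = (\<Sum>b<?N. ecov n x ?\<phi> a b * z $ b)"
      using emp_cov_mult_vec[OF z that, of n x] \<gamma>g[OF that] Sz by simp
    then show ?thesis using n by (simp add: w_def field_simps flip: sum_divide_distrib)
  qed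
  have "chi_sq n x F = (SUP v. ereal (- (\<Sum>a<?N. v a * g a) - 1/4 * quad_form ?N (ecov n x ?\<phi>) v))"
    unfolding g_def by (rule chi_sq_eq_SUP[OF n Q0 span_eq_affine[OF F]]) (intro int \<phi>F)
  also have "\<dots> = ereal (\<Sum>a<?N. w a * g a)"
    by (rule SUP_concave_quadratic[OF quad_form_ecov_nonneg[OF n] _ gw]) (auto simp: ecov_def mult_ac)
  finally have chi: "chi_sq n x F = ereal (\<Sum>a<?N. w a * g a)" .
  have "n * (\<Sum>a<?N. w a * g a) = (\<Sum>a<?N. ?\<gamma> $ a * z $ a)"
    unfolding sum_distrib_left using n by (intro sum.cong refl) (simp add: \<gamma>g w_def real_div_sqrt field_simps)
  also have "\<dots> = scalar_prod ?\<gamma> z" using z by (simp add: scalar_prod_def lessThan_atLeast0)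
  finally show ?thesis unfolding chi inv_quad_form_def B(1) z_def by simp
qed

section \<open>Variance of step functions\<close>

text \<open>Open, so that neighbouring slabs with a common face are disjoint and the strict
  inequalities of \<open>step_sum_shift\<close> hold on them.\<close>

definition slab :: "'d::finite \<Rightarrow> real \<Rightarrow> real \<Rightarrow> (real^'d) set" where
  "slab j p q = box (\<chi> l. if l = j then p else 0) (\<chi> l. if l = j then q else 1)"

lemma mem_slab: "x \<in> slab j p q \<longleftrightarrow> (\<forall>l. if l = j then p < x $ l \<and> x $ l < q else 0 < x $ l \<and> x $ l < 1)"
  unfolding slab_def mem_box_cart by (auto split: if_splits)

lemma content_cslab:
  fixes j :: "'d::finite"
  assumes "p \<le> q"
  shows "measure lborel (cbox (\<chi> l. if l = j then p else 0) (\<chi> l. if l = j then q else (1::real))) = q - p"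
proof -
  have "cbox (\<chi> l. if l = j then p else 0) (\<chi> l. if l = j then q else (1::real)) \<noteq> {}"
    using assms unfolding interval_ne_empty_cart by auto
  then have "measure lborel (cbox (\<chi> l. if l = j then p else 0) (\<chi> l. if l = j then q else (1::real)))
      = (\<Prod>i\<in>UNIV. if i = j then q - p else 1)"
    by (subst content_cbox_cart) (assumption, intro prod.cong refl, simp)
  then show ?thesis by simp
qed

lemma emeasure_slab:
  assumes "p \<le> q" shows "emeasure lborel (slab j p q) = ennreal (q - p)"
proof -
  let ?a = "\<chi> l. if l = j then p else 0" and ?b = "\<chi> l. if l = j then q else (1::real)"
  have "emeasure lborel (box ?a ?b) = emeasure lborel (cbox ?a ?b)"
  proof -
    have "?a \<bullet> b \<le> ?b \<bullet> b" if "b \<in> Basis" for b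
      using that assms by (auto simp: Basis_vec_def inner_axis)
    then show ?thesis by (simp add: emeasure_lborel_box_eq emeasure_lborel_cbox_eq)
  qed
  also have "\<dots> = ennreal (measure lborel (cbox ?a ?b))"
    using emeasure_lborel_cbox_finite[of ?a ?b] by (intro emeasure_eq_ennreal_measure) auto
  finally show ?thesis unfolding slab_def content_cslab[OF assms] .
qed

lemma emeasure_unit_cube: "emeasure lborel (cbox 0 (1::real^'d)) = 1"
proof -
  have "emeasure lborel (cbox 0 (1::real^'d)) = ennreal (measure lborel (cbox 0 (1::real^'d)))"
    using emeasure_lborel_cbox_finite[of 0 "1::real^'d"] by (intro emeasure_eq_ennreal_measure) auto
  also have "cbox 0 (1::real^'d) \<noteq> {}" unfolding interval_ne_empty_cart by simp
  then have "measure lborel (cbox 0 (1::real^'d)) = 1" by (subst content_cbox_cart) auto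
  finally show ?thesis by simp
qed

lemma sets_Q0 [measurable_cong]: "sets (Q0 :: (real^'d) measure) = sets borel"
  by (simp add: Q0_def)

lemma prob_space_Q0: "prob_space (Q0 :: (real^'d) measure)"
  unfolding Q0_def by (rule prob_space_uniform_measure)
    (simp_all add: emeasure_unit_cube del: emeasure_lborel_cbox)

lemma nn_integral_Q0:
  assumes "f \<in> borel_measurable borel"
  shows "(\<integral>\<^sup>+x. f x \<partial>(Q0 :: (real^'d) measure)) = (\<integral>\<^sup>+x. f x * indicator (cbox 0 1) x \<partial>lborel)"
  unfolding Q0_def using assms by (subst nn_integral_uniform_measure)
    (auto simp: emeasure_unit_cube divide_ennreal_def simp del: emeasure_lborel_cbox)

lemma measurable_vec_nth [measurable]: "(\<lambda>x::real^'d. x $ j) \<in> borel_measurable borel"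
  by (intro borel_measurable_continuous_onI continuous_intros)

lemma half_ind_measurable [measurable]: "half_ind v j \<in> borel_measurable borel"
  unfolding half_ind_def[abs_def] by measurable

definition step_sum :: "(nat \<Rightarrow> real) \<Rightarrow> nat \<Rightarrow> (nat \<Rightarrow> 'd \<Rightarrow> real) \<Rightarrow> real^'d \<Rightarrow> real" where
  "step_sum u m w x = (\<Sum>i=1..m. \<Sum>j\<in>UNIV. w i j * half_ind (u i) j x)"

lemma step_sum_measurable [measurable]: "step_sum u m w \<in> borel_measurable borel"
  unfolding step_sum_def[abs_def] by measurable

text \<open>A step function jumps by \<open>w i j\<close> when \<open>x\<^sub>j\<close> crosses \<open>u i\<close>, so its values just below and
  just above that point cannot both be close to \<open>c\<close>.\<close>

lemma step_sum_shift:
  fixes x :: "real^'d"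
  assumes gap: "\<And>l. l \<in> {1..m} \<Longrightarrow> l \<noteq> i \<Longrightarrow> \<bar>u l - u i\<bar> \<ge> \<delta>" and i: "i \<in> {1..m}"
    and x: "u i - \<delta> < x $ j" "x $ j < u i"
  shows "step_sum u m w x - step_sum u m w (axis j \<delta> + x) = w i j"
proof -
  have nth: "(axis j \<delta> + x) $ l = (if l = j then x $ j + \<delta> else x $ l)" for l
    by (simp add: axis_def)
  have "half_ind (u l) j' x - half_ind (u l) j' (axis j \<delta> + x) = (if l = i \<and> j' = j then 1 else 0)"
    if "l \<in> {1..m}" for l j'
  proof (cases "j' = j \<and> l \<noteq> i")
    case True
    then have "\<bar>u l - u i\<bar> \<ge> \<delta>" using gap that by blast
    then show ?thesis using x True unfolding half_ind_def nth by (auto simp: abs_if split: if_splits)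
  next
    case False
    then show ?thesis using x unfolding half_ind_def nth by auto
  qed
  then have "step_sum u m w x - step_sum u m w (axis j \<delta> + x)
      = (\<Sum>l=1..m. \<Sum>j'\<in>UNIV. w l j' * (if l = i \<and> j' = j then 1 else 0))"
    unfolding step_sum_def sum_subtractf[symmetric] by (intro sum.cong refl) (simp flip: right_diff_distrib)
  also have "\<dots> = (\<Sum>l=1..m. if l = i then w i j else 0)"
  proof (intro sum.cong refl)
    fix l
    have "(\<Sum>j'\<in>UNIV. w l j' * (if l = i \<and> j' = j then 1 else 0))
      = (\<Sum>j'\<in>UNIV. if j' = j then (if l = i then w i j else 0) else 0)"
      by (intro sum.cong refl) auto
    then show "(\<Sum>j'\<in>UNIV. w l j' * (if l = i \<and> j' = j then 1 else 0)) = (if l = i then w i j else 0)"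
      by simp
  qed
  also have "\<dots> = w i j" using i by simp
  finally show ?thesis .
qed

text \<open>For one direction \<open>j\<close>, translation by \<open>\<delta>\<close> carries the
  slab below each grid point onto the slab above it, and the constant \<open>c\<close> cancels in
  the difference of the two values. The slabs below are disjoint for different \<open>i\<close>, as
  are those above. The 4 is the 2 of \<open>diff_sq_le\<close> times these two families.\<close>

lemma step_sum_column_bound:
  fixes w :: "nat \<Rightarrow> 'd::finite \<Rightarrow> real"
  assumes \<delta>: "\<delta> > 0"
    and gap: "\<And>i l. i \<in> {1..m} \<Longrightarrow> l \<in> {1..m} \<Longrightarrow> l \<noteq> i \<Longrightarrow> \<bar>u l - u i\<bar> \<ge> \<delta>"
    and range: "\<And>i. i \<in> {1..m} \<Longrightarrow> \<delta> \<le> u i \<and> u i + \<delta> \<le> 1"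
  shows "ennreal (\<delta> * (\<Sum>i=1..m. (w i j)\<^sup>2))
    \<le> 4 * (\<integral>\<^sup>+x. ennreal ((step_sum u m w x - c)\<^sup>2) * indicator (cbox 0 1) x \<partial>lborel)"
proof -
  let ?H = "\<lambda>x. ennreal ((step_sum u m w x - c)\<^sup>2)"
  let ?A = "\<lambda>i. slab j (u i - \<delta>) (u i)" and ?A' = "\<lambda>i. slab j (u i) (u i + \<delta>)"
  let ?I = "\<integral>\<^sup>+x. ?H x * indicator (cbox 0 1) x \<partial>lborel"
  have [measurable]: "slab j p q \<in> sets borel" for p q unfolding slab_def by simp
  have one: "ennreal (\<delta> * (w i j)\<^sup>2) \<le> 2 * (\<integral>\<^sup>+x. ?H x * indicator (?A i) x \<partial>lborel)
    + 2 * (\<integral>\<^sup>+x. ?H x * indicator (?A' i) x \<partial>lborel)"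
    if i: "i \<in> {1..m}" for i
  proof -
    have "ennreal (\<delta> * (w i j)\<^sup>2) = (\<integral>\<^sup>+x. ennreal ((w i j)\<^sup>2) * indicator (?A i) x \<partial>lborel)"
      using \<delta> by (simp add: nn_integral_cmult emeasure_slab flip: ennreal_mult)
    also have "\<dots> \<le> (\<integral>\<^sup>+x. 2 * (?H x * indicator (?A i) x)
      + 2 * (?H (axis j \<delta> + x) * indicator (?A' i) (axis j \<delta> + x)) \<partial>lborel)"
    proof (rule nn_integral_mono)
      fix x :: "real^'d"
      show "ennreal ((w i j)\<^sup>2) * indicator (?A i) x
          \<le> 2 * (?H x * indicator (?A i) x) + 2 * (?H (axis j \<delta> + x) * indicator (?A' i) (axis j \<delta> + x))"
      proof (cases "x \<in> ?A i")
        case True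
        then have xj: "u i - \<delta> < x $ j" "x $ j < u i" by (auto simp: mem_slab dest: spec[of _ j])
        have mem: "axis j \<delta> + x \<in> ?A' i" 
        proof -
          have m: "if l = j then u i - \<delta> < x $ l \<and> x $ l < u i else 0 < x $ l \<and> x $ l < 1" for l
            using True unfolding mem_slab by blast
          have "if l = j then u i < (axis j \<delta> + x) $ l \<and> (axis j \<delta> + x) $ l < u i + \<delta>
              else 0 < (axis j \<delta> + x) $ l \<and> (axis j \<delta> + x) $ l < 1" for l
            using m[of l] by (cases "l = j") (auto simp: axis_def)
          then show ?thesis unfolding mem_slab by blast
        qed
        have "w i j = (step_sum u m w x - c) - (step_sum u m w (axis j \<delta> + x) - c)"
          using step_sum_shift[where u = u and \<delta> = \<delta> and m = m and i = i, OF gap[OF i] i xj, of w] by simp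
        then have "(w i j)\<^sup>2 \<le> 2 * (step_sum u m w x - c)\<^sup>2 + 2 * (step_sum u m w (axis j \<delta> + x) - c)\<^sup>2"
          by (simp only: diff_sq_le)
        then have "ennreal ((w i j)\<^sup>2) \<le> ennreal (2 * (step_sum u m w x - c)\<^sup>2
          + 2 * (step_sum u m w (axis j \<delta> + x) - c)\<^sup>2)"
          by (rule ennreal_leI)
        also have "\<dots> = 2 * ?H x + 2 * ?H (axis j \<delta> + x)"
          by (simp add: ennreal_plus ennreal_mult)
        finally show ?thesis using True mem by simp
      qed simp
    qed
    also have "\<dots> = 2 * (\<integral>\<^sup>+x. ?H x * indicator (?A i) x \<partial>lborel)
        + 2 * (\<integral>\<^sup>+x. ?H (axis j \<delta> + x) * indicator (?A' i) (axis j \<delta> + x) \<partial>lborel)"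
      by (subst nn_integral_add) (auto simp: nn_integral_cmult)
    also have "(\<integral>\<^sup>+x. ?H (axis j \<delta> + x) * indicator (?A' i) (axis j \<delta> + x) \<partial>lborel)
      = (\<integral>\<^sup>+x. ?H x * indicator (?A' i) x \<partial>distr lborel borel ((+) (axis j \<delta>)))"
      by (subst nn_integral_distr) auto
    finally show ?thesis unfolding lborel_distr_plus .
  qed
  have disj: "(\<Sum>i=1..m. \<integral>\<^sup>+x. ?H x * indicator (B i) x \<partial>lborel) \<le> ?I"
    if d: "disjoint_family_on B {1..m}" and s: "\<And>i. i \<in> {1..m} \<Longrightarrow> B i \<subseteq> cbox 0 1"
      and [measurable]: "\<And>i. B i \<in> sets borel"
    for B :: "nat \<Rightarrow> (real^'d) set"
  proof -
    have "(\<Sum>i=1..m. \<integral>\<^sup>+x. ?H x * indicator (B i) x \<partial>lborel)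
      = (\<integral>\<^sup>+x. (\<Sum>i=1..m. ?H x * indicator (B i) x) \<partial>lborel)"
      by (rule nn_integral_sum[symmetric]) auto
    also have "\<dots> \<le> ?I"
    proof (rule nn_integral_mono)
      fix x :: "real^'d"
      have "(\<Sum>i=1..m. indicator (B i) x) = (indicator (\<Union>i\<in>{1..m}. B i) x :: ennreal)"
        by (rule indicator_UN_disjoint[symmetric]) (use d in auto)
      also have "\<dots> \<le> indicator (cbox 0 1) x"
      proof -
        have "(\<Union>i\<in>{1..m}. B i) \<subseteq> cbox 0 1" using s by blast
        then show ?thesis by (auto simp del: UN_iff split: split_indicator)
      qed
      finally show "(\<Sum>i=1..m. ?H x * indicator (B i) x) \<le> ?H x * indicator (cbox 0 1) x"
        unfolding sum_distrib_left[symmetric] by (intro mult_left_mono) auto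
    qed
    finally show ?thesis .
  qed
  have sep: "u i + \<delta> \<le> u l \<or> u l + \<delta> \<le> u i" if "i \<in> {1..m}" "l \<in> {1..m}" "i \<noteq> l" for i l
    using gap[of i l] that by (auto simp: abs_if split: if_splits)
  have dA: "disjoint_family_on ?A {1..m}" "disjoint_family_on ?A' {1..m}"
    unfolding disjoint_family_on_def using sep by (fastforce simp: mem_slab dest: spec[of _ j])+
  have sub: "?A i \<subseteq> cbox 0 1" "?A' i \<subseteq> cbox 0 1" if "i \<in> {1..m}" for i
    using range[OF that] \<delta> by (auto simp: mem_slab mem_box_cart split: if_splits intro: less_imp_le)
      (smt (verit))+
  have "ennreal (\<delta> * (\<Sum>i=1..m. (w i j)\<^sup>2)) = (\<Sum>i=1..m. ennreal (\<delta> * (w i j)\<^sup>2))"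
    unfolding sum_distrib_left using \<delta> by (intro sum_ennreal[symmetric]) auto
  also have "\<dots> \<le> (\<Sum>i=1..m. 2 * (\<integral>\<^sup>+x. ?H x * indicator (?A i) x \<partial>lborel)
    + 2 * (\<integral>\<^sup>+x. ?H x * indicator (?A' i) x \<partial>lborel))"
    by (intro sum_mono one) auto
  also have "\<dots> = 2 * (\<Sum>i=1..m. \<integral>\<^sup>+x. ?H x * indicator (?A i) x \<partial>lborel)
    + 2 * (\<Sum>i=1..m. \<integral>\<^sup>+x. ?H x * indicator (?A' i) x \<partial>lborel)"
    by (simp only: sum.distrib sum_distrib_left)
  also have "\<dots> \<le> 2 * ?I + 2 * ?I"
    using disj[OF dA(1) sub(1)] disj[OF dA(2) sub(2)] by (intro add_mono mult_left_mono) auto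
  also have "\<dots> = 4 * ?I" by (simp flip: distrib_right)
  finally show ?thesis .
qed

text \<open>The density bound passes from Lebesgue measure to \<open>P\<close>. Slabs in different
  directions overlap, so the column bounds are added rather than merged, which costs the factor
  \<open>CARD('d)\<close>.\<close>

lemma step_sum_variance_bound:
  fixes w :: "nat \<Rightarrow> 'd::finite \<Rightarrow> real" and f :: "real^'d \<Rightarrow> real"
  assumes \<delta>: "\<delta> > 0"
    and gap: "\<And>i l. i \<in> {1..m} \<Longrightarrow> l \<in> {1..m} \<Longrightarrow> l \<noteq> i \<Longrightarrow> \<bar>u l - u i\<bar> \<ge> \<delta>"
    and range: "\<And>i. i \<in> {1..m} \<Longrightarrow> \<delta> \<le> u i \<and> u i + \<delta> \<le> 1"
    and f: "f \<in> borel_measurable borel" "\<And>x. x \<in> cbox 0 1 \<Longrightarrow> c0 \<le> f x" "c0 > 0"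
    and P: "P = density Q0 (\<lambda>x. ennreal (f x))" "prob_space P"
  shows "\<delta> * c0 / (4 * CARD('d)) * (\<Sum>i=1..m. \<Sum>j\<in>UNIV. (w i j)\<^sup>2) \<le> (\<integral>x. (step_sum u m w x - c)\<^sup>2 \<partial>P)"
proof -
  interpret P: prob_space P by fact
  note [measurable] = f(1)
  have sP [measurable_cong]: "sets P = sets borel" by (simp add: P sets_Q0)
  let ?H = "\<lambda>x. (step_sum u m w x - c)\<^sup>2"
  let ?I = "\<integral>\<^sup>+x. ennreal (?H x) * indicator (cbox 0 1) x \<partial>lborel"
  have "ennreal c0 * ?I = (\<integral>\<^sup>+x. ennreal c0 * ennreal (?H x) * indicator (cbox 0 1) x \<partial>lborel)"
    by (subst nn_integral_cmult[symmetric]) (auto simp: mult.assoc)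
  also have "\<dots> \<le> (\<integral>\<^sup>+x. ennreal (f x) * ennreal (?H x) * indicator (cbox 0 1) x \<partial>lborel)"
    using f(2) by (intro nn_integral_mono) (auto split: split_indicator intro!: mult_right_mono ennreal_leI)
  also have "\<dots> = (\<integral>\<^sup>+x. ennreal (f x) * ennreal (?H x) \<partial>Q0)" by (rule nn_integral_Q0[symmetric]) measurable
  also have "\<dots> = (\<integral>\<^sup>+x. ennreal (?H x) \<partial>P)" unfolding P(1) by (rule nn_integral_density[symmetric]) measurable
  also have "\<dots> = ennreal (\<integral>x. ?H x \<partial>P)"
  proof (rule nn_integral_eq_integral)
    have "\<bar>step_sum u m w x\<bar> \<le> (\<Sum>i=1..m. \<Sum>j\<in>UNIV. \<bar>w i j\<bar>)" for x
      unfolding step_sum_def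
      by (intro order_trans[OF sum_abs] sum_mono order_trans[OF sum_abs]) (auto simp: half_ind_def)
    then have "\<bar>step_sum u m w x - c\<bar> \<le> (\<Sum>i=1..m. \<Sum>j\<in>UNIV. \<bar>w i j\<bar>) + \<bar>c\<bar>" for x
      by (rule order_trans[OF abs_triangle_ineq4 add_right_mono])
    then have "?H x \<le> ((\<Sum>i=1..m. \<Sum>j\<in>UNIV. \<bar>w i j\<bar>) + \<bar>c\<bar>)\<^sup>2" for x
      by (simp add: abs_le_square_iff[symmetric] order_trans[OF _ abs_ge_self])
    then show "integrable P ?H"
      by (intro P.integrable_const_bound[where B = "((\<Sum>i=1..m. \<Sum>j\<in>UNIV. \<bar>w i j\<bar>) + \<bar>c\<bar>)\<^sup>2"]) auto
  qed auto
  finally have I: "ennreal c0 * ?I \<le> ennreal (\<integral>x. ?H x \<partial>P)" .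
  have int0: "(\<integral>x. ?H x \<partial>P) \<ge> 0" by simp
  have col: "\<delta> * c0 * (\<Sum>i=1..m. (w i j)\<^sup>2) \<le> 4 * (\<integral>x. ?H x \<partial>P)" for j
  proof -
    have "ennreal c0 * ennreal (\<delta> * (\<Sum>i=1..m. (w i j)\<^sup>2)) \<le> ennreal c0 * (4 * ?I)"
      using step_sum_column_bound[OF \<delta> gap range, where c = c and j = j and w = w]
        by (intro mult_left_mono) auto
    also have "\<dots> = 4 * (ennreal c0 * ?I)" by (simp add: mult_ac)
    also have "\<dots> \<le> 4 * ennreal (\<integral>x. ?H x \<partial>P)" using I by (intro mult_left_mono) auto
    also have "\<dots> = ennreal (4 * (\<integral>x. ?H x \<partial>P))" using int0 by (simp add: ennreal_mult)
    finally have "ennreal (c0 * (\<delta> * (\<Sum>i=1..m. (w i j)\<^sup>2))) \<le> ennreal (4 * (\<integral>x. ?H x \<partial>P))"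
      using f(3) \<delta> by (simp add: ennreal_mult sum_nonneg)
    then show ?thesis using int0 by (subst (asm) ennreal_le_iff) (auto simp: mult_ac)
  qed
  have "\<delta> * c0 * (\<Sum>i=1..m. \<Sum>j\<in>UNIV. (w i j)\<^sup>2) = (\<Sum>j\<in>(UNIV::'d set). \<delta> * c0 * (\<Sum>i=1..m. (w i j)\<^sup>2))"
    by (subst sum.swap) (simp add: sum_distrib_left)
  also have "\<dots> \<le> (\<Sum>j\<in>(UNIV::'d set). 4 * (\<integral>x. ?H x \<partial>P))" by (intro sum_mono col)
  also have "\<dots> = 4 * CARD('d) * (\<integral>x. ?H x \<partial>P)" by simp
  finally show ?thesis by (simp add: field_simps)
qed

lemma integral_half_ind_Q0:
  assumes "0 < v" "v < 1" shows "(\<integral>x. half_ind v j x \<partial>(Q0 :: (real^'d) measure)) = v"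
proof -
  have "half_ind v j = indicator {x. x $ j \<le> v}" by (auto simp: half_ind_def fun_eq_iff split: split_indicator)
  then have "(\<integral>x. half_ind v j x \<partial>(Q0 :: (real^'d) measure)) = measure Q0 {x. x $ j \<le> v}"
    by (simp add: Q0_def)
  also have "\<dots> = measure lborel (cbox 0 1 \<inter> {x::real^'d. x $ j \<le> v})"
    unfolding Q0_def using emeasure_unit_cube[where 'd='d]
    by (subst measure_uniform_measure) (auto simp: measure_def simp del: emeasure_lborel_cbox
      measure_lborel_cbox)
  \<comment> \<open>The lower corner is written with a conditional to match
    \<open>content_cslab\<close> for \<open>p = 0\<close>.\<close>
  also have "cbox 0 1 \<inter> {x::real^'d. x $ j \<le> v}
    = cbox (\<chi> l. if l = j then 0 else 0) (\<chi> l. if l = j then v else 1)"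
    using assms by (auto simp: mem_box_cart split: if_splits) (metis order.trans less_imp_le)+
  also have "measure lborel \<dots> = v" using content_cslab[of 0 v j] assms by simp
  finally show ?thesis .
qed

text \<open>Each function of the class depends on one coordinate, so uniform marginals fix its mean;
  comparison with \<open>integral_half_ind_Q0\<close> shows that \<open>P\<close> and
  \<open>Q0\<close> agree on the class.\<close>

lemma integral_half_ind_Omega:
  fixes P :: "(real^'d) measure"
  assumes "P \<in> Omega" "0 < v" "v < 1" shows "(\<integral>x. half_ind v j x \<partial>P) = v"
proof -
  have sP [measurable_cong]: "sets P = sets borel"
    and d: "distr P borel (\<lambda>x. x $ j) = uniform_measure lborel {0..1}"
    using assms(1) by (auto simp: Omega_def)
  have "(\<integral>x. half_ind v j x \<partial>P) = (\<integral>x. indicator {..v} (x $ j) \<partial>P)"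
    by (intro Bochner_Integration.integral_cong refl) (auto simp: half_ind_def split: split_indicator)
  also have "\<dots> = (\<integral>t. indicator {..v} t \<partial>distr P borel (\<lambda>x. x $ j))"
    by (rule integral_distr[symmetric]) measurable
  also have "\<dots> = measure (uniform_measure lborel {0..1}) {..v}" unfolding d by simp
  also have "\<dots> = v"
  proof -
    have "{0..1} \<inter> {..v} = {0..v}" using assms by auto
    then show ?thesis using assms by (subst measure_uniform_measure) auto
  qed
  finally show ?thesis .
qed

section \<open>Orthonormal bases\<close>

text \<open>The expansions hold at every point, not almost everywhere, because the functions are
  later evaluated at sample points. Both coefficient arrays are produced so that the two spans
  coincide.\<close>

lemma (in prob_space) gram_schmidt:
  fixes \<psi> :: "nat \<Rightarrow> 'a \<Rightarrow> real"
  assumes b: "\<And>a. a < N \<Longrightarrow> bdd_meas M (\<psi> a)"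
    and pos: "\<And>v. (\<integral>y. (\<Sum>a<N. v a * \<psi> a y)\<^sup>2 \<partial>M) = 0 \<Longrightarrow> (\<forall>a<N. v a = 0)"
  shows "\<exists>e L R. (\<forall>a<N. \<forall>y. e a y = (\<Sum>b<N. L a b * \<psi> b y)) \<and> (\<forall>b<N. \<forall>y. \<psi> b y = (\<Sum>a<N. R b a * e a y))
    \<and> (\<forall>a<N. \<forall>b<N. (\<integral>y. e a y * e b y \<partial>M) = (if a = b then 1 else 0))"
  using assms
proof (induction N)
  case 0
  then show ?case by auto
next
  case (Suc N)
  have pos': "\<forall>a<N. v a = 0" if "(\<integral>y. (\<Sum>a<N. v a * \<psi> a y)\<^sup>2 \<partial>M) = 0" for v
  proof -
    have "(\<Sum>a<Suc N. (v(N := 0)) a * \<psi> a y) = (\<Sum>a<N. v a * \<psi> a y)" for y by simp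
    then have "\<forall>a<Suc N. (v(N := 0)) a = 0" using that by (intro Suc.prems(2)) simp
    then show ?thesis by (metis fun_upd_other less_Suc_eq nat_neq_iff)
  qed
  have b': "bdd_meas M (\<psi> a)" if "a < N" for a using Suc.prems(1) that by simp
  obtain e L R where IH: "\<forall>a<N. \<forall>y. e a y = (\<Sum>b<N. L a b * \<psi> b y)"
      "\<forall>b<N. \<forall>y. \<psi> b y = (\<Sum>a<N. R b a * e a y)"
      "\<forall>a<N. \<forall>b<N. (\<integral>y. e a y * e b y \<partial>M) = (if a = b then 1 else 0)"
    using Suc.IH[OF b' pos'] by blast
  have e: "e a y = (\<Sum>b<N. L a b * \<psi> b y)" if "a < N" for a y using IH(1) that by blast
  have r: "\<psi> b y = (\<Sum>a<N. R b a * e a y)" if "b < N" for b y using IH(2) that by blast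
  have orth: "(\<integral>y. e a y * e b y \<partial>M) = (if a = b then 1 else 0)" if "a < N" "b < N" for a b
    using IH(3) that by blast
  have be: "bdd_meas M (e a)" if "a < N" for a
  proof -
    have "e a = (\<lambda>y. \<Sum>b<N. L a b * \<psi> b y)" using e[OF that] by (rule ext)
    then show ?thesis using Suc.prems(1) by (simp only:) (intro bdd_meas_intros bdd_meas_const, simp)
  qed
  have b\<psi>: "bdd_meas M (\<psi> N)" using Suc.prems(1) by simp
  define c where "c a = (\<integral>y. \<psi> N y * e a y \<partial>M)" for a
  define w where "w y = \<psi> N y - (\<Sum>a<N. c a * e a y)" for y
  define l where "l b = (if b < N then - (\<Sum>a<N. c a * L a b) else 1)" for b
  have bw: "bdd_meas M w"
    unfolding w_def[abs_def] using b\<psi> be by (intro bdd_meas_intros) auto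
  have wl: "w y = (\<Sum>b<Suc N. l b * \<psi> b y)" for y
  proof -
    have "(\<Sum>a<N. c a * e a y) = (\<Sum>a<N. \<Sum>b<N. c a * L a b * \<psi> b y)"
      by (intro sum.cong refl) (simp add: e sum_distrib_left mult.assoc)
    also have "\<dots> = (\<Sum>b<N. (\<Sum>a<N. c a * L a b) * \<psi> b y)"
      by (subst sum.swap) (simp add: sum_distrib_right)
    finally show ?thesis unfolding w_def l_def by (simp add: sum_negf)
  qed
  have we: "(\<integral>y. w y * e b y \<partial>M) = 0" if "b < N" for b
  proof -
    have i: "integrable M (\<lambda>y. c a * (e a y * e b y))" if "a < N" for a
      using be[OF that] be[OF \<open>b < N\<close>] by (intro bdd_meas_integrable bdd_meas_intros)
    have "(\<integral>y. w y * e b y \<partial>M) = (\<integral>y. \<psi> N y * e b y - (\<Sum>a<N. c a * (e a y * e b y)) \<partial>M)"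
      by (intro Bochner_Integration.integral_cong refl)
        (simp add: w_def left_diff_distrib sum_distrib_right mult.assoc)
    also have "\<dots> = (\<integral>y. \<psi> N y * e b y \<partial>M) - (\<integral>y. (\<Sum>a<N. c a * (e a y * e b y)) \<partial>M)"
      using i b\<psi> be[OF that]
      by (intro Bochner_Integration.integral_diff Bochner_Integration.integrable_sum)
         (auto intro: bdd_meas_integrable bdd_meas_mult)
    also have "(\<integral>y. (\<Sum>a<N. c a * (e a y * e b y)) \<partial>M) = (\<Sum>a<N. \<integral>y. c a * (e a y * e b y) \<partial>M)"
      using i by (intro Bochner_Integration.integral_sum) auto
    also have "\<dots> = (\<Sum>a<N. if a = b then c a else 0)"
      by (intro sum.cong refl) (simp add: orth that)
    also have "\<dots> = c b" using that by simp
    finally show ?thesis by (simp add: c_def)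
  qed
  define s where "s = (\<integral>y. (w y)\<^sup>2 \<partial>M)"
  \<comment> \<open>The residual \<open>w\<close> has coefficient \<open>l N = 1\<close> at the new
    function, so it cannot have zero norm.\<close>
  have "s \<noteq> 0"
  proof
    assume "s = 0"
    then have "\<forall>a<Suc N. l a = 0" unfolding s_def wl by (rule Suc.prems(2))
    then show False by (auto simp: l_def)
  qed
  moreover have "s \<ge> 0" by (simp add: s_def)
  ultimately have s: "s > 0" by simp
  define q where "q = sqrt s"
  have q: "q > 0" "q * q = s" using s by (auto simp: q_def)
  define e' where "e' a = (if a < N then e a else (\<lambda>y. w y / q))" for a
  define L' where "L' a b = (if a < N then (if b < N then L a b else 0) else l b / q)" for a b
  define R' where "R' b a = (if b < N then if a < N then R b a else 0 else if a < N then c a else q)" for b a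
  have ew: "(\<integral>y. e b y * (w y / q) \<partial>M) = 0" "(\<integral>y. w y / q * e b y \<partial>M) = 0" if "b < N" for b
    using we[OF that] by (simp_all add: mult.commute)
  have ww: "(\<integral>y. w y / q * (w y / q) \<partial>M) = 1"
    using q s by (simp add: s_def power2_eq_square)
  have "\<forall>a<Suc N. \<forall>y. e' a y = (\<Sum>b<Suc N. L' a b * \<psi> b y)"
  proof (intro allI impI)
    fix a y assume "a < Suc N"
    then consider "a < N" | "a = N" by linarith
    then show "e' a y = (\<Sum>b<Suc N. L' a b * \<psi> b y)"
    proof cases
      case 1 then show ?thesis by (simp add: e'_def L'_def e)
    next
      case 2
      have "w y / q = (\<Sum>b<Suc N. l b / q * \<psi> b y)" unfolding wl sum_divide_distrib by simp
      then show ?thesis using 2 by (simp add: e'_def L'_def)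
    qed
  qed
  moreover have "\<forall>b<Suc N. \<forall>y. \<psi> b y = (\<Sum>a<Suc N. R' b a * e' a y)"
  proof (intro allI impI)
    fix b y assume "b < Suc N"
    then consider "b < N" | "b = N" by linarith
    then show "\<psi> b y = (\<Sum>a<Suc N. R' b a * e' a y)"
    proof cases
      case 1 then show ?thesis using r[OF 1, of y] by (simp add: e'_def R'_def)
    next
      case 2 then show ?thesis using q by (simp add: e'_def R'_def w_def)
    qed
  qed
  moreover have "\<forall>a<Suc N. \<forall>b<Suc N. (\<integral>y. e' a y * e' b y \<partial>M) = (if a = b then 1 else 0)"
  proof (intro allI impI)
    fix a b assume "a < Suc N" "b < Suc N"
    then consider "a < N" "b < N" | "a < N" "b = N" | "a = N" "b < N" | "a = N" "b = N" by linarith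
    then show "(\<integral>y. e' a y * e' b y \<partial>M) = (if a = b then 1 else 0)"
      by cases (auto simp: e'_def orth ew ww simp del: times_divide_eq_left times_divide_eq_right)
  qed
  ultimately show ?case by blast
qed

section \<open>Statistics of indicator data\<close>

lemma emp_cong: "(\<And>i. i \<in> {1..n} \<Longrightarrow> f (x i) = g (x' i)) \<Longrightarrow> emp n x f = emp n x' g"
  unfolding emp_def by (intro arg_cong2[where f="(/)"] sum.cong) auto

lemma from_nat_into_in: "finite F \<Longrightarrow> a < card F \<Longrightarrow> from_nat_into F a \<in> F"
  using bij_betw_from_nat_into_finite[of F] by (auto simp: bij_betw_def)

text \<open>Every function in the span is determined at the sample points by the values of
  \<open>F\<close> there. This is what makes the supremum over an infinite family measurable later
  on.\<close>

lemma chi_sq_cong: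
  fixes F :: "(real^'d \<Rightarrow> real) set"
  assumes "finite F" and eq: "\<And>i f. i \<in> {1..n} \<Longrightarrow> f \<in> F \<Longrightarrow> f (x i) = f (x' i)"
  shows "chi_sq n x F = chi_sq n x' F"
  unfolding chi_sq_def
proof (rule SUP_cong[OF refl])
  fix f assume "f \<in> fun_space.span (F \<union> {\<lambda>_. 1})"
  then obtain c v where f: "f = (\<lambda>y. c + lincomb (card F) (from_nat_into F) v y)"
    unfolding span_eq_affine[OF assms(1)] by blast
  have "f (x i) = f (x' i)" if "i \<in> {1..n}" for i
    unfolding f lincomb_def using eq[OF that from_nat_into_in[OF assms(1)]]
    by (intro arg_cong2[where f="(+)"] refl sum.cong) auto
  then have "emp n x f = emp n x' f" "emp n x (\<lambda>y. (f y)\<^sup>2) = emp n x' (\<lambda>y. (f y)\<^sup>2)"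
    by (auto intro!: emp_cong)
  then show "ereal ((\<integral>y. f y \<partial>Q0) - emp n x f - 1/4 * emp n x (\<lambda>y. (f y)\<^sup>2))
      = ereal ((\<integral>y. f y \<partial>Q0) - emp n x' f - 1/4 * emp n x' (\<lambda>y. (f y)\<^sup>2))" by simp
qed

lemma emp_cov_cong:
  assumes "finite F" and eq: "\<And>i f. i \<in> {1..n} \<Longrightarrow> f \<in> F \<Longrightarrow> f (x i) = f (x' i)"
  shows "emp_cov n x F = emp_cov n x' F"
proof -
  have p: "from_nat_into F a (x i) = from_nat_into F a (x' i)" if "a < card F" "i \<in> {1..n}" for a i
    using eq[OF that(2) from_nat_into_in[OF assms(1) that(1)]] .
  have "emp n x (from_nat_into F a) = emp n x' (from_nat_into F a)"
    "emp n x (\<lambda>y. from_nat_into F a y * from_nat_into F b y)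
      = emp n x' (\<lambda>y. from_nat_into F a y * from_nat_into F b y)"
    if "a < card F" "b < card F" for a b
    using that by (auto intro!: emp_cong simp: p)
  then show ?thesis unfolding emp_cov_def by (intro eq_matI) auto
qed

lemma gamma_vec_cong:
  assumes "finite F" and eq: "\<And>i f. i \<in> {1..n} \<Longrightarrow> f \<in> F \<Longrightarrow> f (x i) = f (x' i)"
  shows "gamma_vec P n x F = gamma_vec P n x' F"
proof -
  have "emp n x (from_nat_into F a) = emp n x' (from_nat_into F a)" if "a < card F" for a
    using eq from_nat_into_in[OF assms(1) that] by (auto intro!: emp_cong)
  then show ?thesis unfolding gamma_vec_def by (intro eq_vecI) auto
qed

text \<open>A statistic that only sees the indicators \<open>f (X i)\<close> takes finitely many values.\<close>

lemma finite_data_measurable: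
  fixes F :: "('b::topological_space \<Rightarrow> real) set" and X :: "nat \<Rightarrow> 'w \<Rightarrow> 'b"
  assumes F: "finite F" "\<And>f. f \<in> F \<Longrightarrow> f \<in> borel_measurable borel" "\<And>f y. f \<in> F \<Longrightarrow> f y \<in> {0, 1}"
    and X: "\<And>i. i \<in> {1..n} \<Longrightarrow> X i \<in> measurable M borel"
    and g: "\<And>\<omega> \<omega>'. (\<And>i f. i \<in> {1..n} \<Longrightarrow> f \<in> F \<Longrightarrow> f (X i \<omega>) = f (X i \<omega>')) \<Longrightarrow> g \<omega> = g \<omega>'"
  shows "{\<omega> \<in> space M. g \<omega> \<in> A} \<in> sets M"
proof -
  define K where "K = {1..n} \<times> F"
  \<comment> \<open>\<open>D\<close> records which indicators equal 1 at which observation; it has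
    finitely many possible values and determines \<open>g\<close>.\<close>
  define D where "D \<omega> = {p \<in> K. snd p (X (fst p) \<omega>) = 1}" for \<omega>
  have gD: "g \<omega> = g \<omega>'" if "D \<omega> = D \<omega>'" for \<omega> \<omega>'
  proof (rule g)
    fix i f assume h: "i \<in> {1..n}" "f \<in> F"
    then have "(i, f) \<in> D \<omega> \<longleftrightarrow> f (X i \<omega>) = 1" "(i, f) \<in> D \<omega>' \<longleftrightarrow> f (X i \<omega>') = 1"
      by (simp_all add: D_def K_def)
    then have "f (X i \<omega>) = 1 \<longleftrightarrow> f (X i \<omega>') = 1" using that by simp
    then show "f (X i \<omega>) = f (X i \<omega>')" using F(3)[OF h(2)] by (metis insertE singletonD)
  qed
  have K: "finite K" using F(1) by (simp add: K_def)
  have meas: "{\<omega> \<in> space M. D \<omega> = E} \<in> sets M" if "E \<subseteq> K" for E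
  proof -
    have "D \<omega> = E \<longleftrightarrow> (\<forall>p\<in>K. (snd p (X (fst p) \<omega>) = 1) = (p \<in> E))" for \<omega>
      using that unfolding D_def by blast
    moreover have "{\<omega> \<in> space M. (snd p (X (fst p) \<omega>) = 1) = (p \<in> E)} \<in> sets M" if "p \<in> K" for p
    proof -
      have p: "fst p \<in> {1..n}" "snd p \<in> F" using that by (auto simp: K_def)
      have [measurable]: "(\<lambda>\<omega>. snd p (X (fst p) \<omega>)) \<in> borel_measurable M"
        using X[OF p(1)] F(2)[OF p(2)] by (rule measurable_compose)
      show ?thesis by measurable
    qed
    ultimately show ?thesis using K by (simp only:) (rule sets.sets_Collect_finite_All)
  qed
  \<comment> \<open>The witness may lie outside \<open>space M\<close>; this is harmless because
    \<open>g\<close> depends on the pattern \<open>D\<close> alone.\<close>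
  let ?S = "{E \<in> Pow K. \<exists>\<omega>. D \<omega> = E \<and> g \<omega> \<in> A}"
  have "{\<omega> \<in> space M. g \<omega> \<in> A} = (\<Union>E\<in>?S. {\<omega> \<in> space M. D \<omega> = E})"
  proof (intro antisym subsetI)
    fix \<omega> assume h: "\<omega> \<in> {\<omega> \<in> space M. g \<omega> \<in> A}"
    have "D \<omega> \<in> ?S" using h by (auto simp: D_def)
    then show "\<omega> \<in> (\<Union>E\<in>?S. {\<omega> \<in> space M. D \<omega> = E})" using h by blast
  next
    fix \<omega> assume "\<omega> \<in> (\<Union>E\<in>?S. {\<omega> \<in> space M. D \<omega> = E})"
    then obtain \<omega>' where "\<omega> \<in> space M" "D \<omega>' = D \<omega>" "g \<omega>' \<in> A" by blast
    then show "\<omega> \<in> {\<omega> \<in> space M. g \<omega> \<in> A}" using gD[of \<omega>' \<omega>] by simp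
  qed
  also have "\<dots> \<in> sets M" using K meas by (intro sets.finite_UN) auto
  finally show ?thesis .
qed

section \<open>The class of indicators on a grid\<close>

lemma half_ind_inj:
  fixes j j' :: "'d::finite"
  assumes "0 < v" "v < 1" "0 < v'" "v' < 1" and eq: "half_ind v j = (half_ind v' j' :: real^'d \<Rightarrow> real)"
  shows "v = v' \<and> j = j'"
proof -
  \<comment> \<open>Test points with every coordinate 1 except one: a threshold below 1 rejects them
    unless it acts on the exceptional coordinate, and there the value compares the two
    thresholds.\<close>
  have *: "half_ind p i (\<chi> l. if l = i' then q else 1) = (if i = i' \<and> q \<le> p then 1 else 0)" if "p < 1" for p q
    and i i' :: 'd
    using that by (auto simp: half_ind_def)
  have "half_ind v' j' (\<chi> l. if l = j then v else 1) = 1" 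
    using fun_cong[OF eq, of "\<chi> l. if l = j then v else 1"] assms(1-4) by (simp add: *)
  moreover have "half_ind v j (\<chi> l. if l = j' then v' else 1) = 1" 
    using fun_cong[OF eq, of "\<chi> l. if l = j' then v' else 1"] assms(1-4) by (simp add: *)
  ultimately show ?thesis using assms(1-4) by (auto simp: * split: if_splits)
qed

lemma ind_class_bij:
  fixes g :: "nat \<Rightarrow> real"
  assumes "strict_mono_on {1..m} g" "\<And>i. i \<in> {1..m} \<Longrightarrow> 0 < g i \<and> g i < 1"
  shows "bij_betw (\<lambda>(i, j). half_ind (g i) j) ({1..m} \<times> (UNIV :: 'd::finite set)) (ind_class g m)"
  unfolding bij_betw_def
proof
  show "inj_on (\<lambda>(i, j). half_ind (g i) (j::'d)) ({1..m} \<times> UNIV)"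
  proof (rule inj_onI, clarify)
    fix i j i' and j' :: 'd
    assume h: "i \<in> {1..m}" "i' \<in> {1..m}" "half_ind (g i) j = half_ind (g i') j'"
    then have "g i = g i'" "j = j'" using half_ind_inj[OF _ _ _ _ h(3)] assms(2) by auto
    then show "i = i' \<and> j = j'" using strict_mono_on_imp_inj_on[OF assms(1)] h by (auto dest: inj_onD)
  qed
qed (auto simp: ind_class_def)

lemma ind_class_finite: "finite (ind_class g m :: (real^'d \<Rightarrow> real) set)"
proof -
  have "ind_class g m = (\<lambda>(i, j::'d). half_ind (g i) j) ` ({1..m} \<times> UNIV)" by (auto simp: ind_class_def)
  then show ?thesis by simp
qed

text \<open>The enumeration of the class is arbitrary, so coefficients are carried from it to pairs
  (grid point, direction) through its inverse; distinctness of the indicators keeps the sum of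
  squares unchanged.\<close>

lemma ind_class_variance_bound:
  fixes P :: "(real^'d) measure" and f :: "real^'d \<Rightarrow> real"
  assumes grid: "strict_mono_on {1..m} g" "\<And>i. i \<in> {1..m} \<Longrightarrow> 0 < g i \<and> g i < 1"
    and \<delta>: "\<delta> > 0"
    and gap: "\<And>i l. i \<in> {1..m} \<Longrightarrow> l \<in> {1..m} \<Longrightarrow> l \<noteq> i \<Longrightarrow> \<bar>g l - g i\<bar> \<ge> \<delta>"
    and range: "\<And>i. i \<in> {1..m} \<Longrightarrow> \<delta> \<le> g i \<and> g i + \<delta> \<le> 1"
    and f: "f \<in> borel_measurable borel" "\<And>x. x \<in> cbox 0 1 \<Longrightarrow> c0 \<le> f x" "c0 > 0"
    and P: "P = density Q0 (\<lambda>x. ennreal (f x))" "prob_space P"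
  defines "F \<equiv> ind_class g m :: (real^'d \<Rightarrow> real) set"
  shows "\<delta> * c0 / (4 * CARD('d)) * (\<Sum>a<card F. (v a)\<^sup>2)
    \<le> (\<integral>x. (lincomb (card F) (from_nat_into F) v x - c)\<^sup>2 \<partial>P)"
proof -
  have fin: "finite F" unfolding F_def by (rule ind_class_finite)
  have b1: "bij_betw (from_nat_into F) {..<card F} F" by (rule bij_betw_from_nat_into_finite[OF fin])
  define h where "h = (\<lambda>(i, j::'d). half_ind (g i) j)"
  have b2: "bij_betw h ({1..m} \<times> UNIV) F"
    unfolding h_def F_def by (rule ind_class_bij[OF grid])
  define idx where "idx = inv_into {..<card F} (from_nat_into F)"
  define w where "w i j = v (idx (half_ind (g i) j))" for i j
  have idx: "idx (from_nat_into F a) = a" if "a < card F" for a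
    unfolding idx_def using b1 that by (simp add: bij_betw_def)
  have sum_eq: "(\<Sum>a<card F. S (v a) (from_nat_into F a)) = (\<Sum>i=1..m. \<Sum>j\<in>UNIV. S (w i j) (half_ind (g i) j))"
    for S :: "real \<Rightarrow> (real^'d \<Rightarrow> real) \<Rightarrow> real"
  proof -
    have "(\<Sum>a<card F. S (v a) (from_nat_into F a))
      = (\<Sum>a<card F. S (v (idx (from_nat_into F a))) (from_nat_into F a))"
      by (intro sum.cong refl) (simp add: idx)
    also have "\<dots> = (\<Sum>f\<in>F. S (v (idx f)) f)" by (rule sum.reindex_bij_betw[OF b1])
    also have "\<dots> = (\<Sum>p\<in>{1..m} \<times> UNIV. S (v (idx (h p))) (h p))" by (rule sum.reindex_bij_betw[OF b2, symmetric])
    finally show ?thesis unfolding sum.cartesian_product by (simp add: h_def w_def case_prod_beta)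
  qed
  have 1: "lincomb (card F) (from_nat_into F) v x = step_sum g m w x" for x
    unfolding lincomb_def step_sum_def using sum_eq[of "\<lambda>r f. r * f x"] by simp
  have 2: "(\<Sum>a<card F. (v a)\<^sup>2) = (\<Sum>i=1..m. \<Sum>j\<in>UNIV. (w i j)\<^sup>2)"
    using sum_eq[of "\<lambda>r f. r\<^sup>2"] by simp
  show ?thesis unfolding 1 2 by (rule step_sum_variance_bound[OF \<delta> gap range f P])
qed

lemma lincomb_compose:
  assumes "\<And>b y. b < N \<Longrightarrow> \<psi> b y = (\<Sum>a<N. R b a * e a y)"
  shows "(\<Sum>b<N. v b * \<psi> b y) = lincomb N e (\<lambda>a. \<Sum>b<N. v b * R b a) y"
proof -
  have "(\<Sum>b<N. v b * \<psi> b y) = (\<Sum>b<N. \<Sum>a<N. v b * R b a * e a y)"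
    by (intro sum.cong refl) (simp add: assms sum_distrib_left mult.assoc)
  then show ?thesis unfolding lincomb_def by (subst (asm) sum.swap) (simp add: sum_distrib_right)
qed

text \<open>Gram-Schmidt is applied to the centred functions. The pointwise bound
  \<open>N / \<kappa>\<close> comes from the reproducing kernel: a lower bound on variances bounds
  coefficients by the \<open>L\<^sup>2\<close> norm, and the centred functions are at most 1 in
  absolute value.\<close>

lemma (in prob_space) exists_orthonormal_system:
  fixes \<phi> :: "nat \<Rightarrow> 'a \<Rightarrow> real"
  assumes N: "N \<ge> 1" and \<kappa>: "\<kappa> > 0"
    and \<phi>: "\<And>a. a < N \<Longrightarrow> \<phi> a \<in> borel_measurable M" "\<And>a y. a < N \<Longrightarrow> 0 \<le> \<phi> a y \<and> \<phi> a y \<le> 1"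
    and var: "\<And>v c. \<kappa> * (\<Sum>a<N. (v a)\<^sup>2) \<le> (\<integral>y. (lincomb N \<phi> v y - c)\<^sup>2 \<partial>M)"
  obtains e where "orthonormal_system M e N (N / \<kappa>)"
    and "affine_span N \<phi> = affine_span N e"
proof -
  have b\<phi>: "bdd_meas M (\<phi> a)" if "a < N" for a
    using \<phi>[OF that] by (intro bdd_measI[where C = 1]) auto
  define \<mu> where "\<mu> a = (\<integral>y. \<phi> a y \<partial>M)" for a
  define \<psi> where "\<psi> a y = \<phi> a y - \<mu> a" for a y
  have \<mu>: "0 \<le> \<mu> a \<and> \<mu> a \<le> 1" if "a < N" for a
  proof -
    have "(\<integral>y. \<phi> a y \<partial>M) \<le> (\<integral>y. 1 \<partial>M)"
      using \<phi>(2)[OF that] by (intro integral_mono bdd_meas_integrable b\<phi> that bdd_meas_const) auto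
    moreover have "0 \<le> (\<integral>y. \<phi> a y \<partial>M)" using \<phi>(2)[OF that] by simp
    ultimately show ?thesis by (simp add: \<mu>_def prob_space)
  qed
  have b\<psi>: "bdd_meas M (\<psi> a)" if "a < N" for a
    unfolding \<psi>_def[abs_def] by (intro bdd_meas_intros b\<phi> that)
  have \<psi>0: "(\<integral>y. \<psi> a y \<partial>M) = 0" if "a < N" for a
    using bdd_meas_integrable[OF b\<phi>[OF that]] by (simp add: \<psi>_def \<mu>_def prob_space)
  have \<psi>1: "(\<psi> a y)\<^sup>2 \<le> 1" if "a < N" for a y
  proof -
    have "\<bar>\<psi> a y\<bar> \<le> 1" using \<mu>[OF that] \<phi>(2)[OF that, of y] by (auto simp: \<psi>_def abs_le_iff)
    then show ?thesis by (simp add: abs_square_le_1)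
  qed
  have sum\<psi>: "(\<Sum>a<N. v a * \<psi> a y) = lincomb N \<phi> v y - (\<Sum>a<N. v a * \<mu> a)" for v y
    by (simp add: \<psi>_def lincomb_def right_diff_distrib sum_subtractf)
  have var\<psi>: "\<kappa> * (\<Sum>a<N. (v a)\<^sup>2) \<le> (\<integral>y. (\<Sum>a<N. v a * \<psi> a y)\<^sup>2 \<partial>M)" for v
    unfolding sum\<psi> by (rule var)
  have pos: "\<forall>a<N. v a = 0" if "(\<integral>y. (\<Sum>a<N. v a * \<psi> a y)\<^sup>2 \<partial>M) = 0" for v
  proof -
    have "\<kappa> * (\<Sum>a<N. (v a)\<^sup>2) \<le> 0" using var\<psi>[of v] that by simp
    then show ?thesis by (rule sum_squares_nonposD[OF \<kappa>])
  qed
  obtain e L R where e: "\<And>a y. a < N \<Longrightarrow> e a y = (\<Sum>b<N. L a b * \<psi> b y)"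
      and r: "\<And>b y. b < N \<Longrightarrow> \<psi> b y = (\<Sum>a<N. R b a * e a y)"
      and orth: "\<And>a b. a < N \<Longrightarrow> b < N \<Longrightarrow> (\<integral>y. e a y * e b y \<partial>M) = (if a = b then 1 else 0)"
  proof -
    obtain e L R where "\<forall>a<N. \<forall>y. e a y = (\<Sum>b<N. L a b * \<psi> b y)" "\<forall>b<N. \<forall>y. \<psi> b y = (\<Sum>a<N. R b a * e a y)"
      "\<forall>a<N. \<forall>b<N. (\<integral>y. e a y * e b y \<partial>M) = (if a = b then 1 else 0)"
      using gram_schmidt[where \<psi> = \<psi> and N = N, OF b\<psi> pos] by blast
    then show thesis by (intro that[of e L R]) blast+
  qed
  have be: "bdd_meas M (e a)" if "a < N" for a
  proof -
    have "e a = (\<lambda>y. \<Sum>b<N. L a b * \<psi> b y)" using e[OF that] by (rule ext)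
    then show ?thesis using b\<psi> by (simp only:) (intro bdd_meas_intros bdd_meas_const, simp)
  qed
  have "orthonormal_system M e N (N / \<kappa>)"
  proof
    show "1 \<le> N" by (rule N)
    show "e a \<in> borel_measurable M" if "a < N" for a using be[OF that] by (rule bdd_meas_measurable)
    show "(\<integral>y. e a y \<partial>M) = 0" if "a < N" for a
    proof -
      have "(\<integral>y. e a y \<partial>M) = (\<Sum>b<N. \<integral>y. L a b * \<psi> b y \<partial>M)"
        unfolding e[OF that] using bdd_meas_integrable[OF b\<psi>]
        by (intro Bochner_Integration.integral_sum integrable_mult_right) auto
      then show ?thesis by (simp add: \<psi>0)
    qed
    show "(\<integral>y. e a y * e b y \<partial>M) = (if a = b then 1 else 0)" if "a < N" "b < N" for a b
      using that by (rule orth)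
    fix y
    \<comment> \<open>\<open>K\<close> is the kernel at \<open>(y, y)\<close>, and also the squared
      norm of the kernel section at \<open>y\<close>, whose coefficients in the
      \<open>\<psi> b\<close> are \<open>l\<close>. Thus \<open>\<kappa>\<close> times the squared
      length of \<open>l\<close> is at most \<open>K\<close>; evaluating the section at
      \<open>y\<close> by Cauchy-Schwarz gives
      \<open>K\<^sup>2 \<le> (K / \<kappa>) * N\<close>.\<close>
    define K where "K = (\<Sum>a<N. (e a y)\<^sup>2)"
    define l where "l b = (\<Sum>a<N. e a y * L a b)" for b
    have l: "(\<Sum>a<N. e a y * e a z) = (\<Sum>b<N. l b * \<psi> b z)" for z
      using lincomb_compose[of N e L \<psi> "\<lambda>a. e a y" z] e by (simp add: lincomb_def l_def)
    have "\<kappa> * (\<Sum>b<N. (l b)\<^sup>2) \<le> (\<integral>z. (lincomb N e (\<lambda>a. e a y) z)\<^sup>2 \<partial>M)"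
      using var\<psi>[of l] unfolding l[symmetric] lincomb_def .
    also have "\<dots> = K"
      unfolding K_def lincomb_def using be
        by (intro integral_orthonormal_sq orth bdd_meas_integrable bdd_meas_mult)
    finally have ll: "(\<Sum>b<N. (l b)\<^sup>2) \<le> K / \<kappa>" using \<kappa> by (simp add: pos_le_divide_eq mult.commute)
    have "K\<^sup>2 = (\<Sum>b<N. l b * \<psi> b y)\<^sup>2" unfolding K_def using l[of y] by (simp add: power2_eq_square)
    also have "\<dots> \<le> (\<Sum>b<N. (l b)\<^sup>2) * (\<Sum>b<N. (\<psi> b y)\<^sup>2)" by (rule Cauchy_Schwarz_ineq_sum)
    also have "\<dots> \<le> (K / \<kappa>) * N"
    proof (rule mult_mono[OF ll])
      show "(\<Sum>b<N. (\<psi> b y)\<^sup>2) \<le> N" using sum_bounded_above[of "{..<N}" "\<lambda>b. (\<psi> b y)\<^sup>2" 1] \<psi>1 by simp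
      show "0 \<le> K / \<kappa>" using \<kappa> by (simp add: K_def sum_nonneg)
    qed (simp add: sum_nonneg)
    finally have "K * K \<le> K * (N / \<kappa>)" by (simp add: power2_eq_square)
    moreover have "K \<ge> 0" by (simp add: K_def sum_nonneg)
    ultimately show "K \<le> N / \<kappa>"
      using \<kappa> mult_left_le_imp_le[of K K "N / \<kappa>"] by (cases "K = 0") auto
  qed
  moreover have "affine_span N \<phi> = affine_span N e"
  proof (intro antisym subsetI)
    fix f assume "f \<in> affine_span N \<phi>"
    then obtain c v where f: "f = (\<lambda>y. c + lincomb N \<phi> v y)" by blast
    have "lincomb N \<phi> v y = (\<Sum>a<N. v a * \<mu> a) + lincomb N e (\<lambda>a. \<Sum>b<N. v b * R b a) y" for y
      using lincomb_compose[where N = N and \<psi> = \<psi> and R = R and e = e, OF r, of v y] sum\<psi>[of v y] by simp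
    then have "f = (\<lambda>y. (c + (\<Sum>a<N. v a * \<mu> a)) + lincomb N e (\<lambda>a. \<Sum>b<N. v b * R b a) y)"
      unfolding f by (simp add: add.assoc)
    then show "f \<in> affine_span N e" by blast
  next
    fix f assume "f \<in> affine_span N e"
    then obtain c v where f: "f = (\<lambda>y. c + lincomb N e v y)" by blast
    have "lincomb N e v y = lincomb N \<phi> (\<lambda>b. \<Sum>a<N. v a * L a b) y - (\<Sum>b<N. (\<Sum>a<N. v a * L a b) * \<mu> b)" for y
      using lincomb_compose[where N = N and \<psi> = e and R = L
        and e = \<psi>, OF e, of v y] sum\<psi>[of "\<lambda>b. \<Sum>a<N. v a * L a b" y] by (simp add: lincomb_def)
    then have "f = (\<lambda>y. (c - (\<Sum>b<N. (\<Sum>a<N. v a * L a b) * \<mu> b)) + lincomb N \<phi> (\<lambda>b. \<Sum>a<N. v a * L a b) y)"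
      unfolding f by (auto simp: fun_eq_iff)
    then show "f \<in> affine_span N \<phi>" by blast
  qed
  ultimately show thesis by (rule that)
qed

text \<open>The covariance is the second-moment matrix minus a rank-one term. The first differs from
  the identity by at most the Frobenius norm of \<open>gram_err\<close>, the second is at most the
  square norm of \<open>wvec\<close> divided by \<open>n\<close>; a good sample controls
  both.\<close>

lemma (in orthonormal_system) ecov_near_identity:
  fixes v :: "nat \<Rightarrow> real"
  assumes n: "n \<ge> 1" and good: "good_sample n {1..n} x"
  shows "\<bar>quad_form k (ecov n x e) v - nsq v\<bar> \<le> (sqrt B * k / sqrt n + (real k)\<^sup>2 / n) * nsq v"
proof -
  have W: "nsq (wvec n {1..n} x) < (real k)\<^sup>2"
    and H: "(\<Sum>a<k. \<Sum>b<k. (gram_err n {1..n} x a b)\<^sup>2) < B * (real k)\<^sup>2 / n"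
    using good by (auto simp: good_sample_def)
  have B: "B \<ge> 0" using k_le_B by linarith
  let ?H = "gram_err n {1..n} x"
  have em: "emp n x (e a) = wvec n {1..n} x a / sqrt n" for a
    using n by (simp add: emp_def wvec_def)
  have eH: "emp n x (\<lambda>y. e a y * e b y) = ?H a b + (if a = b then 1 else 0)" for a b
    by (simp add: emp_def gram_err_def)
  have "quad_form k (ecov n x e) v = quad_form k (\<lambda>a b. emp n x (\<lambda>y. e a y * e b y)) v
    - (emp n x (lincomb k e v))\<^sup>2"
    unfolding quad_form_ecov emp_lincomb_sq ..
  also have "quad_form k (\<lambda>a b. emp n x (\<lambda>y. e a y * e b y)) v = quad_form k ?H v + nsq v"
  proof -
    have "quad_form k (\<lambda>a b. emp n x (\<lambda>y. e a y * e b y)) v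
        = (\<Sum>a<k. \<Sum>b<k. v a * v b * ?H a b + (if a = b then v a * v b else 0))"
      unfolding quad_form_def eH by (intro sum.cong refl) (simp add: distrib_left)
    then show ?thesis by (simp add: sum.distrib quad_form_def nsq_def power2_eq_square)
  qed
  finally have q: "quad_form k (ecov n x e) v - nsq v = quad_form k ?H v - (emp n x (lincomb k e v))\<^sup>2" by simp
  have "(quad_form k ?H v)\<^sup>2 \<le> (nsq v)\<^sup>2 * (B * (real k)\<^sup>2 / n)"
  proof -
    have "(quad_form k ?H v)\<^sup>2 = (\<Sum>p\<in>{..<k} \<times> {..<k}. (v (fst p) * v (snd p)) * ?H (fst p) (snd p))\<^sup>2"
      unfolding quad_form_def sum.cartesian_product by (simp add: case_prod_beta)
    also have "\<dots> \<le> (\<Sum>p\<in>{..<k} \<times> {..<k}. (v (fst p) * v (snd p))\<^sup>2)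
      * (\<Sum>p\<in>{..<k} \<times> {..<k}. (?H (fst p) (snd p))\<^sup>2)"
      by (rule Cauchy_Schwarz_ineq_sum)
    also have "(\<Sum>p\<in>{..<k} \<times> {..<k}. (v (fst p) * v (snd p))\<^sup>2) = (nsq v)\<^sup>2"
      unfolding nsq_def power2_eq_square[of "sum _ _"] sum_product sum.cartesian_product
      by (simp add: case_prod_beta power_mult_distrib)
    also have "(\<Sum>p\<in>{..<k} \<times> {..<k}. (?H (fst p) (snd p))\<^sup>2) = (\<Sum>a<k. \<Sum>b<k. (?H a b)\<^sup>2)"
      unfolding sum.cartesian_product by (simp add: case_prod_beta)
    also have "(nsq v)\<^sup>2 * (\<Sum>a<k. \<Sum>b<k. (?H a b)\<^sup>2) \<le> (nsq v)\<^sup>2 * (B * (real k)\<^sup>2 / n)"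
      using H by (intro mult_left_mono) auto
    finally show ?thesis .
  qed
  then have "sqrt ((quad_form k ?H v)\<^sup>2) \<le> sqrt ((nsq v)\<^sup>2 * (B * (real k)\<^sup>2 / n))" by (rule real_sqrt_le_mono)
  then have 1: "\<bar>quad_form k ?H v\<bar> \<le> (sqrt B * k / sqrt n) * nsq v"
    using B nsq_nonneg[of v] by (simp add: real_sqrt_mult real_sqrt_divide mult_ac)
  have "(emp n x (lincomb k e v))\<^sup>2 = (\<Sum>a<k. v a * wvec n {1..n} x a)\<^sup>2 / n"
    unfolding emp_lincomb em by (simp add: power_divide flip: sum_divide_distrib)
  also have "\<dots> \<le> (nsq v * nsq (wvec n {1..n} x)) / n"
    unfolding nsq_def by (intro divide_right_mono Cauchy_Schwarz_ineq_sum) simp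
  also have "\<dots> \<le> (nsq v * (real k)\<^sup>2) / n"
    using W nsq_nonneg[of v] by (intro divide_right_mono mult_left_mono) auto
  finally have 2: "(emp n x (lincomb k e v))\<^sup>2 \<le> (real k)\<^sup>2 / n * nsq v" by (simp add: mult_ac)
  have "\<bar>quad_form k (ecov n x e) v - nsq v\<bar> \<le> \<bar>quad_form k ?H v\<bar> + (emp n x (lincomb k e v))\<^sup>2"
    unfolding q using abs_triangle_ineq4[of "quad_form k ?H v" "(emp n x (lincomb k e v))\<^sup>2"] by simp
  then show ?thesis using 1 2 by (simp add: distrib_right)
qed

text \<open>Both sides are the empirical variance of one function, which ignores the additive
  constant.\<close>

lemma quad_form_ecov_affine:
  assumes "n \<ge> 1" and eq: "\<And>y. lincomb N \<phi> v y = c + lincomb N' e b y"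
  shows "quad_form N (ecov n x \<phi>) v = quad_form N' (ecov n x e) b"
proof -
  have m: "emp n x (lincomb N \<phi> v) = c + emp n x (lincomb N' e b)"
    using emp_add[of n x "\<lambda>_. c" "lincomb N' e b"] emp_const[OF assms(1)] eq by (simp add: eq[abs_def])
  have "quad_form N (ecov n x \<phi>) v = emp n x (\<lambda>y. (- emp n x (lincomb N \<phi> v) + lincomb N \<phi> v y)\<^sup>2)"
    unfolding emp_affine_sq[OF assms(1)] by simp
  also have "\<dots> = emp n x (\<lambda>y. (- emp n x (lincomb N' e b) + lincomb N' e b y)\<^sup>2)"
    unfolding m eq by simp
  also have "\<dots> = quad_form N' (ecov n x e) b"
    unfolding emp_affine_sq[OF assms(1)] by simp
  finally show ?thesis .
qed

section \<open>Gaussian approximation for one sample size\<close>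

lemma distr_restrict_iid:
  fixes X :: "nat \<Rightarrow> 'w \<Rightarrow> 'b::topological_space"
  assumes M: "prob_space M" and indep: "prob_space.indep_vars M (\<lambda>_. borel) X {1..}"
    and law: "\<And>i. i \<ge> 1 \<Longrightarrow> distr M borel (X i) = P" and n: "n \<ge> 1"
  shows "(\<lambda>\<omega>. \<lambda>i\<in>{1..n}. X i \<omega>) \<in> measurable M (Pi\<^sub>M {1..n} (\<lambda>_. P))"
    and "distr M (Pi\<^sub>M {1..n} (\<lambda>_. P)) (\<lambda>\<omega>. \<lambda>i\<in>{1..n}. X i \<omega>) = Pi\<^sub>M {1..n} (\<lambda>_. P)"
proof -
  interpret prob_space M by (rule M)
  have X [measurable]: "X i \<in> measurable M borel" if "i \<in> {1..n}" for i
    using indep that unfolding indep_vars_def by auto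
  have sP: "sets P = sets borel" using law[of 1] by (metis le_refl sets_distr)
  have s: "sets (Pi\<^sub>M {1..n} (\<lambda>_. P)) = sets (Pi\<^sub>M {1..n} (\<lambda>_. borel :: 'b measure))"
    by (rule sets_PiM_cong) (simp_all add: sP)
  have "(\<lambda>\<omega>. \<lambda>i\<in>{1..n}. X i \<omega>) \<in> measurable M (Pi\<^sub>M {1..n} (\<lambda>_. borel))"
    by (rule measurable_restrict) (rule X)
  then show "(\<lambda>\<omega>. \<lambda>i\<in>{1..n}. X i \<omega>) \<in> measurable M (Pi\<^sub>M {1..n} (\<lambda>_. P))"
    by (simp only: measurable_cong_sets[OF refl s])
  have "indep_vars (\<lambda>_. borel) X {1..n}" using indep by (rule indep_vars_subset) auto
  then have "distr M (Pi\<^sub>M {1..n} (\<lambda>_. borel)) (\<lambda>\<omega>. \<lambda>i\<in>{1..n}. X i \<omega>) = Pi\<^sub>M {1..n} (\<lambda>i. distr M borel (X i))"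
    using n X by (subst (asm) indep_vars_iff_distr_eq_PiM') auto
  also have "\<dots> = Pi\<^sub>M {1..n} (\<lambda>_. P)" by (rule PiM_cong) (auto simp: law)
  also have "distr M (Pi\<^sub>M {1..n} (\<lambda>_. borel)) (\<lambda>\<omega>. \<lambda>i\<in>{1..n}. X i \<omega>)
    = distr M (Pi\<^sub>M {1..n} (\<lambda>_. P)) (\<lambda>\<omega>. \<lambda>i\<in>{1..n}. X i \<omega>)"
    by (rule distr_cong[OF refl s[symmetric] refl])
  finally show "distr M (Pi\<^sub>M {1..n} (\<lambda>_. P)) (\<lambda>\<omega>. \<lambda>i\<in>{1..n}. X i \<omega>) = Pi\<^sub>M {1..n} (\<lambda>_. P)" .
qed

lemma card_ind_class:
  assumes "strict_mono_on {1..m} g" "\<And>i. i \<in> {1..m} \<Longrightarrow> 0 < g i \<and> g i < 1"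
  shows "card (ind_class g m :: (real^'d \<Rightarrow> real) set) = CARD('d) * m"
  using bij_betw_same_card[OF ind_class_bij[OF assms, where 'd='d]]
    by (simp add: card_cartesian_product mult.commute)

text \<open>The inverse form in the coordinates of \<open>F\<close> equals \<open>n\<close> times
  \<open>chi_sq\<close>, and \<open>chi_sq\<close> depends on \<open>F\<close> only through the
  affine span. It is therefore evaluated again in the basis \<open>e\<close>, where the covariance
  is close to the identity.\<close>

lemma inv_quad_form_approx:
  fixes P :: "(real^'d) measure" and F :: "(real^'d \<Rightarrow> real) set" and x :: "nat \<Rightarrow> real^'d"
  assumes sys: "orthonormal_system P e (card F) B" and n: "n \<ge> 1" and fin: "finite F"
    and sets: "sets P = sets borel"
    and F: "\<And>f. f \<in> F \<Longrightarrow> f \<in> borel_measurable borel" "\<And>f y. f \<in> F \<Longrightarrow> f y \<in> {0, 1}"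
    and marg: "\<And>f. f \<in> F \<Longrightarrow> (\<integral>y. f y \<partial>Q0) = (\<integral>y. f y \<partial>P)"
    and span: "affine_span (card F) (from_nat_into F) = affine_span (card F) e"
    and var: "\<And>v c. \<kappa> * (\<Sum>a<card F. (v a)\<^sup>2) \<le> (\<integral>y. (lincomb (card F) (from_nat_into F) v y - c)\<^sup>2 \<partial>P)"
      and \<kappa>: "\<kappa> > 0"
    and good: "orthonormal_system.good_sample e (card F) B n {1..n} x"
  defines "\<epsilon> \<equiv> sqrt B * card F / sqrt n + (real (card F))\<^sup>2 / n"
  assumes \<epsilon>: "\<epsilon> \<le> 1/2"
  shows "invertible_mat (emp_cov n x F)"
    and "\<bar>inv_quad_form (emp_cov n x F) (gamma_vec P n x F)
      - orthonormal_system.nsq (card F) (orthonormal_system.wvec e n {1..n} x)\<bar>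
      \<le> 2 * \<epsilon> * (real (card F))\<^sup>2"
proof -
  interpret O: orthonormal_system P e "card F" B by (rule sys)
  interpret Q: prob_space "Q0 :: (real^'d) measure" by (rule prob_space_Q0)
  let ?N = "card F" and ?\<phi> = "from_nat_into F"
  have B: "B \<ge> 0" using O.k_le_B by linarith
  have \<epsilon>0: "\<epsilon> \<ge> 0" unfolding \<epsilon>_def using B by simp
  have near: "\<bar>quad_form ?N (ecov n x e) v - O.nsq v\<bar> \<le> \<epsilon> * O.nsq v" for v
    unfolding \<epsilon>_def by (rule O.ecov_near_identity[OF n good])
  have \<phi>F: "?\<phi> a \<in> F" if "a < ?N" for a by (rule from_nat_into_in[OF fin that])
  have F1: "norm (f y) \<le> 1" if "f \<in> F" for f y using F(2)[OF that, of y] by auto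
  have iQ: "integrable Q0 f" if "f \<in> F" for f
    using F(1)[OF that] F1[OF that]
    by (intro Q.integrable_const_bound[where B = 1] AE_I2) (simp_all add: measurable_cong_sets[OF sets_Q0 refl])
  have iP: "integrable P f" if "f \<in> F" for f
    using F(1)[OF that] F1[OF that]
    by (intro O.integrable_const_bound[where B = 1] AE_I2) (simp_all add: measurable_cong_sets[OF sets refl])
  \<comment> \<open>\<open>e\<close> is orthonormal and centred for \<open>P\<close>, while
    \<open>chi_sq\<close> involves \<open>Q0\<close>. Both measures agree on the affine span of
    \<open>F\<close>, which contains every \<open>e a\<close>.\<close>
  have eQ: "integrable Q0 (e a)" "(\<integral>y. e a y \<partial>Q0) = 0" if a: "a < ?N" for a
  proof -
    have "e a = (\<lambda>y. 0 + lincomb ?N e (\<lambda>b. if b = a then 1 else 0) y)"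
      using a by (simp add: lincomb_def if_distrib[of "\<lambda>z. z * _"] sum.delta cong: if_cong)
    then have "e a \<in> affine_span ?N ?\<phi>" unfolding span by blast
    then obtain c v where ea: "e a = (\<lambda>y. c + (\<Sum>b<?N. v b * ?\<phi> b y))" by (auto simp: lincomb_def)
    have iQ': "integrable Q0 (\<lambda>y. v b * ?\<phi> b y)" and iP': "integrable P (\<lambda>y. v b * ?\<phi> b y)" if "b < ?N" for b
      using iQ[OF \<phi>F[OF that]] iP[OF \<phi>F[OF that]] by auto
    have "integrable Q0 (\<lambda>y. \<Sum>b<?N. v b * ?\<phi> b y)" "integrable P (\<lambda>y. \<Sum>b<?N. v b * ?\<phi> b y)"
      using iQ' iP' by (auto intro: Bochner_Integration.integrable_sum)
    then show "integrable Q0 (e a)" and "(\<integral>y. e a y \<partial>Q0) = 0"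
    proof -
      assume i: "integrable Q0 (\<lambda>y. \<Sum>b<?N. v b * ?\<phi> b y)" "integrable P (\<lambda>y. \<Sum>b<?N. v b * ?\<phi> b y)"
      show "integrable Q0 (e a)" unfolding ea using i by simp
      have "(\<integral>y. (\<Sum>b<?N. v b * ?\<phi> b y) \<partial>Q0) = (\<Sum>b<?N. v b * (\<integral>y. ?\<phi> b y \<partial>Q0))"
        using iQ' by (subst Bochner_Integration.integral_sum) auto
      also have "\<dots> = (\<Sum>b<?N. v b * (\<integral>y. ?\<phi> b y \<partial>P))" by (intro sum.cong refl) (simp add: marg \<phi>F)
      also have "\<dots> = (\<integral>y. (\<Sum>b<?N. v b * ?\<phi> b y) \<partial>P)"
        using iP' by (subst Bochner_Integration.integral_sum) auto
      finally have "(\<integral>y. e a y \<partial>Q0) = (\<integral>y. e a y \<partial>P)"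
        unfolding ea using i by (simp add: Q.prob_space O.prob_space)
      then show "(\<integral>y. e a y \<partial>Q0) = 0" using O.e_mean[OF a] by simp
    qed
  qed
  show inv: "invertible_mat (emp_cov n x F)"
  proof (rule invertible_emp_cov[OF n])
    fix v assume 0: "quad_form ?N (ecov n x ?\<phi>) v = 0"
    have "(\<lambda>y. 0 + lincomb ?N ?\<phi> v y) \<in> affine_span ?N e" unfolding span[symmetric] by blast
    then obtain c b where "(\<lambda>y. 0 + lincomb ?N ?\<phi> v y) = (\<lambda>y. c + lincomb ?N e b y)" by blast
    then have cb: "lincomb ?N ?\<phi> v y = c + lincomb ?N e b y" for y by (auto dest: fun_cong[of _ _ y])
    have "quad_form ?N (ecov n x e) b = 0" using 0 quad_form_ecov_affine[OF n cb] by simp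
    then have "O.nsq b \<le> \<epsilon> * O.nsq b" using near[of b] O.nsq_nonneg[of b] by simp
    also have "\<dots> \<le> 1/2 * O.nsq b" using \<epsilon> O.nsq_nonneg[of b] by (rule mult_right_mono)
    finally have "O.nsq b = 0" using O.nsq_nonneg[of b] by simp
    then have "\<forall>a<?N. b a = 0" unfolding O.nsq_def by (subst (asm) sum_nonneg_eq_0_iff) auto
    then have "lincomb ?N e b y = 0" for y by (simp add: lincomb_def)
    \<comment> \<open>The combination is a constant function, so its variance vanishes and the lower
      bound by \<open>\<kappa>\<close> forces \<open>v\<close> to be 0.\<close>
    then have "\<kappa> * (\<Sum>a<?N. (v a)\<^sup>2) \<le> 0" using var[of v c] by (simp add: cb)
    then show "\<forall>a<?N. v a = 0" by (rule sum_squares_nonposD[OF \<kappa>])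
  qed
  define q where "q = inv_quad_form (emp_cov n x F) (gamma_vec P n x F)"
  have nq: "ereal n * chi_sq n x F = ereal q"
    unfolding q_def by (rule chi_sq_eq_inv_quad_form[OF n fin prob_space_Q0 iQ marg inv])
  have chi: "chi_sq n x F = ereal (q / n)"
    using nq n by (cases "chi_sq n x F") (auto simp: field_simps)
  define g where "g a = emp n x (e a) - (\<integral>y. e a y \<partial>Q0)" for a
  have gW: "g a = O.wvec n {1..n} x a / sqrt n" if "a < ?N" for a
    using n by (simp add: g_def eQ(2)[OF that] emp_def O.wvec_def)
  have G: "(\<Sum>a<?N. (g a)\<^sup>2) = O.nsq (O.wvec n {1..n} x) / n"
    unfolding O.nsq_def sum_divide_distrib by (intro sum.cong refl) (simp add: gW power_divide)
  \<comment> \<open>The second evaluation of the same supremum, now in the basis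
    \<open>e\<close>.\<close>
  have "(SUP v. ereal (- (\<Sum>a<?N. v a * g a) - 1/4 * quad_form ?N (ecov n x e) v)) = ereal (q / n)"
    unfolding chi[symmetric] g_def
    by (rule chi_sq_eq_SUP[OF n prob_space_Q0 _ eQ(1), symmetric]) (simp_all only: span_eq_affine[OF fin] span)
  from SUP_near_identity_quadratic[OF \<epsilon>0 \<epsilon> near[unfolded O.nsq_def] this]
  have "\<bar>q / n - O.nsq (O.wvec n {1..n} x) / n\<bar> \<le> 2 * \<epsilon> * (O.nsq (O.wvec n {1..n} x) / n)"
    unfolding G .
  then have "n * \<bar>q / n - O.nsq (O.wvec n {1..n} x) / n\<bar> \<le> n * (2 * \<epsilon> * (O.nsq (O.wvec n {1..n} x) / n))"
    by (rule mult_left_mono) simp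
  moreover have "n * \<bar>q / n - O.nsq (O.wvec n {1..n} x) / n\<bar> = \<bar>q - O.nsq (O.wvec n {1..n} x)\<bar>"
    using n by (simp add: abs_if diff_divide_distrib[symmetric] divide_less_0_iff)
  ultimately have "\<bar>q - O.nsq (O.wvec n {1..n} x)\<bar> \<le> 2 * \<epsilon> * O.nsq (O.wvec n {1..n} x)" using n by simp
  also have "\<dots> \<le> 2 * \<epsilon> * (real ?N)\<^sup>2"
    using good \<epsilon>0 by (intro mult_left_mono) (auto simp: O.good_sample_def)
  finally show "\<bar>inv_quad_form (emp_cov n x F) (gamma_vec P n x F) - O.nsq (O.wvec n {1..n} x)\<bar>
    \<le> 2 * \<epsilon> * (real ?N)\<^sup>2"
    unfolding q_def .
qed

text \<open>The orthonormal basis stays hidden behind the existential: only the comparison variable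
  \<open>T\<close> and the good event \<open>G\<close> are passed on. \<open>B\<close> is
  \<open>k / \<kappa>\<close> for the \<open>\<kappa>\<close> supplied by
  \<open>ind_class_variance_bound\<close>.\<close>

lemma exists_gaussian_approximation:
  fixes M :: "'w measure" and X :: "nat \<Rightarrow> 'w \<Rightarrow> real^'d" and P :: "(real^'d) measure" and f :: "real^'d \<Rightarrow> real"
  assumes M: "prob_space M" and indep: "prob_space.indep_vars M (\<lambda>_. borel) X {1..}"
    and law: "\<And>i. i \<ge> 1 \<Longrightarrow> distr M borel (X i) = P"
    and n: "n \<ge> 1" and m: "m \<ge> 1"
    and grid: "strict_mono_on {1..m} g" "\<And>i. i \<in> {1..m} \<Longrightarrow> 0 < g i \<and> g i < 1"
    and \<delta>: "\<delta> > 0"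
    and gap: "\<And>i l. i \<in> {1..m} \<Longrightarrow> l \<in> {1..m} \<Longrightarrow> l \<noteq> i \<Longrightarrow> \<bar>g l - g i\<bar> \<ge> \<delta>"
    and range: "\<And>i. i \<in> {1..m} \<Longrightarrow> \<delta> \<le> g i \<and> g i + \<delta> \<le> 1"
    and P: "P \<in> Omega" "P = density Q0 (\<lambda>x. ennreal (f x))"
    and f: "f \<in> borel_measurable borel" "\<And>x. x \<in> cbox 0 1 \<Longrightarrow> c0 \<le> f x" "c0 > 0"
  defines "k \<equiv> CARD('d) * m" and "F \<equiv> ind_class g m :: (real^'d \<Rightarrow> real) set"
  defines "B \<equiv> 4 * CARD('d) * k / (\<delta> * c0)"
  defines "\<epsilon> \<equiv> sqrt B * k / sqrt n + (real k)\<^sup>2 / n"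
  assumes B: "B \<le> n" and \<epsilon>: "\<epsilon> \<le> 1/2"
  shows "\<exists>T G. T \<in> borel_measurable M \<and> G \<in> sets M \<and> measure M G \<ge> 1 - 2 / k
    \<and> near_gaussian M T (8 / sqrt k + 70 * B * k / sqrt n)
    \<and> (\<forall>\<omega>\<in>G. invertible_mat (emp_cov n (\<lambda>i. X i \<omega>) F)
        \<and> \<bar>(inv_quad_form (emp_cov n (\<lambda>i. X i \<omega>) F) (gamma_vec P n (\<lambda>i. X i \<omega>) F) - k) / sqrt (2 * real k)
          - T \<omega>\<bar>
          \<le> 2 * \<epsilon> * (real k)\<^sup>2 / sqrt (2 * real k))"
proof -
  interpret M: prob_space M by (rule M)
  have pP: "prob_space P" and sP: "sets P = sets borel" using P(1) by (auto simp: Omega_def)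
  interpret P: prob_space P by (rule pP)
  have fin: "finite F" unfolding F_def by (rule ind_class_finite)
  have k: "card F = k" unfolding F_def k_def by (rule card_ind_class[OF grid])
  have k1: "k \<ge> 1" using m by (simp add: k_def)
  define \<kappa> where "\<kappa> = \<delta> * c0 / (4 * CARD('d))"
  have \<kappa>: "\<kappa> > 0" "k / \<kappa> = B" using \<delta> f(3) by (simp_all add: \<kappa>_def B_def)
  have Fm: "h \<in> borel_measurable borel" "h y \<in> {0, 1}" if "h \<in> F" for h y
    using that by (auto simp: F_def ind_class_def) (auto simp: half_ind_def)
  have marg: "(\<integral>y. h y \<partial>Q0) = (\<integral>y. h y \<partial>P)" if hF: "h \<in> F" for h
  proof -
    obtain i j where "i \<in> {1..m}" "h = half_ind (g i) j" using hF unfolding F_def ind_class_def by blast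
    then show ?thesis using grid(2) by (simp add: integral_half_ind_Q0 integral_half_ind_Omega[OF P(1)])
  qed
  have var: "\<kappa> * (\<Sum>a<card F. (v a)\<^sup>2) \<le> (\<integral>x. (lincomb (card F) (from_nat_into F) v x - c)\<^sup>2 \<partial>P)" for v c
    unfolding \<kappa>_def F_def by (rule ind_class_variance_bound[OF grid \<delta> gap range f P(2) pP])
  have "1 \<le> card F" using k k1 by simp
  then obtain e where sys: "orthonormal_system P e (card F) (card F / \<kappa>)"
    and span: "affine_span (card F) (from_nat_into F) = affine_span (card F) e"
  proof (rule P.exists_orthonormal_system[OF _ \<kappa>(1) _ _ var])
    fix a y assume "a < card F"
    then have "from_nat_into F a \<in> F" by (rule from_nat_into_in[OF fin])
    from Fm(1)[OF this] Fm(2)[OF this, of y] show "from_nat_into F a \<in> borel_measurable P" "0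
      \<le> from_nat_into F a y \<and> from_nat_into F a y \<le> 1"
      by (auto simp: measurable_cong_sets[OF sP refl])
  qed
  have sys': "orthonormal_system P e (card F) B" using sys unfolding k \<kappa>(2) .
  interpret O: orthonormal_system P e "card F" B by (rule sys')
  let ?S = "Pi\<^sub>M {1..n} (\<lambda>_. P)" and ?Y = "\<lambda>\<omega>. \<lambda>i\<in>{1..n}. X i \<omega>"
  have Y [measurable]: "?Y \<in> measurable M ?S" and dY: "distr M ?S ?Y = ?S"
    using distr_restrict_iid[OF M indep law n] by auto
  have J: "finite {1..n}" "card {1..n} = n" "n > 0" using n by auto
  define T0 where "T0 x = (O.nsq (O.wvec n {1..n} x) - card F) / sqrt (2 * real (card F))" for x
  have T0 [measurable]: "T0 \<in> borel_measurable ?S"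
    unfolding T0_def[abs_def]
    by (intro bdd_meas_measurable bdd_meas_intros O.bdd_meas_nsq_wvec)
  define T where "T \<omega> = T0 (?Y \<omega>)" for \<omega>
  define G0 where "G0 = {x \<in> space ?S. O.good_sample n {1..n} x}"
  have G0: "G0 \<in> sets ?S" "measure ?S G0 \<ge> 1 - 2 / card F"
    unfolding G0_def by (rule O.prob_good_sample[OF J])+
  define G where "G = ?Y -` G0 \<inter> space M"
  have t1: "T \<in> borel_measurable M" unfolding T_def[abs_def] by measurable
  have t2: "G \<in> sets M" unfolding G_def using Y G0(1) by (rule measurable_sets)
  have t3: "measure M G \<ge> 1 - 2 / k"
    using G0(2) measure_distr[OF Y G0(1)] unfolding dY G_def k by simp
  have t4: "near_gaussian M T (8 / sqrt k + 70 * B * k / sqrt n)"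
  proof -
    have "(\<integral>\<omega>. cis (t * T \<omega>) \<partial>M) = (\<integral>x. cis (t * T0 x) \<partial>distr M ?S ?Y)" for t
      unfolding T_def cis_conv_exp by (rule integral_distr[OF Y, symmetric]) measurable
    moreover have "near_gaussian ?S T0 (8 / sqrt k + 70 * B * k / sqrt n)"
      using O.char_bound[OF J B] unfolding T0_def[abs_def] k by simp
    ultimately show ?thesis unfolding near_gaussian_def dY by simp
  qed
  have t5: "invertible_mat (emp_cov n (\<lambda>i. X i \<omega>) F)
        \<and> \<bar>(inv_quad_form (emp_cov n (\<lambda>i. X i \<omega>) F) (gamma_vec P n (\<lambda>i. X i \<omega>) F) - k) / sqrt (2 * real k)
          - T \<omega>\<bar>
          \<le> 2 * \<epsilon> * (real k)\<^sup>2 / sqrt (2 * real k)" if "\<omega> \<in> G" for \<omega>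
  proof -
    let ?x = "\<lambda>i. X i \<omega>"
    have W: "O.wvec n {1..n} (?Y \<omega>) = O.wvec n {1..n} ?x"
      unfolding O.wvec_def by (intro ext arg_cong2[where f="(/)"] sum.cong) auto
    have H: "O.gram_err n {1..n} (?Y \<omega>) = O.gram_err n {1..n} ?x"
      unfolding O.gram_err_def by (intro ext arg_cong2[where f="(-)"] arg_cong2[where f="(/)"] sum.cong) auto
    have "O.good_sample n {1..n} (?Y \<omega>)" using that unfolding G_def G0_def by blast
    then have good: "O.good_sample n {1..n} ?x" unfolding O.good_sample_def W H .
    have \<epsilon>F: "sqrt B * card F / sqrt n + (real (card F))\<^sup>2 / n \<le> 1/2" using \<epsilon> unfolding \<epsilon>_def k .
    have inv: "invertible_mat (emp_cov n ?x F)"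
      by (rule inv_quad_form_approx(1)[where \<kappa> = \<kappa> and P = P and e = e and B = B])
         (fact sys' n fin sP Fm marg span var \<kappa>(1) good \<epsilon>F)+
    have "\<bar>inv_quad_form (emp_cov n ?x F) (gamma_vec P n ?x F) - O.nsq (O.wvec n {1..n} ?x)\<bar>
        \<le> 2 * (sqrt B * card F / sqrt n + (real (card F))\<^sup>2 / n) * (real (card F))\<^sup>2"
      by (rule inv_quad_form_approx(2)[where \<kappa> = \<kappa>])
         (fact sys' n fin sP Fm marg span var \<kappa>(1) good \<epsilon>F)+
    then have a: "\<bar>inv_quad_form (emp_cov n ?x F) (gamma_vec P n ?x F) - O.nsq (O.wvec n {1..n} ?x)\<bar>
        \<le> 2 * \<epsilon> * (real k)\<^sup>2" unfolding \<epsilon>_def k .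
    have eq: "(inv_quad_form (emp_cov n ?x F) (gamma_vec P n ?x F) - k) / sqrt (2 * real k) - T \<omega>
        = (inv_quad_form (emp_cov n ?x F) (gamma_vec P n ?x F) - O.nsq (O.wvec n {1..n} ?x))
          / sqrt (2 * real k)"
      unfolding T_def T0_def W k by (simp add: diff_divide_distrib)
    have "\<bar>inv_quad_form (emp_cov n ?x F) (gamma_vec P n ?x F)
      - O.nsq (O.wvec n {1..n} ?x)\<bar> / \<bar>sqrt (2 * real k)\<bar>
        \<le> 2 * \<epsilon> * (real k)\<^sup>2 / \<bar>sqrt (2 * real k)\<bar>"
      using a by (rule divide_right_mono) simp
    moreover have "\<bar>sqrt (2 * real k)\<bar> = sqrt (2 * real k)" by simp
    ultimately show ?thesis unfolding eq abs_divide using inv by (simp only:)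
  qed
  show ?thesis
    by (rule exI[of _ T], rule exI[of _ G], intro conjI t1 t2 t3 t4, rule ballI, rule t5)
qed

section \<open>Limit distribution\<close>

text \<open>Slutsky's argument for distribution functions. It is stated for events
  \<open>A n\<close> rather than variables, so that it serves both the real-valued and the
  extended-real statistic.\<close>

lemma (in prob_space) prob_sandwich:
  fixes T :: "nat \<Rightarrow> 'a \<Rightarrow> real"
  assumes T: "\<And>n. T n \<in> borel_measurable M"
    and lim: "\<And>s. (\<lambda>n. measure M {\<omega> \<in> space M. T n \<omega> \<le> s}) \<longlonglongrightarrow> \<Phi> s" and cont: "isCont \<Phi> t"
    and G: "\<And>n. G n \<in> sets M" "(\<lambda>n. measure M (G n)) \<longlonglongrightarrow> 1"
    and A: "\<And>n. A n \<in> sets M" and \<delta>: "\<delta> \<longlonglongrightarrow> 0"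
    and low: "eventually (\<lambda>n. \<forall>\<omega>\<in>G n. T n \<omega> \<le> t - \<delta> n \<longrightarrow> \<omega> \<in> A n) sequentially"
    and up: "eventually (\<lambda>n. \<forall>\<omega>\<in>G n. \<omega> \<in> A n \<longrightarrow> T n \<omega> \<le> t + \<delta> n) sequentially"
  shows "(\<lambda>n. measure M (A n)) \<longlonglongrightarrow> \<Phi> t"
proof -
  note [measurable] = T G(1) A
  let ?p = "\<lambda>n s. measure M {\<omega> \<in> space M. T n \<omega> \<le> s}"
  have cont': "\<exists>r>0. \<forall>s. \<bar>s - t\<bar> < r \<longrightarrow> \<bar>\<Phi> s - \<Phi> t\<bar> < \<eta>" if "\<eta> > 0" for \<eta>
    using cont that unfolding isCont_def LIM_eq by (metis abs_0 diff_self real_norm_def)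
  \<comment> \<open>Outside \<open>G n\<close> nothing is known, at the price of its complementary
    probability.\<close>
  have mono: "measure M U \<le> measure M V + (1 - measure M (G n))"
    if "U \<in> sets M" "V \<in> sets M" "U \<inter> G n \<subseteq> V" for U V n
  proof -
    have "measure M U \<le> measure M (V \<union> (space M - G n))"
      using that sets.sets_into_space[OF that(1)] G(1) by (intro finite_measure_mono) auto
    also have "\<dots> \<le> measure M V + measure M (space M - G n)"
      using that(2) G(1) by (intro measure_Un_le) auto
    also have "measure M (space M - G n) = 1 - measure M (G n)" by (rule prob_compl[OF G(1)])
    finally show ?thesis .
  qed
  show ?thesis
  proof (rule order_tendstoI)
    fix a assume a: "a < \<Phi> t"
    obtain r where r: "r > 0" "\<And>s. \<bar>s - t\<bar> < r \<Longrightarrow> \<bar>\<Phi> s - \<Phi> t\<bar> < \<Phi> t - a"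
      using cont'[of "\<Phi> t - a"] a by auto
    have "\<Phi> (t - r / 2) > a" using r(2)[of "t - r / 2"] r(1) by (simp add: abs_if split: if_splits)
    moreover have "(\<lambda>n. ?p n (t - r / 2) - (1 - measure M (G n))) \<longlonglongrightarrow> \<Phi> (t - r / 2) - (1 - 1)"
      by (intro tendsto_intros lim G)
    ultimately have "eventually (\<lambda>n. a < ?p n (t - r / 2) - (1 - measure M (G n))) sequentially"
      by (auto dest: order_tendstoD)
    moreover have "eventually (\<lambda>n. \<delta> n < r / 2) sequentially"
      using order_tendstoD(2)[OF \<delta>, of "r / 2"] r(1) by simp
    ultimately show "eventually (\<lambda>n. a < measure M (A n)) sequentially" using low
    proof eventually_elim
      case (elim n)
      have "?p n (t - r / 2) \<le> measure M (A n) + (1 - measure M (G n))"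
        using elim by (intro mono) (measurable, force)
      then show ?case using elim by simp
    qed
  next
    fix a assume a: "\<Phi> t < a"
    obtain r where r: "r > 0" "\<And>s. \<bar>s - t\<bar> < r \<Longrightarrow> \<bar>\<Phi> s - \<Phi> t\<bar> < a - \<Phi> t"
      using cont'[of "a - \<Phi> t"] a by auto
    have "\<Phi> (t + r / 2) < a" using r(2)[of "t + r / 2"] r(1) by (simp add: abs_if split: if_splits)
    moreover have "(\<lambda>n. ?p n (t + r / 2) + (1 - measure M (G n))) \<longlonglongrightarrow> \<Phi> (t + r / 2) + (1 - 1)"
      by (intro tendsto_intros lim G)
    ultimately have "eventually (\<lambda>n. ?p n (t + r / 2) + (1 - measure M (G n)) < a) sequentially"
      by (auto dest: order_tendstoD)
    moreover have "eventually (\<lambda>n. \<delta> n < r / 2) sequentially"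
      using order_tendstoD(2)[OF \<delta>, of "r / 2"] r(1) by simp
    ultimately show "eventually (\<lambda>n. measure M (A n) < a) sequentially" using up
    proof eventually_elim
      case (elim n)
      have "measure M (A n) \<le> ?p n (t + r / 2) + (1 - measure M (G n))"
        using elim sets.sets_into_space[OF A] by (intro mono) (measurable, force)
      then show ?case using elim by simp
    qed
  qed
qed

lemma isCont_cdf_std_normal: "isCont (cdf std_normal_distribution) t"
proof -
  interpret real_distribution std_normal_distribution by (rule real_dist_normal_dist)
  have "emeasure std_normal_distribution {t} = 0"
    by (subst emeasure_density) (auto simp: nn_integral_0_iff_AE AE_lborel_singleton intro!:
      AE_mp[OF AE_lborel_singleton[of t]] AE_I2 split: split_indicator)
  then show ?thesis by (simp add: isCont_cdf measure_def)
qed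

text \<open>Levy's continuity theorem; since the normal distribution has no atoms, the convergence
  holds at every \<open>s\<close>.\<close>

lemma (in prob_space) cdf_convergence_of_near_gaussian:
  fixes T :: "nat \<Rightarrow> 'a \<Rightarrow> real"
  assumes T: "\<And>n. T n \<in> borel_measurable M"
    and near: "eventually (\<lambda>n. near_gaussian M (T n) (\<epsilon> n)) sequentially" and \<epsilon>: "\<epsilon> \<longlonglongrightarrow> 0"
  shows "(\<lambda>n. measure M {\<omega> \<in> space M. T n \<omega> \<le> s}) \<longlonglongrightarrow> cdf std_normal_distribution s"
proof -
  note [measurable] = T
  have "weak_conv_m (\<lambda>n. distr M borel (T n)) std_normal_distribution"
  proof (rule levy_continuity)
    show "real_distribution (distr M borel (T n))" for n by (rule real_distribution_distr) (rule T)
    show "real_distribution std_normal_distribution" by (rule real_dist_normal_dist)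
    fix t
    have char: "char (distr M borel (T n)) t = (\<integral>\<omega>. cis (t * T n \<omega>) \<partial>M)" for n
      unfolding char_def cis_conv_exp by (rule integral_distr) measurable
    have "(\<lambda>n. (\<integral>\<omega>. cis (t * T n \<omega>) \<partial>M) - complex_of_real (exp (- t\<^sup>2 / 2))) \<longlonglongrightarrow> 0"
    proof (rule Lim_null_comparison)
      show "eventually (\<lambda>n. norm ((\<integral>\<omega>. cis (t * T n \<omega>) \<partial>M) - complex_of_real (exp (- t\<^sup>2 / 2)))
          \<le> \<bar>t\<bar> * (\<bar>t\<bar> + t\<^sup>2) * \<epsilon> n) sequentially"
        using near unfolding near_gaussian_def by (rule eventually_mono) blast
      show "(\<lambda>n. \<bar>t\<bar> * (\<bar>t\<bar> + t\<^sup>2) * \<epsilon> n) \<longlonglongrightarrow> 0" using tendsto_mult_right_zero[OF \<epsilon>] .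
    qed
    then show "(\<lambda>n. char (distr M borel (T n)) t) \<longlonglongrightarrow> char std_normal_distribution t"
      unfolding char by (simp add: char_std_normal_distribution LIM_zero_iff)
  qed
  then have "(\<lambda>n. cdf (distr M borel (T n)) s) \<longlonglongrightarrow> cdf std_normal_distribution s"
    using isCont_cdf_std_normal unfolding weak_conv_m_def weak_conv_def by blast
  moreover have "cdf (distr M borel (T n)) s = measure M {\<omega> \<in> space M. T n \<omega> \<le> s}" for n
    unfolding cdf_def by (subst measure_distr) (auto intro!: arg_cong[where f = "measure M"])
  ultimately show ?thesis by simp
qed

lemma eventually_gt_of_liminf_pos:
  fixes f :: "nat \<Rightarrow> ereal"
  assumes "0 < liminf f"
  shows "\<exists>c>0. eventually (\<lambda>n. ereal c < f n) sequentially"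
proof -
  obtain c where "0 < ereal c" "ereal c < liminf f" using ereal_dense2[OF assms] by blast
  then show ?thesis using less_LiminfD[of "ereal c"] by auto
qed

text \<open>The only place where the rate \<open>k\<^sup>7\<^sup>/\<^sup>2 = o(n\<^sup>1\<^sup>/\<^sup>2)\<close> is used in full is the third bound.\<close>

lemma rate_bounds:
  fixes k n :: nat and C :: real
  assumes k: "k \<ge> 1" and n: "n \<ge> 1" and C: "C \<ge> 0"
  defines "r \<equiv> real k powr (7/2) * real n powr (-1/2)" and "B \<equiv> C * (real k)\<^sup>2"
  defines "\<epsilon> \<equiv> sqrt B * k / sqrt n + (real k)\<^sup>2 / n"
  shows "B \<le> C * r * n" and "\<epsilon> \<le> (sqrt C + 1) * r"
    and "2 * \<epsilon> * (real k)\<^sup>2 / sqrt (2 * real k) \<le> 2 * (sqrt C + 1) * r"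
    and "B * k / sqrt n \<le> C * r"
proof -
  have k1: "real k \<ge> 1" "sqrt k \<ge> 1" and n1: "real n \<ge> 1" "sqrt n \<ge> 1" using k n by auto
  have "real k powr (7/2) = real k powr (3 + 1/2)" by simp
  also have "\<dots> = (real k)^3 * sqrt k" using k1 by (subst powr_add) (simp add: powr_half_sqrt)
  finally have pk: "real k powr (7/2) = (real k)^3 * sqrt k" .
  have pn: "real n powr (-1/2) = 1 / sqrt n" using n1 by (simp add: powr_minus_divide powr_half_sqrt)
  have r: "r = (real k)^3 * sqrt k / sqrt n" unfolding r_def pk pn by simp
  have k23: "(real k)\<^sup>2 \<le> (real k)^3" using k1 by (simp add: power_increasing)
  have k3: "(real k)^3 \<le> (real k)^3 * sqrt k" using k1 by simp
  have k2r: "(real k)\<^sup>2 / sqrt n \<le> r" unfolding r using k23 k3 by (intro divide_right_mono) auto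
  have k3r: "(real k)^3 / sqrt n \<le> r" unfolding r using k3 by (intro divide_right_mono) auto
  have "sqrt n * 1 \<le> sqrt n * sqrt n" using n1 by (intro mult_left_mono) auto
  then have sn: "sqrt n \<le> n" using n1 by simp
  have k2n: "(real k)\<^sup>2 / n \<le> (real k)\<^sup>2 / sqrt n" using sn n1 by (intro divide_left_mono) auto
  have "(real k)\<^sup>2 \<le> r * n"
  proof -
    have "(real k)\<^sup>2 \<le> r * sqrt n" using k2r n1 by (simp add: pos_divide_le_eq)
    also have "\<dots> \<le> r * n" using sn by (intro mult_left_mono) (auto simp: r)
    finally show ?thesis .
  qed
  from mult_left_mono[OF this C] show "B \<le> C * r * n" by (simp add: B_def mult.assoc)
  have sB: "sqrt B = sqrt C * k" by (simp add: B_def real_sqrt_mult)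
  \<comment> \<open>Both parts have the order of the square of \<open>k\<close> over
    \<open>sqrt n\<close>: \<open>sqrt B\<close> contributes one factor \<open>k\<close>, and
    dividing by \<open>n\<close> is better than dividing by \<open>sqrt n\<close>.\<close>
  have \<epsilon>: "\<epsilon> \<le> (sqrt C + 1) * ((real k)\<^sup>2 / sqrt n)"
    unfolding \<epsilon>_def sB using k2n by (simp add: distrib_right power2_eq_square add_divide_distrib)
  also have "\<dots> \<le> (sqrt C + 1) * r" using k2r C by (intro mult_left_mono) auto
  finally show "\<epsilon> \<le> (sqrt C + 1) * r" .
  have "2 * \<epsilon> * (real k)\<^sup>2 / sqrt (2 * real k) \<le> 2 * \<epsilon> * (real k)\<^sup>2 / sqrt k"
    using k1 C by (intro divide_left_mono) (auto simp: \<epsilon>_def B_def)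
  also have "\<dots> = 2 * \<epsilon> * ((real k)\<^sup>2 / sqrt k)" by simp
  also have "\<dots> \<le> 2 * ((sqrt C + 1) * ((real k)\<^sup>2 / sqrt n)) * ((real k)\<^sup>2 / sqrt k)"
    using \<epsilon> by (intro mult_right_mono) auto
  also have "\<dots> = 2 * (sqrt C + 1) * r"
  proof -
    have "(real k)\<^sup>2 * (real k)\<^sup>2 / sqrt k = (real k)^3 * (k / sqrt k)"
      by (simp add: power2_eq_square power3_eq_cube)
    also have "k / sqrt k = sqrt k" by (rule real_div_sqrt) simp
    finally have "(real k)\<^sup>2 * (real k)\<^sup>2 / sqrt k = (real k)^3 * sqrt k" .
    then have "r = ((real k)\<^sup>2 * (real k)\<^sup>2 / sqrt k) / sqrt n" unfolding r by simp
    then have r2: "((real k)\<^sup>2 / sqrt n) * ((real k)\<^sup>2 / sqrt k) = r" by simp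
    show ?thesis unfolding r2[symmetric] by (simp only: mult_ac)
  qed
  finally show "2 * \<epsilon> * (real k)\<^sup>2 / sqrt (2 * real k) \<le> 2 * (sqrt C + 1) * r" .
  have "B * k / sqrt n = C * ((real k)^3 / sqrt n)" by (simp add: B_def power2_eq_square power3_eq_cube)
  also have "\<dots> \<le> C * r" using k3r C by (rule mult_left_mono)
  finally show "B * k / sqrt n \<le> C * r" .
qed

text \<open>Monotonicity extends the gap from neighbours to all pairs. The boundary conditions leave
  room inside the cube for a slab below the first and above the last grid point.\<close>

lemma grid_spacing:
  fixes g :: "nat \<Rightarrow> real"
  assumes mono: "strict_mono_on {1..m} g"
    and gap: "\<And>i. i \<in> {1..m - 1} \<Longrightarrow> \<delta> \<le> g (i + 1) - g i"
    and bd: "\<delta> \<le> g 1" "\<delta> \<le> 1 - g m"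
  shows "i \<in> {1..m} \<Longrightarrow> l \<in> {1..m} \<Longrightarrow> l \<noteq> i \<Longrightarrow> \<delta> \<le> \<bar>g l - g i\<bar>"
    and "i \<in> {1..m} \<Longrightarrow> \<delta> \<le> g i \<and> g i + \<delta> \<le> 1"
proof -
  have le: "g i \<le> g l" if "i \<in> {1..m}" "l \<in> {1..m}" "i \<le> l" for i l
    using strict_mono_onD[OF mono that(1,2)] that(3) by (cases "i = l") auto
  have less: "\<delta> \<le> g l - g i" if "i \<in> {1..m}" "l \<in> {1..m}" "i < l" for i l
  proof -
    have "\<delta> \<le> g (i + 1) - g i" using that by (intro gap) auto
    moreover have "g (i + 1) \<le> g l" using that by (intro le) auto
    ultimately show ?thesis by simp
  qed
  show "\<delta> \<le> \<bar>g l - g i\<bar>" if "i \<in> {1..m}" "l \<in> {1..m}" "l \<noteq> i"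
    using less[of i l] less[of l i] that by (cases "i < l") auto
  show "\<delta> \<le> g i \<and> g i + \<delta> \<le> 1" if "i \<in> {1..m}"
    using le[of 1 i] le[of i m] bd that by force
qed

theorem theorem3p13:
  fixes M :: "'w measure"
    and X :: "nat \<Rightarrow> 'w \<Rightarrow> real^'d"
    and P :: "(real^'d) measure"
    and m :: "nat \<Rightarrow> nat"
    and u :: "nat \<Rightarrow> nat \<Rightarrow> real"
    and k :: "nat \<Rightarrow> nat"
    and F :: "nat \<Rightarrow> (real^'d \<Rightarrow> real) set"
    and Tchi :: "nat \<Rightarrow> 'w \<Rightarrow> ereal"
    and Tquad :: "nat \<Rightarrow> 'w \<Rightarrow> real"
    and S :: "nat \<Rightarrow> 'w \<Rightarrow> real Matrix.mat"
  defines "k \<equiv> \<lambda>n. CARD('d) * m n"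
    and "F \<equiv> \<lambda>n. ind_class (u n) (m n)"
    and "S \<equiv> \<lambda>n \<omega>. emp_cov n (\<lambda>i. X i \<omega>) (F n)"
    and "Tchi \<equiv> \<lambda>n \<omega>. (ereal (real n) * chi_sq n (\<lambda>i. X i \<omega>) (F n) - ereal (real (k n)))
                         / ereal (sqrt (2 * real (k n)))"
    and "Tquad \<equiv> \<lambda>n \<omega>. (inv_quad_form (S n \<omega>) (gamma_vec P n (\<lambda>i. X i \<omega>) (F n)) - real (k n))
                          / sqrt (2 * real (k n))"
  assumes M: "prob_space M"
    and indep: "prob_space.indep_vars M (\<lambda>_. borel) X {1..}"
    and law: "\<And>i. i \<ge> 1 \<Longrightarrow> distr M borel (X i) = P"
    and grid_nonempty: "\<And>n. n \<ge> 1 \<Longrightarrow> m n \<ge> 1"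
    and grid_mono: "\<And>n. n \<ge> 1 \<Longrightarrow> strict_mono_on {1..m n} (u n)"
    and grid_range: "\<And>n i. n \<ge> 1 \<Longrightarrow> i \<in> {1..m n} \<Longrightarrow> 0 < u n i \<and> u n i < 1"
    and nested: "\<And>n. n \<ge> 1 \<Longrightarrow> F n \<subseteq> F (Suc n)"
    and gap_lower:
      "0 < liminf (\<lambda>n. INF i\<in>{1..m n - 1}. ereal (real (k n) * (u n (i + 1) - u n i)))"
    and gap_upper:
      "limsup (\<lambda>n. SUP i\<in>{1..m n - 1}. ereal (real (k n) * (u n (i + 1) - u n i))) < \<infinity>"
    and boundary_gap:
      "0 < liminf (\<lambda>n. ereal (real (k n) * min (u n 1) (1 - u n (m n))))"
    and Omega: "P \<in> Omega"
    and dens: "\<exists>(f :: real^'d \<Rightarrow> real) c. c > 0 \<and> f \<in> borel_measurable borel \<and>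
                 (\<forall>x \<in> cbox 0 1. c \<le> f x) \<and> P = density Q0 (\<lambda>x. ennreal (f x))"
    and k_lim: "filterlim k at_top sequentially"
    and k_rate: "(\<lambda>n. real (k n) powr (7/2) * real n powr (-1/2)) \<longlonglongrightarrow> 0"
  shows "(\<forall>n\<ge>1. \<forall>\<omega>\<in>space M. invertible_mat (S n \<omega>) \<longrightarrow> Tchi n \<omega> = ereal (Tquad n \<omega>))
    \<and> (\<lambda>n. measure M {\<omega> \<in> space M. invertible_mat (S n \<omega>)}) \<longlonglongrightarrow> 1
    \<and> (\<forall>t. (\<lambda>n. measure M {\<omega> \<in> space M. Tchi n \<omega> \<le> ereal t})
               \<longlonglongrightarrow> cdf std_normal_distribution t)
    \<and> weak_conv_m (\<lambda>n. distr M borel (Tquad n)) std_normal_distribution"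
proof -
  interpret prob_space M by (rule M)

  \<comment> \<open>Constants and vanishing error terms\<close>
  let ?d = "real CARD('d)"
  obtain f c0 where f: "f \<in> borel_measurable borel" "\<And>x. x \<in> cbox 0 1 \<Longrightarrow> c0 \<le> f x" "c0 > 0"
    and Pf: "P = density Q0 (\<lambda>x. ennreal (f x))" using dens by blast
  have X: "X i \<in> measurable M borel" if "i \<ge> 1" for i
    using indep that unfolding indep_vars_def by auto
  have finF: "finite (F n)" for n unfolding F_def by (rule ind_class_finite)
  have Fm: "h \<in> borel_measurable borel" "h y \<in> {0, 1}" if "h \<in> F n" for h y n
    using that by (auto simp: F_def ind_class_def) (auto simp: half_ind_def)
  have k1: "k n \<ge> 1" if "n \<ge> 1" for n using grid_nonempty[OF that] by (simp add: k_def)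

  obtain c1 where c1: "c1 > 0" "eventually
    (\<lambda>n. ereal c1 < (INF i\<in>{1..m n - 1}. ereal (real (k n) * (u n (i + 1) - u n i)))) sequentially"
    using eventually_gt_of_liminf_pos[OF gap_lower] by blast
  have c1': "eventually (\<lambda>n. \<forall>i\<in>{1..m n - 1}. c1 \<le> k n * (u n (i + 1) - u n i)) sequentially"
    using c1(2) by eventually_elim (auto dest!: less_INF_D)
  obtain c2 where c2: "c2 > 0" "eventually (\<lambda>n. ereal c2 < ereal (real (k n) * min (u n 1) (1 - u n (m n))))
    sequentially"
    using eventually_gt_of_liminf_pos[OF boundary_gap] by blast
  have c2': "eventually (\<lambda>n. c2 \<le> k n * min (u n 1) (1 - u n (m n))) sequentially"
    using c2(2) by eventually_elim simp
  define c where "c = min c1 c2"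
  have c: "c > 0" using c1 c2 by (simp add: c_def)
  \<comment> \<open>For spacing \<open>c / k\<close> the bound
    \<open>4 * d * k / (\<delta> * c0)\<close> on the basis equals \<open>C\<close> times the square
    of \<open>k\<close>.\<close>
  define C where "C = 4 * ?d / (c * c0)"
  have C: "C \<ge> 0" using c f(3) by (simp add: C_def)
  define r where "r n = real (k n) powr (7/2) * real n powr (-1/2)" for n
  have r0: "r \<longlonglongrightarrow> 0" using k_rate unfolding r_def[abs_def] .
  define B where "B n = C * (real (k n))\<^sup>2" for n
  define \<epsilon> where "\<epsilon> n = sqrt (B n) * k n / sqrt n + (real (k n))\<^sup>2 / n" for n
  define \<delta> where "\<delta> n = 2 * (sqrt C + 1) * r n" for n
  have \<delta>0: "\<delta> \<longlonglongrightarrow> 0" unfolding \<delta>_def[abs_def] using tendsto_mult_right_zero[OF r0] .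
  define err where "err n = 8 / sqrt (k n) + 70 * (C * r n)" for n
  have "(\<lambda>n. 8 / sqrt (real (k n)) + 70 * (C * r n)) \<longlonglongrightarrow> 0 + 70 * (C * 0)"
    by (intro tendsto_intros r0 tendsto_divide_0[OF tendsto_const] filterlim_at_top_imp_at_infinity
          filterlim_compose[OF sqrt_at_top] filterlim_compose[OF filterlim_real_sequentially] k_lim)
  then have err0: "err \<longlonglongrightarrow> 0" by (simp add: err_def[abs_def])

  \<comment> \<open>Sample sizes at which the approximation is available\<close>
  \<comment> \<open>The asymptotic hypotheses are turned into conditions on a single
    \<open>n\<close>; the last two give the requirements \<open>B \<le> n\<close> and
    \<open>\<epsilon> \<le> 1/2\<close> through \<open>rate_bounds\<close>.\<close>
  define Good where "Good n \<longleftrightarrow> n \<ge> 1 \<and> (\<forall>i\<in>{1..m n - 1}. c \<le> k n * (u n (i + 1) - u n i))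
    \<and> c \<le> k n * min (u n 1) (1 - u n (m n)) \<and> C * r n \<le> 1 \<and> (sqrt C + 1) * r n \<le> 1/2" for n
  have Good: "eventually Good sequentially"
  proof -
    have "(\<lambda>n. C * r n) \<longlonglongrightarrow> 0" "(\<lambda>n. (sqrt C + 1) * r n) \<longlonglongrightarrow> 0"
      using tendsto_mult_right_zero[OF r0] by auto
    then have "eventually (\<lambda>n. C * r n < 1) sequentially" "eventually (\<lambda>n. (sqrt C + 1) * r n < 1/2)
      sequentially"
      using order_tendstoD(2)[of "\<lambda>n. C * r n" 0 sequentially 1]
        order_tendstoD(2)[of "\<lambda>n. (sqrt C + 1) * r n" 0 sequentially "1/2"]
      by (simp_all only: zero_less_one half_gt_zero_iff)
    then show ?thesis using c1' c2' eventually_ge_at_top[of 1]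
    proof eventually_elim
      case (elim n)
      then show ?case unfolding Good_def c_def by (auto intro: order.trans min.coboundedI1 min.coboundedI2)
    qed
  qed

  define Pr where "Pr n T G \<longleftrightarrow> T \<in> borel_measurable M \<and> G \<in> sets M \<and> measure M G \<ge> 1 - 2 / k n
    \<and> near_gaussian M T (err n)
    \<and> (\<forall>\<omega>\<in>G. invertible_mat (S n \<omega>) \<and> \<bar>Tquad n \<omega> - T \<omega>\<bar> \<le> \<delta> n)" for n T G
  have "\<exists>T G. Pr n T G" if g: "Good n" for n
  proof -
    have n: "n \<ge> 1" using g by (simp add: Good_def)
    have kn: "real (k n) \<ge> 1" using k1[OF n] by simp
    \<comment> \<open>The uniform spacing at this \<open>n\<close>; it plays the role of
      \<open>\<delta>\<close> in the variance bound.\<close>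
    define d where "d = c / k n"
    have d: "d > 0" using c kn by (simp add: d_def)
    have dk: "d \<le> z" if "c \<le> real (k n) * z" for z :: real using that kn
      by (simp add: d_def pos_divide_le_eq mult.commute)
    have gap: "d \<le> u n (i + 1) - u n i" if "i \<in> {1..m n - 1}" for i
      by (rule dk) (use g that in \<open>simp add: Good_def\<close>)
    have "d \<le> min (u n 1) (1 - u n (m n))" by (rule dk) (use g in \<open>simp add: Good_def\<close>)
    then have bd: "d \<le> u n 1" "d \<le> 1 - u n (m n)" by auto
    have spacing1: "d \<le> \<bar>u n l - u n i\<bar>" if "i \<in> {1..m n}" "l \<in> {1..m n}" "l \<noteq> i" for i l
      by (rule grid_spacing(1)[where m = "m n"]) (fact grid_mono[OF n] gap bd that)+
    have spacing2: "d \<le> u n i \<and> u n i + d \<le> 1" if "i \<in> {1..m n}" for i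
      by (rule grid_spacing(2)[where m = "m n"]) (fact grid_mono[OF n] gap bd that)+
    have Bn: "4 * CARD('d) * (CARD('d) * m n) / (d * c0) = B n"
      using kn c f(3) by (simp add: B_def C_def d_def k_def power2_eq_square field_simps)
    note rb = rate_bounds[OF k1[OF n] n C, folded r_def, folded B_def, folded \<epsilon>_def]
    have "B n \<le> 1 * n" using rb(1) g mult_right_mono[of "C * r n" 1 "real n"] unfolding Good_def by linarith
    then have BN: "4 * CARD('d) * (CARD('d) * m n) / (d * c0) \<le> n" unfolding Bn by simp
    have eps: "sqrt (4 * CARD('d) * (CARD('d) * m n) / (d * c0)) * (CARD('d) * m n) / sqrt n
      + (real (CARD('d) * m n))\<^sup>2 / n \<le> 1/2"
      unfolding Bn using rb(2) g unfolding Good_def \<epsilon>_def k_def by linarith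
    have "\<exists>T G. T \<in> borel_measurable M \<and> G \<in> sets M \<and> measure M G \<ge> 1 - 2 / k n
      \<and> near_gaussian M T (8 / sqrt (k n) + 70 * B n * k n / sqrt n)
      \<and> (\<forall>\<omega>\<in>G. invertible_mat (S n \<omega>) \<and> \<bar>Tquad n \<omega> - T \<omega>\<bar> \<le> 2 * \<epsilon> n * (real (k n))\<^sup>2 / sqrt (2 * real (k n)))"
      unfolding Bn[symmetric] \<epsilon>_def S_def Tquad_def F_def k_def
      by (rule exists_gaussian_approximation[where g = "u n" and \<delta> = d and f = f and ?c0.0 = c0 and P = P
        and m = "m n"])
         (fact M indep law n grid_nonempty[OF n] grid_mono[OF n] grid_range[OF n] d
          spacing1 spacing2 Omega Pf f BN eps)+
    then obtain T G where TG: "T \<in> borel_measurable M" "G \<in> sets M" "measure M G \<ge> 1 - 2 / k n"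
      and ng: "near_gaussian M T (8 / sqrt (k n) + 70 * B n * k n / sqrt n)"
      and close: "\<forall>\<omega>\<in>G. invertible_mat (S n \<omega>) \<and> \<bar>Tquad n \<omega> - T \<omega>\<bar>
        \<le> 2 * \<epsilon> n * (real (k n))\<^sup>2 / sqrt (2 * real (k n))"
      by (elim exE conjE) (rule that)
    have "near_gaussian M T (err n)"
      using ng by (rule near_gaussian_mono) (use rb(4) in \<open>simp add: err_def\<close>)
    moreover have "invertible_mat (S n \<omega>) \<and> \<bar>Tquad n \<omega> - T \<omega>\<bar> \<le> \<delta> n" if "\<omega> \<in> G" for \<omega>
      using bspec[OF close that] rb(3) unfolding \<delta>_def by linarith
    ultimately have "Pr n T G" unfolding Pr_def using TG by blast
    then show ?thesis by blast
  qed
  then obtain T0 G0 where Pr: "\<And>n. Good n \<Longrightarrow> Pr n (T0 n) (G0 n)" by metis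
  have TG0: "T0 n \<in> borel_measurable M" "G0 n \<in> sets M" "measure M (G0 n) \<ge> 1 - 2 / k n"
      "near_gaussian M (T0 n) (err n)"
      "\<omega> \<in> G0 n \<Longrightarrow> invertible_mat (S n \<omega>) \<and> \<bar>Tquad n \<omega> - T0 n \<omega>\<bar> \<le> \<delta> n" if "Good n" for n \<omega>
    using Pr[OF that] unfolding Pr_def by (blast, blast, blast, blast, blast)
  \<comment> \<open>Defaults for the finitely many other \<open>n\<close>:
    \<open>prob_sandwich\<close> asks for measurability at every \<open>n\<close>, and an empty
    \<open>G n\<close> makes every claim on it hold trivially.\<close>
  define T where "T n = (if Good n then T0 n else (\<lambda>_. 0))" for n
  define G where "G n = (if Good n then G0 n else {})" for n
  have T: "T n \<in> borel_measurable M" for n using TG0(1) by (simp add: T_def)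
  have G: "G n \<in> sets M" for n using TG0(2) by (simp add: G_def)
  have G_T: "invertible_mat (S n \<omega>) \<and> \<bar>Tquad n \<omega> - T n \<omega>\<bar> \<le> \<delta> n" if "\<omega> \<in> G n" for n \<omega>
    using that TG0(5) by (auto simp: G_def T_def split: if_splits)
  have G_n: "n \<ge> 1" if "\<omega> \<in> G n" for n \<omega> using that by (auto simp: G_def Good_def split: if_splits)
  have k_inv: "(\<lambda>n. 1 - 2 / real (k n)) \<longlonglongrightarrow> 1 - 0"
    by (intro tendsto_intros tendsto_divide_0[OF tendsto_const] filterlim_at_top_imp_at_infinity
          filterlim_compose[OF filterlim_real_sequentially] k_lim)
  have "eventually (\<lambda>n. 1 - 2 / k n \<le> measure M (G n)) sequentially"
    using Good by eventually_elim (simp add: G_def TG0(3))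
  then have G1: "(\<lambda>n. measure M (G n)) \<longlonglongrightarrow> 1"
    by (rule tendsto_sandwich[OF _ _ k_inv[simplified] tendsto_const]) simp
  have lim: "(\<lambda>n. measure M {\<omega> \<in> space M. T n \<omega> \<le> s}) \<longlonglongrightarrow> cdf std_normal_distribution s" for s
  proof (rule cdf_convergence_of_near_gaussian[OF T _ err0])
    show "eventually (\<lambda>n. near_gaussian M (T n) (err n)) sequentially"
      by (rule eventually_mono[OF Good]) (use TG0(4) in \<open>simp add: T_def\<close>)
  qed

  \<comment> \<open>Measurability of the statistics\<close>
  have X': "X i \<in> measurable M borel" if "i \<in> {1..n}" for i n using that by (intro X) simp
  have meas: "{\<omega> \<in> space M. p \<omega>} \<in> sets M"
    if p: "\<And>\<omega> \<omega>'. (\<And>i h. i \<in> {1..n} \<Longrightarrow> h \<in> F n \<Longrightarrow> h (X i \<omega>) = h (X i \<omega>')) \<Longrightarrow> p \<omega> = p \<omega>'" for n and p :: "'w \<Rightarrow> bool"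
  proof -
    have "{\<omega> \<in> space M. p \<omega> \<in> {True}} \<in> sets M"
      by (rule finite_data_measurable[where F = "F n" and n = n and X = X and g = p])
         (fact finF Fm X' p)+
    then show ?thesis by simp
  qed
  have data: "S n \<omega> = S n \<omega>'" "Tquad n \<omega> = Tquad n \<omega>'" "Tchi n \<omega> = Tchi n \<omega>'"
    if *: "\<And>i h. i \<in> {1..n} \<Longrightarrow> h \<in> F n \<Longrightarrow> h (X i \<omega>) = h (X i \<omega>')" for n \<omega> \<omega>'
  proof -
    show "S n \<omega> = S n \<omega>'" unfolding S_def by (rule emp_cov_cong[OF finF]) (rule *)
    moreover have "gamma_vec P n (\<lambda>i. X i \<omega>) (F n) = gamma_vec P n (\<lambda>i. X i \<omega>') (F n)"
      by (rule gamma_vec_cong[OF finF]) (rule *)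
    ultimately show "Tquad n \<omega> = Tquad n \<omega>'" unfolding Tquad_def by simp
    have "chi_sq n (\<lambda>i. X i \<omega>) (F n) = chi_sq n (\<lambda>i. X i \<omega>') (F n)" by (rule chi_sq_cong[OF finF]) (rule *)
    then show "Tchi n \<omega> = Tchi n \<omega>'" unfolding Tchi_def by simp
  qed
  have S_meas: "{\<omega> \<in> space M. invertible_mat (S n \<omega>)} \<in> sets M" for n
    by (rule meas[of n], rule arg_cong[where f = invertible_mat], rule data(1))
  have Tquad_meas: "{\<omega> \<in> space M. Tquad n \<omega> \<in> A} \<in> sets M" for n A
    by (rule meas[of n], rule arg_cong[where f = "\<lambda>z. z \<in> A"], rule data(2))
  have Tchi_meas: "{\<omega> \<in> space M. Tchi n \<omega> \<in> A} \<in> sets M" for n A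
    by (rule meas[of n], rule arg_cong[where f = "\<lambda>z. z \<in> A"], rule data(3))

  \<comment> \<open>The identity of the two statistics and the limits\<close>
  have eq: "Tchi n \<omega> = ereal (Tquad n \<omega>)" if n: "n \<ge> 1" and inv: "invertible_mat (S n \<omega>)" for n \<omega>
  proof -
    interpret Q: prob_space "Q0 :: (real^'d) measure" by (rule prob_space_Q0)
    have "ereal n * chi_sq n (\<lambda>i. X i \<omega>) (F n)
      = ereal (inv_quad_form (S n \<omega>) (gamma_vec P n (\<lambda>i. X i \<omega>) (F n)))"
      unfolding S_def
    proof (rule chi_sq_eq_inv_quad_form[OF n finF prob_space_Q0])
      fix h assume h: "h \<in> F n"
      have "norm (h y) \<le> 1" for y using Fm(2)[OF h, of y] by auto
      then show "integrable Q0 h" using Fm(1)[OF h]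
        by (intro Q.integrable_const_bound[where B = 1] AE_I2)
          (simp_all add: measurable_cong_sets[OF sets_Q0 refl])
      obtain i j where "i \<in> {1..m n}" "h = half_ind (u n i) j" using h unfolding F_def ind_class_def by blast
      then show "(\<integral>y. h y \<partial>Q0) = (\<integral>y. h y \<partial>P)"
        using grid_range[OF n] by (simp add: integral_half_ind_Q0 integral_half_ind_Omega[OF Omega])
    qed (use inv in \<open>simp add: S_def\<close>)
    moreover have "sqrt (2 * real (k n)) > 0" using k1[OF n] by simp
    ultimately show ?thesis unfolding Tchi_def Tquad_def by simp
  qed
  have inv_lim: "(\<lambda>n. measure M {\<omega> \<in> space M. invertible_mat (S n \<omega>)}) \<longlonglongrightarrow> 1"
  proof (rule tendsto_sandwich[OF _ _ G1 tendsto_const])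
    have "G n \<subseteq> {\<omega> \<in> space M. invertible_mat (S n \<omega>)}" for n
      using sets.sets_into_space[OF G] G_T by blast
    then show "eventually (\<lambda>n. measure M (G n) \<le> measure M {\<omega> \<in> space M. invertible_mat (S n \<omega>)}) sequentially"
      by (intro always_eventually allI finite_measure_mono S_meas)
  qed simp
  have quad_lim: "(\<lambda>n. measure M {\<omega> \<in> space M. Tquad n \<omega> \<le> t}) \<longlonglongrightarrow> cdf std_normal_distribution t" for t
  proof (rule prob_sandwich[OF T lim isCont_cdf_std_normal G G1 _ \<delta>0])
    show "{\<omega> \<in> space M. Tquad n \<omega> \<le> t} \<in> sets M" for n using Tquad_meas[of n "{..t}"] by simp
    show "eventually (\<lambda>n. \<forall>\<omega>\<in>G n. T n \<omega> \<le> t - \<delta> n \<longrightarrow> \<omega> \<in> {\<omega> \<in> space M. Tquad n \<omega> \<le> t}) sequentially"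
      using G_T sets.sets_into_space[OF G]
        by (intro always_eventually allI ballI impI) (fastforce simp: abs_le_iff)
    show "eventually (\<lambda>n. \<forall>\<omega>\<in>G n. \<omega> \<in> {\<omega> \<in> space M. Tquad n \<omega> \<le> t} \<longrightarrow> T n \<omega> \<le> t + \<delta> n) sequentially"
      using G_T by (intro always_eventually allI ballI impI) (fastforce simp: abs_le_iff)
  qed
  have chi_lim: "(\<lambda>n. measure M {\<omega> \<in> space M. Tchi n \<omega> \<le> ereal t}) \<longlonglongrightarrow> cdf std_normal_distribution t" for t
  proof (rule prob_sandwich[OF T lim isCont_cdf_std_normal G G1 _ \<delta>0])
    show "{\<omega> \<in> space M. Tchi n \<omega> \<le> ereal t} \<in> sets M" for n using Tchi_meas[of n "{..ereal t}"] by simp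
    \<comment> \<open>On \<open>G n\<close> the covariance matrix is invertible, so
      \<open>Tchi\<close> is finite there and inherits the comparison with \<open>T n\<close> from
      \<open>Tquad\<close>.\<close>
    have e: "Tchi n \<omega> = ereal (Tquad n \<omega>)" if "\<omega> \<in> G n" for n \<omega> using eq G_T G_n that by blast
    show "eventually (\<lambda>n. \<forall>\<omega>\<in>G n. T n \<omega> \<le> t - \<delta> n \<longrightarrow> \<omega> \<in> {\<omega> \<in> space M. Tchi n \<omega> \<le> ereal t}) sequentially"
      using G_T sets.sets_into_space[OF G]
        by (intro always_eventually allI ballI impI) (fastforce simp: abs_le_iff e)
    show "eventually (\<lambda>n. \<forall>\<omega>\<in>G n. \<omega> \<in> {\<omega> \<in> space M. Tchi n \<omega> \<le> ereal t} \<longrightarrow> T n \<omega> \<le> t + \<delta> n) sequentially"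
      using G_T by (intro always_eventually allI ballI impI) (fastforce simp: abs_le_iff e)
  qed
  have "cdf (distr M borel (Tquad n)) t = measure M {\<omega> \<in> space M. Tquad n \<omega> \<le> t}" for n t
  proof -
    have "Tquad n \<in> borel_measurable M"
      by (rule measurableI) (use Tquad_meas in \<open>auto simp: vimage_def Int_def conj_commute\<close>)
    then show ?thesis
      unfolding cdf_def by (subst measure_distr) (auto intro!: arg_cong[where f = "measure M"])
  qed
  then have "weak_conv_m (\<lambda>n. distr M borel (Tquad n)) std_normal_distribution"
    unfolding weak_conv_m_def weak_conv_def using quad_lim by simp
  then show ?thesis using eq inv_lim chi_lim by blast
qed

end
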